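(* (1) Let $M$ be a simply connected Riemann surface and let $f:M\to\mathbb{C}^2\cong\mathbb{R}^4$ be a complex curve (holomorphic immersion) without flex points. Then $f$ is a totally umbilic elliptic Lagrangian immersion. (2) Conversely, let $M$ be a connected, simply connected, oriented smooth surface and let $f:M\to\mathbb{R}^4$ be a totally umbilic elliptic Lagrangian immersion. Then there exists an affine symplectic transformation $\mathcal{D}\in\mathcal{S}(4,\mathbb{R})$ such that $\mathcal{D}\cdot f$ is a complex curve in $\mathbb{C}^2\cong\mathbb{R}^4$ without flex points (with respect to the complex structure on $M$ induced by $f$).
   Context: Identification. $\mathbb{R}^4$ is identified with $\mathbb{C}^2$ by ${}^t(x^1,x^2,x^3,x^4)\mapsto{}^t(x^1-ix^2,\;x^3+ix^4)$. A point $q\in M$ is a flex point of a holomorphic immersion $f:M\to\mathbb{C}^2$ if $f_z|_q\wedge f_{zz}|_q=0$ for $z$ a local holomorphic coordinate on $M$. Symplectic group. $\mathbb{R}^4$ carries the symplectic form $\Omega(X,Y)={}^tXJY$, $J=\begin{pmatrix}0&I_2\\-I_2&0\end{pmatrix}$. $\mathrm{Sp}(4,\mathbb{R})=\{\mathbf{X}\in\mathrm{GL}(4,\mathbb{R}):{}^t\mathbf{X}J\mathbf{X}=J\}$. The affine symplectic group $\mathcal{S}(4,\mathbb{R})=\mathbb{R}^4\rtimes\mathrm{Sp}(4,\mathbb{R})$ consists of the matrices $\mathbf{S}(P,\mathbf{X})=\begin{pmatrix}1&0\\P&\mathbf{X}\end{pmatrix}$, $P\in\mathbb{R}^4$, $\mathbf{X}\in\mathrm{Sp}(4,\mathbb{R})$,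 acting on $\mathbb{R}^4$ by $v\mapsto P+\mathbf{X}v$. Lagrangian immersions. Let $M$ be oriented (a Riemann surface is oriented by its complex structure). A smooth immersion $f:M\to\mathbb{R}^4$ is Lagrangian if $f^*\Omega=0$. Its Gauss map $\mathcal{T}_f$ sends $q$ to the plane $df(T_qM)$, translated to the origin, with the orientation OPPOSITE to the one induced by $df$ from $M$; it takes values in the manifold $\Lambda_2^+$ of oriented Lagrangian 2-planes. A symplectic frame field along $f$ on an open connected set $U\subset M$ is a smooth map $\mathbf{S}=\mathbf{S}(f,\mathbf{X}):U\to\mathcal{S}(4,\mathbb{R})$; write $X_1,\dots,X_4$ for the columns of $\mathbf{X}$. Define real 1-forms on $U$ by $df=\sum_j\tau^jX_j$, $dX_j=\sum_i\theta^i_jX_i$, with $\theta=\begin{pmatrix}\alpha&\beta\\\gamma&-{}^t\alpha\end{pmatrix}$, where $\alpha=(\alpha^i_j)$ is $2\times2$ ($i$ row, $j$ column) and $\beta=(\beta^i_j)$, $\gamma=(\gamma^i_j)$ are symmetric $2\times2$. The frame is of first order if $\mathcal{T}_f=[X_1\wedge X_2]$ as oriented planes (equivalently $\tau^3=\tau^4=0$ and $\tau^1\wedge\tau^2<0$). $f$ is elliptic if its Gauss map is a spacelike immersion for the natural signature $(2,1)$ conformal structure of $\Lambda_2^+$, i.e. if for first order frames the quadratic form $g=-\gamma^1_1\gamma^2_2+(\gamma^2_1)^2$ is positive definite. The conformal class of $g$ does not depend on the first order frame; with the orientation of $M$ it defines the complex structure on $M$ induced by $f$. Higher order frames. A first order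 frame is of second order if $\gamma^1_1+\gamma^2_2=0$. For such a frame put $\omega=\tfrac12(\gamma^1_1-\gamma^2_2)+i\gamma^2_1$, $\tau=\tau^1-i\tau^2$, $\eta=\tfrac12(\alpha^1_1-\alpha^2_2)-\tfrac i2(\alpha^2_1+\alpha^1_2)$. Then $\omega$ is a nowhere zero $(1,0)$-form, $\tau=t\omega$ with $t$ nowhere zero complex-valued, and $\eta=h\omega+\ell\bar\omega$ with $h$ complex-valued and $\ell$ real-valued. The frame is of third order if $\ell=0$. Second and third order frames exist locally. Total umbilicity. The normalized Hopf differential $\mathcal{H}=|t|^{2/3}\eta\,\omega$, computed with any third order frame, is independent of the choice of frame and globally defined on $M$. An elliptic Lagrangian immersion $f$ is totally umbilic if $\mathcal{H}$ vanishes identically (equivalently $h\equiv0$ for third order frames). *)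

theory Defs
  imports "HOL-Analysis.Analysis"
begin

section \<open>Smooth maps between normed spaces\<close>

text \<open>For open \<open>S\<close> in a finite-dimensional space: all partial derivatives up to order \<open>k\<close>
  exist and are continuous.\<close>

primrec Ck_on :: "nat \<Rightarrow> 'a::real_normed_vector set \<Rightarrow> ('a \<Rightarrow> 'b::real_normed_vector) \<Rightarrow> bool" where
  "Ck_on 0 S f \<longleftrightarrow> continuous_on S f"
| "Ck_on (Suc k) S f \<longleftrightarrow>
     (\<forall>x\<in>S. f differentiable (at x)) \<and> (\<forall>v. Ck_on k S (\<lambda>x. frechet_derivative f (at x) v))"

definition smooth_on :: "'a::real_normed_vector set \<Rightarrow> ('a \<Rightarrow> 'b::real_normed_vector) \<Rightarrow> bool" where
  "smooth_on S f \<longleftrightarrow> (\<forall>k. Ck_on k S f)"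


section \<open>Surfaces\<close>

text \<open>The underlying space of a surface is a whole (Hausdorff) type. A surface is given by an
  atlas, and the plane in which the charts take their values is \<open>complex\<close>.\<close>

type_synonym 'a chart = "'a set \<times> ('a \<Rightarrow> complex)"

abbreviation chart_dom :: "'a chart \<Rightarrow> 'a set" where
  "chart_dom c \<equiv> fst c"

abbreviation chart_inv :: "'a chart \<Rightarrow> complex \<Rightarrow> 'a" where
  "chart_inv c \<equiv> inv_into (fst c) (snd c)"

definition is_chart :: "'a::topological_space chart \<Rightarrow> bool" where
  "is_chart c \<longleftrightarrow> open (chart_dom c) \<and> open (snd c ` chart_dom c) \<and>
     homeomorphism (chart_dom c) (snd c ` chart_dom c) (snd c) (chart_inv c)"

definition transition_dom :: "'a chart \<Rightarrow> 'a chart \<Rightarrow> complex set" where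
  "transition_dom c d = snd c ` (chart_dom c \<inter> chart_dom d)"

definition transition :: "'a chart \<Rightarrow> 'a chart \<Rightarrow> complex \<Rightarrow> complex" where
  "transition c d = snd d \<circ> chart_inv c"

text \<open>Determinant of a real-linear endomorphism of the plane.\<close>

definition plane_det :: "(complex \<Rightarrow> complex) \<Rightarrow> real" where
  "plane_det L = Re (L 1) * Im (L \<i>) - Im (L 1) * Re (L \<i>)"

definition oriented_transition :: "'a chart \<Rightarrow> 'a chart \<Rightarrow> bool" where
  "oriented_transition c d \<longleftrightarrow> smooth_on (transition_dom c d) (transition c d) \<and>
     (\<forall>z\<in>transition_dom c d. 0 < plane_det (frechet_derivative (transition c d) (at z)))"

definition oriented_surface :: "'a::t2_space chart set \<Rightarrow> bool" where
  "oriented_surface A \<longleftrightarrow> (\<forall>c\<in>A. is_chart c) \<and> \<Union> (chart_dom ` A) = UNIV \<and>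
     (\<forall>c\<in>A. \<forall>d\<in>A. oriented_transition c d)"

text \<open>A holomorphic atlas also serves as the oriented smooth atlas underlying it. Second
  countability is not required here: it is automatic for connected Riemann surfaces.\<close>

definition riemann_surface :: "'a::t2_space chart set \<Rightarrow> bool" where
  "riemann_surface A \<longleftrightarrow> (\<forall>c\<in>A. is_chart c) \<and> \<Union> (chart_dom ` A) = UNIV \<and>
     (\<forall>c\<in>A. \<forall>d\<in>A. transition c d holomorphic_on transition_dom c d)"

text \<open>Tangent vectors at \<open>q\<close> and forms on them are handled through their coordinate expressions:
  \<open>v :: complex\<close> stands for the tangent vector at \<open>q\<close> having coordinates \<open>v\<close> in the chart \<open>c\<close>,
  and the arguments \<open>c\<close>, \<open>q\<close>, \<open>v\<close> of a form below denote its value at \<open>q\<close> on that vector.\<close>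

definition dif :: "'a chart \<Rightarrow> ('a \<Rightarrow> 'b::real_normed_vector) \<Rightarrow> 'a \<Rightarrow> complex \<Rightarrow> 'b" where
  "dif c F q v = frechet_derivative (F \<circ> chart_inv c) (at (snd c q)) v"

definition smooth_on_surface ::
    "'a chart set \<Rightarrow> 'a set \<Rightarrow> ('a \<Rightarrow> 'b::real_normed_vector) \<Rightarrow> bool" where
  "smooth_on_surface A U F \<longleftrightarrow>
     (\<forall>c\<in>A. smooth_on (snd c ` (chart_dom c \<inter> U)) (F \<circ> chart_inv c))"


section \<open>Complex curves and flex points\<close>

definition to_C2 :: "real^4 \<Rightarrow> complex^2" where
  "to_C2 x = vector [Complex (x$1) (- x$2), Complex (x$3) (x$4)]"

text \<open>The derivatives \<open>f\<^sub>z\<close> and \<open>f\<^sub>z\<^sub>z\<close> in the local coordinate \<open>z = snd c\<close>.\<close>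

definition curve_z :: "'a chart \<Rightarrow> ('a \<Rightarrow> complex^2) \<Rightarrow> 'a \<Rightarrow> complex^2" where
  "curve_z c F q = (\<chi> i. deriv (\<lambda>z. F (chart_inv c z) $ i) (snd c q))"

definition curve_zz :: "'a chart \<Rightarrow> ('a \<Rightarrow> complex^2) \<Rightarrow> 'a \<Rightarrow> complex^2" where
  "curve_zz c F q = (\<chi> i. deriv (deriv (\<lambda>z. F (chart_inv c z) $ i)) (snd c q))"

definition complex_curve :: "'a chart set \<Rightarrow> ('a \<Rightarrow> complex^2) \<Rightarrow> bool" where
  "complex_curve A F \<longleftrightarrow>
     (\<forall>c\<in>A. (\<forall>i. (\<lambda>z. F (chart_inv c z) $ i) holomorphic_on snd c ` chart_dom c) \<and>
            (\<forall>q\<in>chart_dom c. curve_z c F q \<noteq> 0))"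

definition wedge2 :: "complex^2 \<Rightarrow> complex^2 \<Rightarrow> complex" where
  "wedge2 a b = a$1 * b$2 - a$2 * b$1"

definition flex_point :: "'a chart set \<Rightarrow> ('a \<Rightarrow> complex^2) \<Rightarrow> 'a \<Rightarrow> bool" where
  "flex_point A F q \<longleftrightarrow>
     (\<exists>c\<in>A. q \<in> chart_dom c \<and> wedge2 (curve_z c F q) (curve_zz c F q) = 0)"


section \<open>The affine symplectic group\<close>

definition J4 :: "real^4^4" where
  "J4 = (\<chi> i j. if (i, j) \<in> {(1, 3), (2, 4)} then 1
               else if (i, j) \<in> {(3, 1), (4, 2)} then -1 else 0)"

definition Omega :: "real^4 \<Rightarrow> real^4 \<Rightarrow> real" where
  "Omega x y = x \<bullet> (J4 *v y)"

definition Sp4 :: "(real^4^4) set" where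
  "Sp4 = {X. invertible X \<and> transpose X ** J4 ** X = J4}"

text \<open>The pair \<open>(P, X)\<close> stands for the matrix \<open>S(P, X)\<close>.\<close>

definition affine_symplectic :: "((real^4) \<times> (real^4^4)) set" where
  "affine_symplectic = UNIV \<times> Sp4"

definition affine_act :: "(real^4) \<times> (real^4^4) \<Rightarrow> real^4 \<Rightarrow> real^4" where
  "affine_act D v = fst D + snd D *v v"


section \<open>Lagrangian immersions and first order frames\<close>

definition lagrangian_immersion :: "'a chart set \<Rightarrow> ('a \<Rightarrow> real^4) \<Rightarrow> bool" where
  "lagrangian_immersion A f \<longleftrightarrow> smooth_on_surface A UNIV f \<and>
     (\<forall>c\<in>A. \<forall>q\<in>chart_dom c. inj (dif c f q) \<and> (\<forall>v w. Omega (dif c f q v) (dif c f q w) = 0))"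

text \<open>For independent \<open>x\<close>, \<open>y\<close>, the oriented plane \<open>[x \<and> y]\<close>, represented by the set of its
  positively oriented bases.\<close>

definition oriented_plane :: "real^4 \<Rightarrow> real^4 \<Rightarrow> ((real^4) \<times> (real^4)) set" where
  "oriented_plane x y =
     {(a *\<^sub>R x + b *\<^sub>R y, c *\<^sub>R x + d *\<^sub>R y) | a b c d. a * d - b * c > 0}"

text \<open>The basis \<open>(1, \<i>)\<close> of coordinate vectors is positively oriented; exchanging the two
  vectors gives the opposite orientation.\<close>

definition gauss_map :: "'a chart \<Rightarrow> ('a \<Rightarrow> real^4) \<Rightarrow> 'a \<Rightarrow> ((real^4) \<times> (real^4)) set" where
  "gauss_map c f q = oriented_plane (dif c f q \<i>) (dif c f q 1)"

text \<open>A symplectic frame field \<open>S(f, X)\<close> along \<open>f\<close> is determined by its linear part \<open>X\<close>.\<close>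

definition symplectic_frame ::
    "'a::topological_space chart set \<Rightarrow> 'a set \<Rightarrow> ('a \<Rightarrow> real^4^4) \<Rightarrow> bool" where
  "symplectic_frame A U X \<longleftrightarrow>
     open U \<and> connected U \<and> smooth_on_surface A U X \<and> (\<forall>q\<in>U. X q \<in> Sp4)"

text \<open>\<open>df = X \<tau>\<close> and \<open>dX = X \<theta>\<close>, where \<open>\<alpha>\<close> and \<open>\<gamma>\<close> are the upper left and lower left blocks of
  \<open>\<theta>\<close>: in particular \<open>\<gamma>\<^sup>i\<^sub>j\<close> is the entry \<open>(i + 2, j)\<close>.\<close>

definition frame_tau ::
    "'a chart \<Rightarrow> ('a \<Rightarrow> real^4) \<Rightarrow> ('a \<Rightarrow> real^4^4) \<Rightarrow> 'a \<Rightarrow> complex \<Rightarrow> real^4" where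
  "frame_tau c f X q v = matrix_inv (X q) *v dif c f q v"

definition frame_theta ::
    "'a chart \<Rightarrow> ('a \<Rightarrow> real^4^4) \<Rightarrow> 'a \<Rightarrow> complex \<Rightarrow> real^4^4" where
  "frame_theta c X q v = matrix_inv (X q) ** dif c X q v"

abbreviation gamma11 :: "'a chart \<Rightarrow> ('a \<Rightarrow> real^4^4) \<Rightarrow> 'a \<Rightarrow> complex \<Rightarrow> real" where
  "gamma11 c X q v \<equiv> frame_theta c X q v $ 3 $ 1"

abbreviation gamma21 :: "'a chart \<Rightarrow> ('a \<Rightarrow> real^4^4) \<Rightarrow> 'a \<Rightarrow> complex \<Rightarrow> real" where
  "gamma21 c X q v \<equiv> frame_theta c X q v $ 4 $ 1"

abbreviation gamma22 :: "'a chart \<Rightarrow> ('a \<Rightarrow> real^4^4) \<Rightarrow> 'a \<Rightarrow> complex \<Rightarrow> real" where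
  "gamma22 c X q v \<equiv> frame_theta c X q v $ 4 $ 2"

definition first_order_frame ::
    "'a::topological_space chart set \<Rightarrow> ('a \<Rightarrow> real^4) \<Rightarrow> 'a set \<Rightarrow> ('a \<Rightarrow> real^4^4) \<Rightarrow> bool" where
  "first_order_frame A f U X \<longleftrightarrow> symplectic_frame A U X \<and>
     (\<forall>c\<in>A. \<forall>q\<in>U \<inter> chart_dom c.
        gauss_map c f q = oriented_plane (column 1 (X q)) (column 2 (X q)))"

definition frame_g :: "'a chart \<Rightarrow> ('a \<Rightarrow> real^4^4) \<Rightarrow> 'a \<Rightarrow> complex \<Rightarrow> real" where
  "frame_g c X q v = - gamma11 c X q v * gamma22 c X q v + (gamma21 c X q v)\<^sup>2"

definition elliptic :: "'a::topological_space chart set \<Rightarrow> ('a \<Rightarrow> real^4) \<Rightarrow> bool" where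
  "elliptic A f \<longleftrightarrow> lagrangian_immersion A f \<and>
     (\<forall>U X. first_order_frame A f U X \<longrightarrow>
        (\<forall>c\<in>A. \<forall>q\<in>U \<inter> chart_dom c. \<forall>v. v \<noteq> 0 \<longrightarrow> frame_g c X q v > 0))"

text \<open>The complex structure induced by \<open>f\<close>, as its full holomorphic atlas: all oriented smooth
  charts \<open>d\<close> of the surface in which \<open>g\<close> is a positive multiple of \<open>|dz|\<^sup>2\<close>, \<open>z = snd d\<close>.\<close>

definition induced_structure ::
    "'a::topological_space chart set \<Rightarrow> ('a \<Rightarrow> real^4) \<Rightarrow> 'a chart set" where
  "induced_structure A f = {d. is_chart d \<and>
     (\<forall>c\<in>A. oriented_transition c d \<and> oriented_transition d c) \<and>
     (\<forall>U X. first_order_frame A f U X \<longrightarrow>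
        (\<forall>c\<in>A. \<forall>q\<in>U \<inter> chart_dom c \<inter> chart_dom d.
           \<exists>r>0. \<forall>v. frame_g c X q v = r * (cmod (dif c (snd d) q v))\<^sup>2))}"


section \<open>Higher order frames and total umbilicity\<close>

definition second_order_frame ::
    "'a::topological_space chart set \<Rightarrow> ('a \<Rightarrow> real^4) \<Rightarrow> 'a set \<Rightarrow> ('a \<Rightarrow> real^4^4) \<Rightarrow> bool" where
  "second_order_frame A f U X \<longleftrightarrow> first_order_frame A f U X \<and>
     (\<forall>c\<in>A. \<forall>q\<in>U \<inter> chart_dom c. \<forall>v. gamma11 c X q v + gamma22 c X q v = 0)"

definition frame_omega :: "'a chart \<Rightarrow> ('a \<Rightarrow> real^4^4) \<Rightarrow> 'a \<Rightarrow> complex \<Rightarrow> complex" where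
  "frame_omega c X q v = Complex ((gamma11 c X q v - gamma22 c X q v) / 2) (gamma21 c X q v)"

definition frame_tau_cx ::
    "'a chart \<Rightarrow> ('a \<Rightarrow> real^4) \<Rightarrow> ('a \<Rightarrow> real^4^4) \<Rightarrow> 'a \<Rightarrow> complex \<Rightarrow> complex" where
  "frame_tau_cx c f X q v = Complex (frame_tau c f X q v $ 1) (- (frame_tau c f X q v $ 2))"

definition frame_eta :: "'a chart \<Rightarrow> ('a \<Rightarrow> real^4^4) \<Rightarrow> 'a \<Rightarrow> complex \<Rightarrow> complex" where
  "frame_eta c X q v =
     Complex ((frame_theta c X q v $ 1 $ 1 - frame_theta c X q v $ 2 $ 2) / 2)
             (- (frame_theta c X q v $ 2 $ 1 + frame_theta c X q v $ 1 $ 2) / 2)"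

text \<open>The function \<open>t\<close> with \<open>\<tau> = t \<omega>\<close>.\<close>

definition frame_t :: "'a chart \<Rightarrow> ('a \<Rightarrow> real^4) \<Rightarrow> ('a \<Rightarrow> real^4^4) \<Rightarrow> 'a \<Rightarrow> complex" where
  "frame_t c f X q = (THE t. \<forall>v. frame_tau_cx c f X q v = t * frame_omega c X q v)"

text \<open>\<open>\<eta> = h \<omega> + \<ell> \<omega>\<close>-bar at \<open>q\<close>, with \<open>\<ell>\<close> real.\<close>

definition eta_coeffs ::
    "'a chart \<Rightarrow> ('a \<Rightarrow> real^4^4) \<Rightarrow> 'a \<Rightarrow> complex \<Rightarrow> real \<Rightarrow> bool" where
  "eta_coeffs c X q h l \<longleftrightarrow>
     (\<forall>v. frame_eta c X q v = h * frame_omega c X q v + of_real l * cnj (frame_omega c X q v))"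

definition third_order_frame ::
    "'a::topological_space chart set \<Rightarrow> ('a \<Rightarrow> real^4) \<Rightarrow> 'a set \<Rightarrow> ('a \<Rightarrow> real^4^4) \<Rightarrow> bool" where
  "third_order_frame A f U X \<longleftrightarrow> second_order_frame A f U X \<and>
     (\<forall>c\<in>A. \<forall>q\<in>U \<inter> chart_dom c. \<exists>h. eta_coeffs c X q h 0)"

text \<open>The normalized Hopf differential \<open>|t|\<^sup>2\<^sup>/\<^sup>3 \<eta> \<omega>\<close> of a frame, as a quadratic form.\<close>

definition hopf ::
    "'a chart \<Rightarrow> ('a \<Rightarrow> real^4) \<Rightarrow> ('a \<Rightarrow> real^4^4) \<Rightarrow> 'a \<Rightarrow> complex \<Rightarrow> complex" where
  "hopf c f X q v =
     of_real (cmod (frame_t c f X q) powr (2 / 3)) * frame_eta c X q v * frame_omega c X q v"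

definition totally_umbilic :: "'a::topological_space chart set \<Rightarrow> ('a \<Rightarrow> real^4) \<Rightarrow> bool" where
  "totally_umbilic A f \<longleftrightarrow> elliptic A f \<and>
     (\<forall>U X. third_order_frame A f U X \<longrightarrow>
        (\<forall>c\<in>A. \<forall>q\<in>U \<inter> chart_dom c. \<forall>v. hopf c f X q v = 0))"

end

theory Submission
  imports Defs "HOL-Complex_Analysis.Cauchy_Integral_Formula"
begin

text \<open>Since \<open>\<Omega>\<close> is the real part of \<open>dz\<^sub>1 \<and> dz\<^sub>2\<close>, complex curves are Lagrangian. If the first two columns
  of a first order frame along a complex curve are \<open>a\<^sub>i f\<^sub>z\<close>, then \<open>\<gamma>\<^sup>i\<^sub>j = Re (a\<^sub>i a\<^sub>j (f\<^sub>z \<and> f\<^sub>z\<^sub>z) dz)\<close>.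
  So \<open>g\<close> is \<open>|f\<^sub>z \<and> f\<^sub>z\<^sub>z|\<^sup>2 |dz|\<^sup>2\<close> up to a positive factor, the second order condition says
  \<open>a\<^sub>2 = - \<i> a\<^sub>1\<close>, and \<open>\<eta>\<close> is then a real multiple of the conjugate of \<open>\<omega>\<close>: it vanishes for third order frames.

  Conversely, if \<open>\<eta> = 0\<close> for a third order frame \<open>X\<close>, the structure equation for \<open>d\<alpha>\<close> gives
  \<open>\<beta>\<^sup>1\<^sub>1 + \<beta>\<^sup>2\<^sub>2 = 0\<close>. Then \<open>\<theta>\<close> commutes with the standard complex structure \<open>I\<close> of \<open>\<complex>\<^sup>2\<close>, so that
  \<open>K = X I X\<^sup>-\<^sup>1\<close> is locally constant. It does not depend on the frame: \<open>K\<close> is determined on the tangent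
  planes, and their derivatives span \<open>\<real>\<^sup>4\<close>. Hence \<open>K\<close> is constant on \<open>M\<close>, and the inverse of the frame at one
  point carries \<open>f\<close> to an immersion whose tangent planes are complex lines. A component of this
  immersion is a local coordinate conformal for \<open>g\<close>, so no general theorem on isothermal coordinates is
  needed, and flex points are excluded by the positivity of \<open>g\<close>.\<close>

section \<open>Smooth maps\<close>

text \<open>Total umbilicity speaks of all third order frames, so the converse has no content until
  such a frame is produced near every point. This is where ellipticity does its work: over a chart
  the matrices \<gamma>(v) form a plane of symmetric 2 x 2 matrices of negative determinant. Such a
  plane is orthogonal to a positive definite matrix, and a tangent basis adapted to that matrix
  makes \<gamma> trace-free. What then separates \<eta> from a multiple of \<omega> is one real
  function, because the exterior derivative of the second order condition kills the real part of
  \<eta> \<and> \<omega>; a shear of the last column removes it. The computations are made for four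
  vector functions on an open set of the plane, where the entries of \<theta> are \<Omega>-pairings
  and each integrability condition is the exterior derivative of an identity between pairings. The
  results are carried to the surface chart by chart: frames exist only locally, so conditions
  checked in one chart are transported to all others. The reversed orientation of the Gauss map fits
  the identification with C^2: it selects -i rather than i as the ratio of the two tangent
  columns.\<close>

definition ddir :: "('a::real_normed_vector \<Rightarrow> 'b::real_normed_vector) \<Rightarrow> 'a \<Rightarrow> 'a \<Rightarrow> 'b" where
  "ddir f v x = frechet_derivative f (at x) v"

lemma ddir_eq: "(f has_derivative F) (at x) \<Longrightarrow> ddir f v x = F v"
  unfolding ddir_def by (metis frechet_derivative_at)

lemma has_derivative_ddir: "f differentiable (at x) \<Longrightarrow> (f has_derivative (\<lambda>v. ddir f v x)) (at x)"
  unfolding ddir_def using frechet_derivative_works by (metis eta_contract_eq)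

lemma ddir_cong:
  assumes "open S" "x \<in> S" "\<And>y. y \<in> S \<Longrightarrow> f y = g y"
  shows "ddir f v x = ddir g v x"
proof -
  have "(f has_derivative F) (at x) \<longleftrightarrow> (g has_derivative F) (at x)" for F
    using has_derivative_transform_within_open[OF _ assms(1,2), of f F UNIV g]
      has_derivative_transform_within_open[OF _ assms(1,2), of g F UNIV f] assms(3) by auto
  then show ?thesis
    by (simp add: ddir_def frechet_derivative_def)
qed

lemma Ck_on_Suc: "Ck_on (Suc k) S f \<longleftrightarrow>
    (\<forall>x\<in>S. f differentiable (at x)) \<and> (\<forall>v. Ck_on k S (ddir f v))"
  by (simp add: ddir_def[abs_def])

lemma Ck_on_cong:
  assumes "open S" "\<And>x. x \<in> S \<Longrightarrow> f x = g x" "Ck_on k S f"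
  shows "Ck_on k S g"
  using assms(2,3)
proof (induction k arbitrary: f g)
  case 0
  then show ?case
    using continuous_on_cong by (metis Ck_on.simps(1))
next
  case (Suc k)
  have "g differentiable (at x)" if "x \<in> S" for x
    using Suc.prems that assms(1) unfolding Ck_on_Suc differentiable_def
    by (meson has_derivative_transform_within_open)
  moreover have "Ck_on k S (ddir g v)" for v
    by (rule Suc.IH[of "ddir f v"]) (use Suc.prems ddir_cong[OF assms(1), of _ f g] in \<open>auto simp: Ck_on_Suc simp del: Ck_on.simps\<close>)
  ultimately show ?case
    by (simp add: Ck_on_Suc del: Ck_on.simps)
qed

text \<open>Induction step for the closure properties that follow: any explicit formula for the
  derivative, valid on the open set, may replace the abstract Frechet derivative.\<close>

lemma Ck_on_SucI:
  assumes "open S" "\<And>x. x \<in> S \<Longrightarrow> (f has_derivative F x) (at x)"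
    "\<And>v. Ck_on k S (\<lambda>x. F x v)"
  shows "Ck_on (Suc k) S f"
proof -
  have "Ck_on k S (ddir f v)" for v
    using Ck_on_cong[OF assms(1) _ assms(3)[of v]] ddir_eq[OF assms(2)] by metis
  then show ?thesis
    using assms(2) by (auto simp: Ck_on_Suc differentiable_def simp del: Ck_on.simps)
qed

lemma Ck_on_SucD: "Ck_on (Suc k) S f \<Longrightarrow> Ck_on k S f"
proof (induction k arbitrary: f)
  case 0
  then show ?case
    by (auto simp: continuous_on_eq_continuous_within
        intro!: differentiable_imp_continuous_within intro: differentiable_at_withinI)
next
  case (Suc k)
  then show ?case by (metis Ck_on_Suc)
qed

lemma Ck_on_subset: "Ck_on k S f \<Longrightarrow> T \<subseteq> S \<Longrightarrow> Ck_on k T f"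
  by (induction k arbitrary: f) (auto intro: continuous_on_subset)

lemma Ck_on_const: "Ck_on k S (\<lambda>x. c)"
  by (induction k arbitrary: c) (auto)

lemma Ck_on_linear:
  assumes "open S" "bounded_linear L" "Ck_on k S f"
  shows "Ck_on k S (\<lambda>x. L (f x))"
  using assms(3)
proof (induction k arbitrary: f)
  case 0
  then show ?case using assms(2) by (simp add: bounded_linear.continuous_on)
next
  case (Suc k)
  then show ?case
    by (intro Ck_on_SucI[OF assms(1), where F = "\<lambda>x v. L (ddir f v x)"])
      (auto simp: Ck_on_Suc simp del: Ck_on.simps
        intro!: bounded_linear.has_derivative[OF assms(2)] has_derivative_ddir)
qed

lemma Ck_on_add:
  assumes "open S" "Ck_on k S f" "Ck_on k S g"
  shows "Ck_on k S (\<lambda>x. f x + g x)"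
  using assms(2,3)
proof (induction k arbitrary: f g)
  case 0
  then show ?case by (simp add: continuous_on_add)
next
  case (Suc k)
  then show ?case
    by (intro Ck_on_SucI[OF assms(1), where F = "\<lambda>x v. ddir f v x + ddir g v x"])
      (auto simp: Ck_on_Suc simp del: Ck_on.simps
        intro!: has_derivative_add has_derivative_ddir)
qed

lemma Ck_on_sum:
  assumes "open S" "\<And>i. i \<in> I \<Longrightarrow> Ck_on k S (f i)"
  shows "Ck_on k S (\<lambda>x. \<Sum>i\<in>I. f i x)"
proof (cases "finite I")
  case True
  then show ?thesis
    using assms(2) by (induction I) (auto simp: Ck_on_const intro: Ck_on_add[OF assms(1)])
qed (simp add: Ck_on_const)

lemma Ck_on_bilinear:
  assumes "open S" "bounded_bilinear P" "Ck_on k S f" "Ck_on k S g"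
  shows "Ck_on k S (\<lambda>x. P (f x) (g x))"
  using assms(3,4)
proof (induction k arbitrary: f g)
  case 0
  then show ?case using assms(2) by (simp add: bounded_bilinear.continuous_on)
next
  case (Suc k)
  have "Ck_on k S (\<lambda>x. P (f x) (ddir g v x) + P (ddir f v x) (g x))" for v
    using Suc.prems Ck_on_SucD[OF Suc.prems(1)] Ck_on_SucD[OF Suc.prems(2)]
    by (intro Ck_on_add[OF assms(1)] Suc.IH) (simp_all only: Ck_on_Suc)
  then show ?case
    using Suc.prems
    by (intro Ck_on_SucI[OF assms(1),
          where F = "\<lambda>x v. P (f x) (ddir g v x) + P (ddir f v x) (g x)"])
      (auto simp: Ck_on_Suc simp del: Ck_on.simps
        intro!: bounded_bilinear.FDERIV[OF assms(2)] has_derivative_ddir)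
qed

text \<open>In the chain rule the direction \<open>ddir g v x\<close> varies with the point, while
  \<open>Ck_on\<close> speaks of fixed directions. Expanding it in the basis of the Euclidean middle
  space leaves products of its coordinates with \<open>ddir f b\<close> composed with
  \<open>g\<close>, and the induction hypothesis, general in \<open>f\<close>, covers these.\<close>

lemma Ck_on_compose:
  fixes g :: "'a::real_normed_vector \<Rightarrow> 'b::euclidean_space"
  assumes "open S" "open T" "g ` S \<subseteq> T" "Ck_on k S g" "Ck_on k T f"
  shows "Ck_on k S (\<lambda>x. f (g x))"
  using assms(4,5)
proof (induction k arbitrary: f)
  case 0
  then show ?case
    using continuous_on_compose2[of T f S g] assms(3) by simp
next
  case (Suc k)
  have expand: "ddir f w y = (\<Sum>b\<in>Basis. (w \<bullet> b) *\<^sub>R ddir f b y)" if "y \<in> T" for w y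
  proof -
    have "bounded_linear (\<lambda>v. ddir f v y)"
      using Suc.prems that by (auto simp: Ck_on_Suc intro!: has_derivative_bounded_linear[OF has_derivative_ddir])
    then have "linear (\<lambda>v. ddir f v y)"
      by (rule bounded_linear.linear)
    then have "ddir f (\<Sum>b\<in>Basis. (w \<bullet> b) *\<^sub>R b) y = (\<Sum>b\<in>Basis. (w \<bullet> b) *\<^sub>R ddir f b y)"
      using linear_sum[of "\<lambda>v. ddir f v y" "\<lambda>b. (w \<bullet> b) *\<^sub>R b"]
        linear_scale[of "\<lambda>v. ddir f v y"] by (simp del: euclidean_representation)
    then show ?thesis by (simp add: euclidean_representation)
  qed
  show ?case
  proof (intro Ck_on_SucI[OF assms(1), where F = "\<lambda>x v. \<Sum>b\<in>Basis. (ddir g v x \<bullet> b) *\<^sub>R ddir f b (g x)"])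
    fix x assume x: "x \<in> S"
    then have "(g has_derivative (\<lambda>v. ddir g v x)) (at x)"
      "(f has_derivative (\<lambda>v. ddir f v (g x))) (at (g x))"
      using Suc.prems assms(3) by (auto simp: Ck_on_Suc intro!: has_derivative_ddir)
    then have "((\<lambda>x. f (g x)) has_derivative (\<lambda>v. ddir f (ddir g v x) (g x))) (at x)"
      by (rule has_derivative_compose)
    moreover have "(\<lambda>v. ddir f (ddir g v x) (g x)) =
        (\<lambda>v. \<Sum>b\<in>Basis. (ddir g v x \<bullet> b) *\<^sub>R ddir f b (g x))"
      using x assms(3) by (intro ext expand) blast
    ultimately show "((\<lambda>x. f (g x)) has_derivative
        (\<lambda>v. \<Sum>b\<in>Basis. (ddir g v x \<bullet> b) *\<^sub>R ddir f b (g x))) (at x)"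
      by metis
  next
    fix v
    have "Ck_on k S (\<lambda>x. ddir g v x \<bullet> b)" for b
      using Suc.prems(1) unfolding Ck_on_Suc
      by (intro Ck_on_linear[OF assms(1) bounded_linear_inner_left]) blast
    moreover have "Ck_on k S (\<lambda>x. ddir f b (g x))" for b
    proof (rule Suc.IH)
      show "Ck_on k S g" by (rule Ck_on_SucD[OF Suc.prems(1)])
      show "Ck_on k T (ddir f b)" using Suc.prems(2) unfolding Ck_on_Suc by blast
    qed
    ultimately show "Ck_on k S (\<lambda>x. \<Sum>b\<in>Basis. (ddir g v x \<bullet> b) *\<^sub>R ddir f b (g x))"
      by (intro Ck_on_sum Ck_on_bilinear[OF _ bounded_bilinear_scaleR] assms(1))
  qed
qed

text \<open>The derivative of \<open>inverse\<close> is a polynomial in \<open>inverse\<close>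
  itself, so the induction closes. In the same way the derivative of \<open>sqrt\<close> below is
  built from \<open>sqrt\<close> by \<open>inverse\<close>.\<close>

lemma Ck_on_inverse: "Ck_on k (- {0}) (inverse :: real \<Rightarrow> real)"
proof (induction k)
  case 0
  then show ?case by (auto intro!: continuous_intros)
next
  case (Suc k)
  have op: "open (- {0::real})" by auto
  show ?case
  proof (rule Ck_on_SucI[OF op, where F = "\<lambda>x v. - (inverse x * v * inverse x)"])
    show "(inverse has_derivative (\<lambda>v. - (inverse x * v * inverse x))) (at x)" if "x \<in> - {0}" for x :: real
      using has_derivative_inverse'[of x UNIV] that by simp
    show "Ck_on k (- {0}) (\<lambda>x. - (inverse x * v * inverse x))" for v :: real
      by (intro Ck_on_linear[OF op bounded_linear_minus[OF bounded_linear_ident]]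
          Ck_on_bilinear[OF op bounded_bilinear_mult] Ck_on_const Suc)
  qed
qed

lemma Ck_on_sqrt: "Ck_on k {0<..} sqrt"
proof (induction k)
  case 0
  then show ?case by (auto intro!: continuous_intros)
next
  case (Suc k)
  have op: "open {0::real<..}" by auto
  show ?case
  proof (rule Ck_on_SucI[OF op, where F = "\<lambda>x. times (inverse (sqrt x) * (1/2))"])
    show "(sqrt has_derivative times (inverse (sqrt x) * (1/2))) (at x)" if "x \<in> {0<..}" for x
      using DERIV_real_sqrt[of x] that
      by (simp add: has_field_derivative_def)
    have "Ck_on k {0<..} (\<lambda>x. inverse (sqrt x))"
      by (rule Ck_on_compose[OF op _ _ Suc Ck_on_inverse]) (auto simp: open_Compl)
    then show "Ck_on k {0<..} (\<lambda>x. (inverse (sqrt x) * (1/2)) * v)" for v :: real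
      by (intro Ck_on_bilinear[OF op bounded_bilinear_mult] Ck_on_const)
  qed
qed

lemma smooth_onD: "smooth_on S f \<Longrightarrow> x \<in> S \<Longrightarrow> f differentiable (at x)"
  unfolding smooth_on_def by (metis Ck_on_Suc)

lemma smooth_on_ddir: "smooth_on S f \<Longrightarrow> smooth_on S (ddir f v)"
  unfolding smooth_on_def by (metis Ck_on_Suc)

lemma smooth_on_imp_continuous_on: "smooth_on S f \<Longrightarrow> continuous_on S f"
  unfolding smooth_on_def by (metis Ck_on.simps(1))

lemma smooth_on_cong:
  "open S \<Longrightarrow> smooth_on S f \<Longrightarrow> (\<And>x. x \<in> S \<Longrightarrow> f x = g x) \<Longrightarrow> smooth_on S g"
  unfolding smooth_on_def using Ck_on_cong by metis

lemma smooth_on_subset: "smooth_on S f \<Longrightarrow> T \<subseteq> S \<Longrightarrow> smooth_on T f"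
  unfolding smooth_on_def by (metis Ck_on_subset)

lemma smooth_on_const: "smooth_on S (\<lambda>x. c)"
  by (simp add: smooth_on_def Ck_on_const)

lemma smooth_on_linear:
  "open S \<Longrightarrow> bounded_linear L \<Longrightarrow> smooth_on S f \<Longrightarrow> smooth_on S (\<lambda>x. L (f x))"
  by (simp add: smooth_on_def Ck_on_linear)

lemma smooth_on_add:
  "open S \<Longrightarrow> smooth_on S f \<Longrightarrow> smooth_on S g \<Longrightarrow> smooth_on S (\<lambda>x. f x + g x)"
  by (simp add: smooth_on_def Ck_on_add)

lemma smooth_on_minus: "open S \<Longrightarrow> smooth_on S f \<Longrightarrow> smooth_on S (\<lambda>x. - f x)"
  by (rule smooth_on_linear[OF _ bounded_linear_minus[OF bounded_linear_ident]])

lemma smooth_on_diff: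
  "open S \<Longrightarrow> smooth_on S f \<Longrightarrow> smooth_on S g \<Longrightarrow> smooth_on S (\<lambda>x. f x - g x)"
  using smooth_on_add[of S f "\<lambda>x. - g x"] smooth_on_minus[of S g] by simp

lemma smooth_on_sum:
  "open S \<Longrightarrow> (\<And>i. i \<in> I \<Longrightarrow> smooth_on S (f i)) \<Longrightarrow> smooth_on S (\<lambda>x. \<Sum>i\<in>I. f i x)"
  by (simp add: smooth_on_def Ck_on_sum)

lemma smooth_on_bilinear:
  "open S \<Longrightarrow> bounded_bilinear P \<Longrightarrow> smooth_on S f \<Longrightarrow> smooth_on S g \<Longrightarrow> smooth_on S (\<lambda>x. P (f x) (g x))"
  by (simp add: smooth_on_def Ck_on_bilinear)

lemmas smooth_on_mult = smooth_on_bilinear[OF _ bounded_bilinear_mult]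
  and smooth_on_scaleR = smooth_on_bilinear[OF _ bounded_bilinear_scaleR]

lemma smooth_on_compose:
  fixes g :: "'a::real_normed_vector \<Rightarrow> 'b::euclidean_space"
  shows "open S \<Longrightarrow> open T \<Longrightarrow> g ` S \<subseteq> T \<Longrightarrow> smooth_on S g \<Longrightarrow> smooth_on T f
    \<Longrightarrow> smooth_on S (\<lambda>x. f (g x))"
  unfolding smooth_on_def using Ck_on_compose by metis

lemma smooth_on_divide:
  fixes f g :: "'a::real_normed_vector \<Rightarrow> real"
  assumes "open S" "smooth_on S f" "smooth_on S g" "\<And>x. x \<in> S \<Longrightarrow> g x \<noteq> 0"
  shows "smooth_on S (\<lambda>x. f x / g x)"
proof -
  have "smooth_on S (\<lambda>x. inverse (g x))"
    using assms by (intro smooth_on_compose[OF assms(1), of "- {0}" g inverse])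
      (auto simp: smooth_on_def Ck_on_inverse)
  then show ?thesis
    unfolding divide_inverse by (intro smooth_on_mult assms)
qed

lemma smooth_on_sqrt:
  fixes f :: "'a::real_normed_vector \<Rightarrow> real"
  assumes "open S" "smooth_on S f" "\<And>x. x \<in> S \<Longrightarrow> f x > 0"
  shows "smooth_on S (\<lambda>x. sqrt (f x))"
  using assms by (intro smooth_on_compose[OF assms(1), of "{0<..}" f sqrt])
    (auto simp: smooth_on_def Ck_on_sqrt)

lemma smooth_on_vec_lambda:
  fixes f :: "'n::finite \<Rightarrow> 'a::real_normed_vector \<Rightarrow> 'b::euclidean_space"
  assumes "open S" "\<And>i. smooth_on S (f i)"
  shows "smooth_on S (\<lambda>x. \<chi> i. f i x)"
proof -
  have "smooth_on S (\<lambda>x. \<Sum>i\<in>UNIV. axis i (f i x))"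
    using assms
    by (intro smooth_on_sum smooth_on_linear[where L = "axis _"])
      (auto simp: linear_conv_bounded_linear[symmetric] linear_iff vec_eq_iff axis_def)
  moreover have "(\<Sum>i\<in>UNIV. axis i (f i x)) = (\<chi> i. f i x)" for x
    by (simp add: vec_eq_iff axis_def if_distrib cong: if_cong)
  ultimately show ?thesis by simp
qed

lemma smooth_on_Re_Im:
  assumes "open S" "smooth_on S f"
  shows "smooth_on S (\<lambda>x. Re (f x))" "smooth_on S (\<lambda>x. Im (f x))"
  using smooth_on_linear[OF assms(1) bounded_linear_Re assms(2)]
    smooth_on_linear[OF assms(1) bounded_linear_Im assms(2)] .

lemma smooth_on_Complex:
  assumes V: "open V" and "smooth_on V g" "smooth_on V h"
  shows "smooth_on V (\<lambda>z. Complex (g z) (h z))"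
proof -
  have "smooth_on V (\<lambda>z. g z *\<^sub>R 1 + h z *\<^sub>R \<i>)"
    by (intro smooth_on_add smooth_on_scaleR V assms smooth_on_const)
  then show ?thesis
    by (rule smooth_on_cong[OF V]) (simp add: complex_eq_iff)
qed

lemma Ck_on_holomorphic: "open S \<Longrightarrow> f holomorphic_on S \<Longrightarrow> Ck_on k S f"
proof (induction k arbitrary: f)
  case 0
  then show ?case by (simp add: holomorphic_on_imp_continuous_on)
next
  case (Suc k)
  have "Ck_on k S (\<lambda>x. deriv f x * v)" for v
    by (intro Ck_on_bilinear[OF Suc.prems(1) bounded_bilinear_mult] Suc.IH Ck_on_const
        holomorphic_deriv Suc.prems)
  then show ?case
    using Suc.prems holomorphic_derivI[of f S]
    by (intro Ck_on_SucI[where F = "\<lambda>x v. deriv f x * v"]) (auto simp: has_field_derivative_def)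
qed

lemma smooth_on_holomorphic: "open S \<Longrightarrow> f holomorphic_on S \<Longrightarrow> smooth_on S f"
  by (simp add: smooth_on_def Ck_on_holomorphic)


section \<open>Symmetry of mixed directional derivatives\<close>

lemma ddir_MVT:
  fixes f :: "'a::real_normed_vector \<Rightarrow> real"
  assumes "h > 0" "\<And>s. 0 \<le> s \<Longrightarrow> s \<le> h \<Longrightarrow> f differentiable (at (y + s *\<^sub>R v))"
  obtains \<xi> where "0 < \<xi>" "\<xi> < h" "f (y + h *\<^sub>R v) - f y = h * ddir f v (y + \<xi> *\<^sub>R v)"
proof -
  have "((\<lambda>s. f (y + s *\<^sub>R v)) has_real_derivative ddir f v (y + s *\<^sub>R v)) (at s)"
    if "0 \<le> s" "s \<le> h" for s
  proof -
    note D = has_derivative_ddir[OF assms(2)[OF that]]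
    have "((\<lambda>s. y + s *\<^sub>R v) has_derivative (\<lambda>t. t *\<^sub>R v)) (at s)"
      by (auto intro!: derivative_eq_intros)
    then have "((\<lambda>s. f (y + s *\<^sub>R v)) has_derivative (\<lambda>t. ddir f (t *\<^sub>R v) (y + s *\<^sub>R v))) (at s)"
      using has_derivative_compose D by blast
    moreover have "ddir f (t *\<^sub>R v) (y + s *\<^sub>R v) = ddir f v (y + s *\<^sub>R v) * t" for t
      using linear_scale[OF has_derivative_linear[OF D]] by simp
    ultimately show ?thesis
      by (simp add: has_field_derivative_def)
  qed
  from MVT2[OF assms(1) this] show ?thesis
    using that by auto
qed

text \<open>Mean value theorem twice: along \<open>v\<close> for the increment of \<open>f\<close>
  in direction \<open>w\<close>, then along \<open>w\<close> for \<open>ddir f v\<close>. The second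
  difference is symmetric in \<open>v\<close> and \<open>w\<close>, which is what
  \<open>ddir_commute_real\<close> exploits.\<close>

lemma second_difference:
  fixes f :: "'a::real_normed_vector \<Rightarrow> real"
  assumes "h > 0" "Ck_on (Suc (Suc 0)) S f"
    "\<And>s t. 0 \<le> s \<Longrightarrow> s \<le> h \<Longrightarrow> 0 \<le> t \<Longrightarrow> t \<le> h \<Longrightarrow> x + s *\<^sub>R v + t *\<^sub>R w \<in> S"
  obtains \<xi> \<eta> where "0 < \<xi>" "\<xi> < h" "0 < \<eta>" "\<eta> < h"
    "f (x + h *\<^sub>R v + h *\<^sub>R w) - f (x + h *\<^sub>R v) - f (x + h *\<^sub>R w) + f x
       = h * h * ddir (ddir f v) w (x + \<xi> *\<^sub>R v + \<eta> *\<^sub>R w)"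
proof -
  have diff: "f differentiable (at z)" "ddir f v differentiable (at z)" if "z \<in> S" for z
    using assms(2) that by (auto simp: Ck_on_Suc simp del: Ck_on.simps)
  let ?F = "\<lambda>y. f (y + h *\<^sub>R w) - f y"
  have F: "(?F has_derivative (\<lambda>u. ddir f u (x + s *\<^sub>R v + h *\<^sub>R w) - ddir f u (x + s *\<^sub>R v)))
      (at (x + s *\<^sub>R v))" if s: "0 \<le> s" "s \<le> h" for s
  proof (intro has_derivative_diff)
    have "((\<lambda>y. y + h *\<^sub>R w) has_derivative (\<lambda>u. u)) (at (x + s *\<^sub>R v))"
      by (auto intro!: derivative_eq_intros)
    from has_derivative_compose[OF this has_derivative_ddir[OF diff(1)]]
    show "((\<lambda>y. f (y + h *\<^sub>R w)) has_derivative (\<lambda>u. ddir f u (x + s *\<^sub>R v + h *\<^sub>R w)))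
        (at (x + s *\<^sub>R v))"
      using assms(1,3) s by simp
    show "(f has_derivative (\<lambda>u. ddir f u (x + s *\<^sub>R v))) (at (x + s *\<^sub>R v))"
      using assms(3)[OF s, of 0] assms(1) by (intro has_derivative_ddir diff) simp
  qed
  obtain \<xi> where xi: "0 < \<xi>" "\<xi> < h" "?F (x + h *\<^sub>R v) - ?F x = h * ddir ?F v (x + \<xi> *\<^sub>R v)"
    by (rule ddir_MVT[OF assms(1), of ?F x v]) (auto intro!: differentiableI F)
  have "ddir ?F v (x + \<xi> *\<^sub>R v) = ddir f v (x + \<xi> *\<^sub>R v + h *\<^sub>R w) - ddir f v (x + \<xi> *\<^sub>R v)"
    using xi by (intro ddir_eq[OF F]) auto
  moreover obtain \<eta> where eta: "0 < \<eta>" "\<eta> < h"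
    "ddir f v (x + \<xi> *\<^sub>R v + h *\<^sub>R w) - ddir f v (x + \<xi> *\<^sub>R v)
       = h * ddir (ddir f v) w (x + \<xi> *\<^sub>R v + \<eta> *\<^sub>R w)"
    by (rule ddir_MVT[OF assms(1), of "ddir f v" "x + \<xi> *\<^sub>R v" w])
      (use xi in \<open>auto intro!: diff(2) assms(3)\<close>)
  ultimately show ?thesis
    using that[OF xi(1,2) eta(1,2)] xi(3) by (simp add: algebra_simps)
qed

lemma ddir_commute_real:
  fixes f :: "'a::real_normed_vector \<Rightarrow> real"
  assumes "open S" "Ck_on (Suc (Suc 0)) S f" "x \<in> S"
  shows "ddir (ddir f v) w x = ddir (ddir f w) v x"
proof (rule ccontr)
  let ?A = "ddir (ddir f v) w" and ?B = "ddir (ddir f w) v"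
  assume ne: "?A x \<noteq> ?B x"
  define e where "e = \<bar>?A x - ?B x\<bar> / 2"
  have e: "e > 0"
    using ne by (simp add: e_def)
  have "continuous_on S ?A" "continuous_on S ?B"
    using assms(2) unfolding Ck_on_Suc Ck_on.simps(1) by blast+
  then have "isCont ?A x" "isCont ?B x"
    using assms(1,3) by (simp_all add: continuous_on_eq_continuous_at)
  then obtain d1 d2 where d: "d1 > 0" "\<And>y. dist y x < d1 \<Longrightarrow> dist (?A y) (?A x) < e"
      "d2 > 0" "\<And>y. dist y x < d2 \<Longrightarrow> dist (?B y) (?B x) < e"
    using e unfolding continuous_at_eps_delta by metis
  obtain d3 where d3: "d3 > 0" "\<And>y. dist y x < d3 \<Longrightarrow> y \<in> S"
    using assms(1,3) unfolding open_dist by metis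
  define d where "d = min d1 (min d2 d3)"
  \<comment> \<open>Keeps the parallelogram at \<open>x\<close> spanned by
    \<open>h *\<^sub>R v\<close> and \<open>h *\<^sub>R w\<close> within d / 2 of \<open>x\<close>;
    the summand 1 avoids a zero denominator when both directions vanish.\<close>
  define h where "h = d / (2 * (norm v + norm w + 1))"
  have pos: "d > 0" "norm v + norm w + 1 > 0"
    using d(1,3) d3(1) by (auto simp: d_def add_nonneg_pos)
  then have h: "h > 0"
    by (simp add: h_def)
  have near: "dist (x + s *\<^sub>R v + t *\<^sub>R w) x < d" if "0 \<le> s" "s \<le> h" "0 \<le> t" "t \<le> h" for s t
  proof -
    have "dist (x + s *\<^sub>R v + t *\<^sub>R w) x \<le> s * norm v + t * norm w"
      using norm_triangle_ineq[of "s *\<^sub>R v" "t *\<^sub>R w"] that by (simp add: dist_norm add.assoc)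
    also have "\<dots> \<le> h * norm v + h * norm w"
      using that by (intro add_mono mult_right_mono) auto
    also have "\<dots> \<le> h * (norm v + norm w + 1)"
      using h by (simp add: algebra_simps)
    also have "h * (norm v + norm w + 1) = d / 2"
      using pos(2) by (simp add: h_def divide_simps)
    also have "d / 2 < d"
      using pos by simp
    finally show ?thesis .
  qed
  have swap: "x + s *\<^sub>R w + t *\<^sub>R v = x + t *\<^sub>R v + s *\<^sub>R w" for s t
    by simp
  have near': "dist (x + s *\<^sub>R w + t *\<^sub>R v) x < d" if "0 \<le> s" "s \<le> h" "0 \<le> t" "t \<le> h" for s t
    using near[of t s] that by (simp only: swap)
  obtain a b where 1: "0 < a" "a < h" "0 < b" "b < h"
    "f (x + h *\<^sub>R v + h *\<^sub>R w) - f (x + h *\<^sub>R v) - f (x + h *\<^sub>R w) + f x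
       = h * h * ?A (x + a *\<^sub>R v + b *\<^sub>R w)"
    by (rule second_difference[OF h assms(2), of x v w]) (use near d3(2) in \<open>auto simp: d_def\<close>)
  obtain a' b' where 2: "0 < a'" "a' < h" "0 < b'" "b' < h"
    "f (x + h *\<^sub>R w + h *\<^sub>R v) - f (x + h *\<^sub>R w) - f (x + h *\<^sub>R v) + f x
       = h * h * ?B (x + a' *\<^sub>R w + b' *\<^sub>R v)"
    by (rule second_difference[OF h assms(2), of x w v]) (use near' d3(2) in \<open>auto simp: d_def\<close>)
  have "?A (x + a *\<^sub>R v + b *\<^sub>R w) = ?B (x + b' *\<^sub>R v + a' *\<^sub>R w)"
  proof -
    have "h * h * ?A (x + a *\<^sub>R v + b *\<^sub>R w) = h * h * ?B (x + b' *\<^sub>R v + a' *\<^sub>R w)"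
      using 1(5) 2(5) unfolding swap by linarith
    then show ?thesis
      using h by simp
  qed
  moreover have "dist (?A x) (?A (x + a *\<^sub>R v + b *\<^sub>R w)) < e"
    using near[of a b] 1 by (subst dist_commute, intro d) (auto simp: d_def)
  moreover have "dist (?B x) (?B (x + b' *\<^sub>R v + a' *\<^sub>R w)) < e"
    using near[of b' a'] 2 by (subst dist_commute, intro d) (auto simp: d_def)
  ultimately have "dist (?A x) (?B x) < e + e"
    by (metis dist_triangle_less_add)
  then show False
    by (simp add: dist_real_def e_def)
qed

lemma ddir_linear:
  assumes "bounded_linear L" "f differentiable (at x)"
  shows "ddir (\<lambda>x. L (f x)) v x = L (ddir f v x)"
  by (intro ddir_eq bounded_linear.has_derivative[OF assms(1)] has_derivative_ddir assms(2))

lemma ddir_commute: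
  fixes f :: "'a::real_normed_vector \<Rightarrow> 'b::euclidean_space"
  assumes "open S" "smooth_on S f" "x \<in> S"
  shows "ddir (ddir f v) w x = ddir (ddir f w) v x"
proof (rule euclidean_eqI)
  fix b :: 'b
  have bl: "bounded_linear (\<lambda>y::'b. y \<bullet> b)"
    by (rule bounded_linear_inner_left)
  have comp: "ddir (ddir (\<lambda>x. f x \<bullet> b) v) w x = ddir (ddir f v) w x \<bullet> b" for v w
  proof -
    have "ddir (ddir (\<lambda>x. f x \<bullet> b) v) w x = ddir (\<lambda>x. ddir f v x \<bullet> b) w x"
      using assms by (intro ddir_cong[of S] ddir_linear[OF bl]) (auto dest: smooth_onD)
    also have "\<dots> = ddir (ddir f v) w x \<bullet> b"
      using assms smooth_onD[OF smooth_on_ddir[OF assms(2)]] by (intro ddir_linear[OF bl])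
    finally show ?thesis .
  qed
  have "smooth_on S (\<lambda>x. f x \<bullet> b)"
    by (intro smooth_on_linear[OF assms(1) bl] assms(2))
  then show "ddir (ddir f v) w x \<bullet> b = ddir (ddir f w) v x \<bullet> b"
    using ddir_commute_real[OF assms(1) _ assms(3)] unfolding smooth_on_def
    by (metis comp)
qed

section \<open>The symplectic form and the symplectic group\<close>

lemma Omega_expand: "Omega x y = x$1 * y$3 + x$2 * y$4 - x$3 * y$1 - x$4 * y$2"
  by (simp add: Omega_def J4_def inner_vec_def matrix_vector_mult_def sum_4)

lemma bounded_bilinear_Omega: "bounded_bilinear Omega"
  unfolding bilinear_conv_bounded_bilinear[symmetric] bilinear_def
  by (auto intro!: linearI simp: Omega_expand algebra_simps)

lemmas Omega_bilinear_simps =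
  bounded_bilinear.add_left[OF bounded_bilinear_Omega]
  bounded_bilinear.add_right[OF bounded_bilinear_Omega]
  bounded_bilinear.diff_left[OF bounded_bilinear_Omega]
  bounded_bilinear.diff_right[OF bounded_bilinear_Omega]
  bounded_bilinear.minus_left[OF bounded_bilinear_Omega]
  bounded_bilinear.minus_right[OF bounded_bilinear_Omega]
  bounded_bilinear.scaleR_left[OF bounded_bilinear_Omega]
  bounded_bilinear.scaleR_right[OF bounded_bilinear_Omega]
  bounded_bilinear.zero_left[OF bounded_bilinear_Omega]
  bounded_bilinear.zero_right[OF bounded_bilinear_Omega]

lemma Omega_commute: "Omega x y = - Omega y x"
  by (simp add: Omega_expand)

lemma Omega_self [simp]: "Omega x x = 0"
  by (simp add: Omega_expand)

definition sympl_basis :: "real^4 \<Rightarrow> real^4 \<Rightarrow> real^4 \<Rightarrow> real^4 \<Rightarrow> bool" where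
  "sympl_basis x1 x2 x3 x4 \<longleftrightarrow> Omega x1 x2 = 0 \<and> Omega x1 x3 = 1 \<and> Omega x1 x4 = 0 \<and>
     Omega x2 x3 = 0 \<and> Omega x2 x4 = 1 \<and> Omega x3 x4 = 0"

lemma sympl_basisD:
  assumes "sympl_basis x1 x2 x3 x4"
  shows "Omega x1 x2 = 0" "Omega x1 x3 = 1" "Omega x1 x4 = 0" "Omega x2 x1 = 0" "Omega x2 x3 = 0"
    "Omega x2 x4 = 1" "Omega x3 x1 = -1" "Omega x3 x2 = 0" "Omega x3 x4 = 0" "Omega x4 x1 = 0"
    "Omega x4 x2 = -1" "Omega x4 x3 = 0"
  using assms Omega_commute[of x2 x1] Omega_commute[of x3 x1] Omega_commute[of x3 x2]
    Omega_commute[of x4 x1] Omega_commute[of x4 x2] Omega_commute[of x4 x3]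
  by (auto simp: sympl_basis_def)

lemma Omega_sympl_basis:
  assumes "sympl_basis x1 x2 x3 x4"
  shows "Omega (p1 *\<^sub>R x1 + p2 *\<^sub>R x2 + p3 *\<^sub>R x3 + p4 *\<^sub>R x4)
      (q1 *\<^sub>R x1 + q2 *\<^sub>R x2 + q3 *\<^sub>R x3 + q4 *\<^sub>R x4) = p1 * q3 + p2 * q4 - p3 * q1 - p4 * q2"
  by (simp add: Omega_bilinear_simps sympl_basisD[OF assms])

lemma J4_entries:
  "J4 $ 1 $ 1 = 0" "J4 $ 1 $ 2 = 0" "J4 $ 1 $ 3 = 1" "J4 $ 1 $ 4 = 0"
  "J4 $ 2 $ 1 = 0" "J4 $ 2 $ 2 = 0" "J4 $ 2 $ 3 = 0" "J4 $ 2 $ 4 = 1"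
  "J4 $ 3 $ 1 = -1" "J4 $ 3 $ 2 = 0" "J4 $ 3 $ 3 = 0" "J4 $ 3 $ 4 = 0"
  "J4 $ 4 $ 1 = 0" "J4 $ 4 $ 2 = -1" "J4 $ 4 $ 3 = 0" "J4 $ 4 $ 4 = 0"
  by (simp_all add: J4_def)

lemma J4_square: "J4 ** J4 = - mat 1"
  by (simp add: vec_eq_iff forall_4 J4_def matrix_matrix_mult_def mat_def sum_4)

lemma transpose_J4_mult_entry:
  fixes X :: "real^4^4"
  shows "(transpose X ** J4 ** X) $ i $ j = Omega (column i X) (column j X)"
proof -
  have J: "(\<Sum>l\<in>UNIV. y $ l * J4 $ l $ k) = (if k = 1 then - y$3 else if k = 2 then - y$4
      else if k = 3 then y$1 else y$2)" for y :: "real^4" and k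
    using exhaust_4[of k] by (auto simp: sum_4 J4_def)
  have "(transpose X ** J4 ** X) $ i $ j = (\<Sum>k\<in>UNIV. (\<Sum>l\<in>UNIV. column i X $ l * J4 $ l $ k) * column j X $ k)"
    by (simp add: matrix_matrix_mult_def transpose_def column_def)
  also have "\<dots> = Omega (column i X) (column j X)"
    unfolding J by (simp add: sum_4 Omega_expand)
  finally show ?thesis .
qed

text \<open>The entries of the product in the definition of \<open>Sp4\<close> are the
  \<Omega>-pairings of columns, and invertibility is automatic because the negative of
  \<open>J4 ** transpose X ** J4\<close> is a left inverse.\<close>

lemma Sp4_iff: "X \<in> Sp4 \<longleftrightarrow> sympl_basis (column 1 X) (column 2 X) (column 3 X) (column 4 X)"
proof -
  have *: "transpose X ** J4 ** X = J4 \<longleftrightarrow>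
      sympl_basis (column 1 X) (column 2 X) (column 3 X) (column 4 X)"
  proof -
    have "transpose X ** J4 ** X = J4 \<longleftrightarrow> (\<forall>i j. Omega (column i X) (column j X) = J4 $ i $ j)"
      by (simp add: vec_eq_iff transpose_J4_mult_entry)
    also have "\<dots> \<longleftrightarrow> sympl_basis (column 1 X) (column 2 X) (column 3 X) (column 4 X)"
    proof
      assume L: "\<forall>i j. Omega (column i X) (column j X) = J4 $ i $ j"
      show "sympl_basis (column 1 X) (column 2 X) (column 3 X) (column 4 X)"
        unfolding sympl_basis_def by (simp add: L J4_entries)
    next
      assume "sympl_basis (column 1 X) (column 2 X) (column 3 X) (column 4 X)"
      then show "\<forall>i j. Omega (column i X) (column j X) = J4 $ i $ j"
        by (simp only: forall_4 J4_entries sympl_basisD Omega_self simp_thms)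
    qed
    finally show ?thesis .
  qed
  moreover have "invertible X" if "transpose X ** J4 ** X = J4"
  proof -
    have "- (J4 ** transpose X ** J4) ** X = - (J4 ** transpose X ** J4 ** X)"
      by (simp add: vec_eq_iff matrix_matrix_mult_def sum_negf)
    also have "\<dots> = - (J4 ** (transpose X ** J4 ** X))"
      by (simp only: matrix_mul_assoc)
    also have "\<dots> = mat 1"
      by (simp add: that J4_square)
    finally show ?thesis
      unfolding invertible_left_inverse by blast
  qed
  ultimately show ?thesis
    by (auto simp: Sp4_def)
qed

lemma Sp4_inv:
  assumes "X \<in> Sp4"
  shows "X ** matrix_inv X = mat 1" "matrix_inv X ** X = mat 1"
  using assms someI_ex[of "\<lambda>Y. X ** Y = mat 1 \<and> Y ** X = mat 1"]
  by (auto simp: Sp4_def invertible_def matrix_inv_def)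

lemma matrix_vector_mult_columns:
  fixes X :: "real^4^4"
  shows "X *v c = (c$1) *\<^sub>R column 1 X + (c$2) *\<^sub>R column 2 X + (c$3) *\<^sub>R column 3 X + (c$4) *\<^sub>R column 4 X"
  by (simp add: vec_eq_iff matrix_vector_mult_def column_def sum_4 mult.commute)

text \<open>Pairing with the conjugate basis vector reads off a coordinate in a symplectic basis.
  This turns the matrix inverse in \<open>frame_tau\<close> and \<open>frame_theta\<close> into
  \<Omega>-pairings.\<close>

lemma Sp4_inv_mult:
  fixes X :: "real^4^4" and w :: "real^4"
  assumes "X \<in> Sp4"
  defines "k \<equiv> matrix_inv X *v w"
  shows "k $ 1 = Omega w (column 3 X)" "k $ 2 = Omega w (column 4 X)"
    "k $ 3 = Omega (column 1 X) w" "k $ 4 = Omega (column 2 X) w"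
proof -
  have "w = X *v k"
    by (simp add: k_def matrix_vector_mul_assoc Sp4_inv[OF assms(1)])
  then have w: "w = (k$1) *\<^sub>R column 1 X + (k$2) *\<^sub>R column 2 X + (k$3) *\<^sub>R column 3 X + (k$4) *\<^sub>R column 4 X"
    using matrix_vector_mult_columns by metis
  note sb = sympl_basisD[OF assms(1)[unfolded Sp4_iff]]
  show "k $ 1 = Omega w (column 3 X)" "k $ 2 = Omega w (column 4 X)"
    "k $ 3 = Omega (column 1 X) w" "k $ 4 = Omega (column 2 X) w"
    by (subst w, simp add: Omega_bilinear_simps sb)+
qed

definition of_columns :: "real^4 \<Rightarrow> real^4 \<Rightarrow> real^4 \<Rightarrow> real^4 \<Rightarrow> real^4^4" where
  "of_columns x1 x2 x3 x4 = (\<chi> i j. if j = 1 then x1 $ i else if j = 2 then x2 $ i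
     else if j = 3 then x3 $ i else x4 $ i)"

lemma column_of_columns [simp]:
  "column 1 (of_columns x1 x2 x3 x4) = x1" "column 2 (of_columns x1 x2 x3 x4) = x2"
  "column 3 (of_columns x1 x2 x3 x4) = x3" "column 4 (of_columns x1 x2 x3 x4) = x4"
  by (simp_all add: of_columns_def column_def vec_eq_iff)

lemma sympl_basis_expand:
  assumes "sympl_basis x1 x2 x3 x4"
  shows "w = Omega w x3 *\<^sub>R x1 + Omega w x4 *\<^sub>R x2 + Omega x1 w *\<^sub>R x3 + Omega x2 w *\<^sub>R x4"
proof -
  let ?X = "of_columns x1 x2 x3 x4"
  have X: "?X \<in> Sp4"
    using assms by (simp add: Sp4_iff)
  have "w = ?X *v (matrix_inv ?X *v w)"
    by (simp add: matrix_vector_mul_assoc Sp4_inv[OF X])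
  then show ?thesis
    using matrix_vector_mult_columns[of ?X] by (simp add: Sp4_inv_mult[OF X])
qed

lemma bounded_linear_column: "bounded_linear (column j :: real^4^4 \<Rightarrow> real^4)"
  unfolding linear_conv_bounded_linear[symmetric]
  by (auto intro!: linearI simp: column_def vec_eq_iff)

section \<open>Exterior derivatives of \<Omega>-pairings\<close>

lemma ddir_Omega:
  assumes "P differentiable (at z)" "Q differentiable (at z)"
  shows "ddir (\<lambda>z. Omega (P z) (Q z)) v z = Omega (P z) (ddir Q v z) + Omega (ddir P v z) (Q z)"
  by (intro ddir_eq bounded_bilinear.FDERIV[OF bounded_bilinear_Omega] has_derivative_ddir assms)

lemma ddir_const: "ddir (\<lambda>x. c) v z = 0"
  by (rule ddir_eq) simp

lemma ddir_zero_on: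
  assumes "open V" "z \<in> V" "\<And>y. y \<in> V \<Longrightarrow> f y = c"
  shows "ddir f v z = 0"
  using ddir_cong[OF assms(1,2), of f "\<lambda>x. c"] assms(3) ddir_const by metis

lemma linear_ddir: "f differentiable (at z) \<Longrightarrow> linear (\<lambda>v. ddir f v z)"
  using has_derivative_ddir has_derivative_linear by blast

lemma ddir_dir:
  assumes "f differentiable (at z)"
  shows "ddir f (v + w) z = ddir f v z + ddir f w z" "ddir f (r *\<^sub>R v) z = r *\<^sub>R ddir f v z"
    "ddir f 0 z = 0"
  using linear_add[OF linear_ddir[OF assms]] linear_scale[OF linear_ddir[OF assms]]
    linear_0[OF linear_ddir[OF assms]] by auto

text \<open>The local form of \<open>d (P dQ) = dP \<and> dQ\<close>, for the product \<open>\<Omega>\<close>.\<close>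

lemma Omega_wedge:
  assumes "open V" "z \<in> V" "smooth_on V P" "smooth_on V Q"
  shows "ddir (\<lambda>z. Omega (P z) (ddir Q v z)) w z - ddir (\<lambda>z. Omega (P z) (ddir Q w z)) v z
    = Omega (ddir P w z) (ddir Q v z) - Omega (ddir P v z) (ddir Q w z)"
  using smooth_onD[OF assms(3,2)] smooth_onD[OF smooth_on_ddir[OF assms(4)] assms(2)]
    ddir_commute[OF assms(1,4,2)] by (simp add: ddir_Omega)

text \<open>Exterior derivative of the assumed identity between 1-forms. The integrability
  conditions below are all instances of it; for an identity with a single term the second pair is
  taken to be zero.\<close>

lemma Omega_pair_wedge:
  assumes "open V" "z \<in> V" "smooth_on V P" "smooth_on V Q" "smooth_on V P'" "smooth_on V Q'"
    "\<And>y v. y \<in> V \<Longrightarrow> Omega (P y) (ddir Q v y) + Omega (P' y) (ddir Q' v y) = 0"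
  shows "Omega (ddir P w z) (ddir Q v z) + Omega (ddir P' w z) (ddir Q' v z) =
    Omega (ddir P v z) (ddir Q w z) + Omega (ddir P' v z) (ddir Q' w z)"
proof -
  have "ddir (\<lambda>z. Omega (P z) (ddir Q v z)) w z + ddir (\<lambda>z. Omega (P' z) (ddir Q' v z)) w z = 0"
    for v w
  proof -
    have "((\<lambda>z. Omega (R z) (ddir S v z)) has_derivative
        (\<lambda>w. ddir (\<lambda>z. Omega (R z) (ddir S v z)) w z)) (at z)"
      if "smooth_on V R" "smooth_on V S" for R S
      using smooth_onD[OF smooth_on_bilinear[OF assms(1) bounded_bilinear_Omega that(1)
            smooth_on_ddir[OF that(2)]] assms(2)] by (rule has_derivative_ddir)
    note ddir_eq[OF has_derivative_add[OF this[OF assms(3,4)] this[OF assms(5,6)]], of w]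
    moreover have "ddir (\<lambda>y. Omega (P y) (ddir Q v y) + Omega (P' y) (ddir Q' v y)) w z = 0"
      by (rule ddir_zero_on[OF assms(1,2), where c = 0]) (rule assms(7))
    ultimately show ?thesis by simp
  qed
  from this[of v w] this[of w v] show ?thesis
    using Omega_wedge[OF assms(1-4), of v w] Omega_wedge[OF assms(1,2,5,6), of v w] by linarith
qed

section \<open>Symplectic frames over plane domains\<close>

text \<open>Entries of \<theta> become \<Omega>-pairings of the columns with their derivatives:
  lower blocks pair with the first two columns, upper blocks with the last two. So \<omega> depends
  on the tangent columns alone.\<close>

definition plane_om :: "(complex \<Rightarrow> real^4) \<Rightarrow> (complex \<Rightarrow> real^4) \<Rightarrow> complex \<Rightarrow> complex \<Rightarrow> complex" where
  "plane_om x1 x2 v z = Complex ((Omega (x1 z) (ddir x1 v z) - Omega (x2 z) (ddir x2 v z)) / 2)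
     (Omega (x2 z) (ddir x1 v z))"

definition plane_et :: "(complex \<Rightarrow> real^4) \<Rightarrow> (complex \<Rightarrow> real^4) \<Rightarrow> (complex \<Rightarrow> real^4) \<Rightarrow>
    (complex \<Rightarrow> real^4) \<Rightarrow> complex \<Rightarrow> complex \<Rightarrow> complex" where
  "plane_et x1 x2 x3 x4 v z =
     Complex ((Omega (ddir x1 v z) (x3 z) - Omega (ddir x2 v z) (x4 z)) / 2)
       (- (Omega (ddir x1 v z) (x4 z) + Omega (ddir x2 v z) (x3 z)) / 2)"

text \<open>In the identification of \<open>\<real>\<^sup>4\<close> with \<open>\<complex>\<^sup>2\<close>, multiplication by \<open>\<i>\<close> sends the standard basis
  vectors \<open>e\<^sub>1, e\<^sub>2, e\<^sub>3, e\<^sub>4\<close> to \<open>- e\<^sub>2, e\<^sub>1, e\<^sub>4, - e\<^sub>3\<close>; the following map is its conjugate by the frame.\<close>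

definition plane_K :: "(complex \<Rightarrow> real^4) \<Rightarrow> (complex \<Rightarrow> real^4) \<Rightarrow> (complex \<Rightarrow> real^4) \<Rightarrow>
    (complex \<Rightarrow> real^4) \<Rightarrow> complex \<Rightarrow> real^4 \<Rightarrow> real^4" where
  "plane_K x1 x2 x3 x4 z w = Omega w (x4 z) *\<^sub>R x1 z - Omega w (x3 z) *\<^sub>R x2 z
     + Omega w (x2 z) *\<^sub>R x3 z - Omega w (x1 z) *\<^sub>R x4 z"

text \<open>A symplectic frame in coordinates. The columns are separate maps so that single columns
  can be renormalised, as in \<open>third_order_exists\<close>, where only the last one
  changes.\<close>

locale planar_frame =
  fixes V :: "complex set" and x1 x2 x3 x4 :: "complex \<Rightarrow> real^4"
  assumes open_V: "open V"
    and smooth: "smooth_on V x1" "smooth_on V x2" "smooth_on V x3" "smooth_on V x4"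
    and basis: "\<And>z. z \<in> V \<Longrightarrow> sympl_basis (x1 z) (x2 z) (x3 z) (x4 z)"
begin

text \<open>\<open>aij\<close>, \<open>bij\<close>, \<open>cij\<close> are the entries \<open>\<alpha>\<^sup>i\<^sub>j\<close>, \<open>\<beta>\<^sup>i\<^sub>j\<close>, \<open>\<gamma>\<^sup>i\<^sub>j\<close> of \<open>\<theta>\<close>, and
  \<open>om\<close>, \<open>et\<close> are \<open>\<omega>\<close>, \<open>\<eta>\<close>.\<close>

abbreviation "a11 v z \<equiv> Omega (ddir x1 v z) (x3 z)"
abbreviation "a21 v z \<equiv> Omega (ddir x1 v z) (x4 z)"
abbreviation "a12 v z \<equiv> Omega (ddir x2 v z) (x3 z)"
abbreviation "a22 v z \<equiv> Omega (ddir x2 v z) (x4 z)"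
abbreviation "b11 v z \<equiv> Omega (ddir x3 v z) (x3 z)"
abbreviation "b21 v z \<equiv> Omega (ddir x3 v z) (x4 z)"
abbreviation "b22 v z \<equiv> Omega (ddir x4 v z) (x4 z)"
abbreviation "c11 v z \<equiv> Omega (x1 z) (ddir x1 v z)"
abbreviation "c21 v z \<equiv> Omega (x2 z) (ddir x1 v z)"
abbreviation "c22 v z \<equiv> Omega (x2 z) (ddir x2 v z)"

abbreviation "om v z \<equiv> plane_om x1 x2 v z"
abbreviation "et v z \<equiv> plane_et x1 x2 x3 x4 v z"
abbreviation "Kx z w \<equiv> plane_K x1 x2 x3 x4 z w"

lemma diff: "z \<in> V \<Longrightarrow> x1 differentiable (at z)" "z \<in> V \<Longrightarrow> x2 differentiable (at z)"
  "z \<in> V \<Longrightarrow> x3 differentiable (at z)" "z \<in> V \<Longrightarrow> x4 differentiable (at z)"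
  using smooth smooth_onD by blast+

text \<open>Differentiating the constant pairings of the basis vectors shows that \<theta> lies in
  the symplectic Lie algebra: \<beta> and \<gamma> are symmetric and the lower right block is minus
  the transpose of \<alpha>.\<close>

lemma structure_symmetries:
  assumes z: "z \<in> V"
  shows "Omega (x1 z) (ddir x2 v z) = c21 v z"
    "Omega (x1 z) (ddir x3 v z) = - a11 v z" "Omega (x2 z) (ddir x3 v z) = - a12 v z"
    "Omega (x1 z) (ddir x4 v z) = - a21 v z" "Omega (x2 z) (ddir x4 v z) = - a22 v z"
    "Omega (ddir x4 v z) (x3 z) = b21 v z"
proof -
  have "Omega (P z) (ddir Q v z) + Omega (ddir P v z) (Q z) = 0"
    if "P differentiable (at z)" "Q differentiable (at z)" "\<And>y. y \<in> V \<Longrightarrow> Omega (P y) (Q y) = r" for P Q r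
    using ddir_zero_on[OF open_V z, of "\<lambda>y. Omega (P y) (Q y)" r v] that(3)
      ddir_Omega[OF that(1,2), of v] by simp
  note this[OF diff(1)[OF z] diff(2)[OF z], OF sympl_basisD(1)[OF basis]]
    this[OF diff(1)[OF z] diff(3)[OF z], OF sympl_basisD(2)[OF basis]]
    this[OF diff(1)[OF z] diff(4)[OF z], OF sympl_basisD(3)[OF basis]]
    this[OF diff(2)[OF z] diff(3)[OF z], OF sympl_basisD(5)[OF basis]]
    this[OF diff(2)[OF z] diff(4)[OF z], OF sympl_basisD(6)[OF basis]]
    this[OF diff(3)[OF z] diff(4)[OF z], OF sympl_basisD(9)[OF basis]]
  then show "Omega (x1 z) (ddir x2 v z) = c21 v z"
    "Omega (x1 z) (ddir x3 v z) = - a11 v z" "Omega (x2 z) (ddir x3 v z) = - a12 v z"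
    "Omega (x1 z) (ddir x4 v z) = - a21 v z" "Omega (x2 z) (ddir x4 v z) = - a22 v z"
    "Omega (ddir x4 v z) (x3 z) = b21 v z"
    using Omega_commute[of "x2 z" "ddir x1 v z"] Omega_commute[of "x3 z" "ddir x4 v z"] by auto
qed

lemma structure_equations:
  assumes z: "z \<in> V"
  shows "ddir x1 v z = a11 v z *\<^sub>R x1 z + a21 v z *\<^sub>R x2 z + c11 v z *\<^sub>R x3 z + c21 v z *\<^sub>R x4 z"
    "ddir x2 v z = a12 v z *\<^sub>R x1 z + a22 v z *\<^sub>R x2 z + c21 v z *\<^sub>R x3 z + c22 v z *\<^sub>R x4 z"
    "ddir x3 v z = b11 v z *\<^sub>R x1 z + b21 v z *\<^sub>R x2 z + (- a11 v z) *\<^sub>R x3 z + (- a12 v z) *\<^sub>R x4 z"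
    "ddir x4 v z = b21 v z *\<^sub>R x1 z + b22 v z *\<^sub>R x2 z + (- a21 v z) *\<^sub>R x3 z + (- a22 v z) *\<^sub>R x4 z"
  using sympl_basis_expand[OF basis[OF z], of "ddir x1 v z"]
    sympl_basis_expand[OF basis[OF z], of "ddir x2 v z"]
    sympl_basis_expand[OF basis[OF z], of "ddir x3 v z"]
    sympl_basis_expand[OF basis[OF z], of "ddir x4 v z"]
  by (simp_all only: structure_symmetries[OF z])

lemma linear_om: "z \<in> V \<Longrightarrow> linear (\<lambda>v. om v z)"
  unfolding plane_om_def
  by (auto intro!: linearI simp: ddir_dir diff Omega_bilinear_simps complex_eq_iff field_simps)

lemma linear_et: "z \<in> V \<Longrightarrow> linear (\<lambda>v. et v z)"
  unfolding plane_et_def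
  by (auto intro!: linearI simp: ddir_dir diff Omega_bilinear_simps complex_eq_iff field_simps)

text \<open>This is what makes the coefficient \<open>\<ell>\<close> of \<open>\<eta> = h \<omega> + \<ell> \<omega>\<close>-bar real.\<close>

lemma Re_wedge_om_et:
  assumes tr: "\<And>z v. z \<in> V \<Longrightarrow> c11 v z + c22 v z = 0" and z: "z \<in> V"
  shows "Re (et v z * om w z - et w z * om v z) = 0"
proof -
  \<comment> \<open>Exterior derivative of the second order condition. Exchanging \<open>v\<close>
    and \<open>w\<close> also changes the sign by antisymmetry of \<Omega>, so both sides
    vanish.\<close>
  have "Omega (ddir x1 w z) (ddir x1 v z) + Omega (ddir x2 w z) (ddir x2 v z) =
      Omega (ddir x1 v z) (ddir x1 w z) + Omega (ddir x2 v z) (ddir x2 w z)"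
    by (rule Omega_pair_wedge[OF open_V z smooth(1,1,2,2) tr])
  then have "Omega (ddir x1 v z) (ddir x1 w z) + Omega (ddir x2 v z) (ddir x2 w z) = 0"
    using Omega_commute[of "ddir x1 v z" "ddir x1 w z"] Omega_commute[of "ddir x2 v z" "ddir x2 w z"]
    by linarith
  moreover have "Omega (ddir x1 v z) (ddir x1 w z) = a11 v z * c11 w z + a21 v z * c21 w z
      - c11 v z * a11 w z - c21 v z * a21 w z"
    using Omega_sympl_basis[OF basis[OF z]] structure_equations[OF z] by metis
  moreover have "Omega (ddir x2 v z) (ddir x2 w z) = a12 v z * c21 w z + a22 v z * c22 w z
      - c21 v z * a12 w z - c22 v z * a22 w z"
    using Omega_sympl_basis[OF basis[OF z]] structure_equations[OF z] by metis
  moreover have "c22 v z = - c11 v z" "c22 w z = - c11 w z"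
    using tr[OF z] by (simp_all add: eq_neg_iff_add_eq_0 add.commute)
  ultimately show ?thesis
    by (simp add: plane_om_def plane_et_def field_simps)
qed

text \<open>Tangency means that the last two components of \<tau> vanish; their exterior derivatives
  give two real equations \<gamma> \<and> \<tau> = 0. For trace-free \<gamma> these are the real and
  imaginary parts of \<tau> \<and> \<omega> = 0, which makes \<tau> a multiple of \<omega>.\<close>

lemma wedge_tau_om:
  assumes tr: "\<And>z v. z \<in> V \<Longrightarrow> c11 v z + c22 v z = 0" and z: "z \<in> V"
    and \<phi>: "smooth_on V \<phi>"
    and tan: "\<And>z v. z \<in> V \<Longrightarrow> Omega (x1 z) (ddir \<phi> v z) = 0" "\<And>z v. z \<in> V \<Longrightarrow> Omega (x2 z) (ddir \<phi> v z) = 0"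
  defines "ta \<equiv> \<lambda>v. Complex (Omega (ddir \<phi> v z) (x3 z)) (- Omega (ddir \<phi> v z) (x4 z))"
  shows "ta v * om w z = ta w * om v z"
proof -
  have 1: "Omega (ddir x1 w z) (ddir \<phi> v z) = Omega (ddir x1 v z) (ddir \<phi> w z)"
    "Omega (ddir x2 w z) (ddir \<phi> v z) = Omega (ddir x2 v z) (ddir \<phi> w z)"
    using Omega_pair_wedge[OF open_V z smooth(1) \<phi> smooth_on_const[of _ 0] smooth_on_const[of _ 0], of w v]
      Omega_pair_wedge[OF open_V z smooth(2) \<phi> smooth_on_const[of _ 0] smooth_on_const[of _ 0], of w v] tan
    by (simp_all add: ddir_const Omega_bilinear_simps)
  define t1 t2 where "t1 v = Omega (ddir \<phi> v z) (x3 z)" and "t2 v = Omega (ddir \<phi> v z) (x4 z)" for v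
  have \<phi>v: "ddir \<phi> v z = t1 v *\<^sub>R x1 z + t2 v *\<^sub>R x2 z" for v
    using sympl_basis_expand[OF basis[OF z], of "ddir \<phi> v z"] tan[OF z] by (simp add: t1_def t2_def)
  have "Omega (ddir x1 w z) (ddir \<phi> v z) = - (t1 v * c11 w z + t2 v * c21 w z)"
    "Omega (ddir x2 w z) (ddir \<phi> v z) = - (t1 v * c21 w z + t2 v * c22 w z)" for v w
    unfolding \<phi>v using Omega_commute[of "x1 z"] Omega_commute[of "x2 z"] structure_symmetries(1)[OF z]
    by (auto simp: Omega_bilinear_simps)
  with 1 have "t1 v * c11 w z + t2 v * c21 w z = t1 w * c11 v z + t2 w * c21 v z"
    "t1 v * c21 w z + t2 v * c22 w z = t1 w * c21 v z + t2 w * c22 v z"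
    by simp_all
  moreover have "c22 v z = - c11 v z" for v
    using tr[OF z, of v] by simp
  ultimately show ?thesis
    unfolding ta_def t1_def[symmetric] t2_def[symmetric] by (simp add: plane_om_def complex_eq_iff algebra_simps)
qed

text \<open>If \<eta> = 0, the differences \<open>a11 - a22\<close> and \<open>a12 + a21\<close>
  vanish, and so do their exterior derivatives. The terms quadratic in \<alpha> and those in
  \<open>b21\<close> cancel, which leaves the wedge products of \<open>b11 + b22\<close> with
  \<open>c11\<close> and with \<open>c21\<close>. As \<omega> is injective, these two forms are
  independent.\<close>

lemma beta_trace_free:
  assumes tr: "\<And>z v. z \<in> V \<Longrightarrow> c11 v z + c22 v z = 0"
    and et: "\<And>z v. z \<in> V \<Longrightarrow> et v z = 0"
    and inj: "\<And>v. v \<noteq> 0 \<Longrightarrow> om v z \<noteq> 0" and z: "z \<in> V"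
  shows "b11 v z + b22 v z = 0"
proof -
  have eqs: "a22 v z = a11 v z" "a12 v z = - a21 v z" "c22 v z = - c11 v z" if "z \<in> V" for v z
    using et[OF that, of v] tr[OF that, of v] by (simp_all add: plane_et_def complex_eq_iff)
  define B where "B v = b11 v z + b22 v z" for v
  have "Omega (ddir x4 w z) (ddir x2 v z) + Omega (- ddir x3 w z) (ddir x1 v z) =
      Omega (ddir x4 v z) (ddir x2 w z) + Omega (- ddir x3 v z) (ddir x1 w z)" for v w
  proof -
    have "ddir (\<lambda>z. - x3 z) v z = - ddir x3 v z" for v
      by (rule ddir_linear[OF bounded_linear_minus[OF bounded_linear_ident] diff(3)[OF z]])
    moreover have "Omega (x4 z) (ddir x2 v z) + Omega (- x3 z) (ddir x1 v z) = 0" if "z \<in> V" for v z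
      using eqs(1)[OF that, of v] Omega_commute[of "x4 z"] Omega_commute[of "x3 z"]
      by (simp add: Omega_bilinear_simps)
    ultimately show ?thesis
      using Omega_pair_wedge[OF open_V z smooth(4,2) smooth_on_minus[OF open_V smooth(3)] smooth(1), of w v]
      by simp
  qed
  moreover have "Omega (ddir x4 w z) (ddir x1 v z) + Omega (ddir x3 w z) (ddir x2 v z) =
      Omega (ddir x4 v z) (ddir x1 w z) + Omega (ddir x3 v z) (ddir x2 w z)" for v w
  proof -
    have "Omega (x4 z) (ddir x1 v z) + Omega (x3 z) (ddir x2 v z) = 0" if "z \<in> V" for v z
      using eqs(2)[OF that, of v] Omega_commute[of "x4 z"] Omega_commute[of "x3 z"]
      by (simp add: Omega_bilinear_simps)
    then show ?thesis
      using Omega_pair_wedge[OF open_V z smooth(4,1,3,2), of w v] by simp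
  qed
  moreover have "Omega (ddir x4 w z) (ddir x2 v z) = b21 w z * c21 v z + b22 w z * c22 v z
      - (- a21 w z) * a12 v z - (- a22 w z) * a22 v z"
    "Omega (ddir x3 w z) (ddir x1 v z) = b11 w z * c11 v z + b21 w z * c21 v z
      - (- a11 w z) * a11 v z - (- a12 w z) * a21 v z"
    "Omega (ddir x4 w z) (ddir x1 v z) = b21 w z * c11 v z + b22 w z * c21 v z
      - (- a21 w z) * a11 v z - (- a22 w z) * a21 v z"
    "Omega (ddir x3 w z) (ddir x2 v z) = b11 w z * c21 v z + b21 w z * c22 v z
      - (- a11 w z) * a12 v z - (- a12 w z) * a22 v z" for v w
    using Omega_sympl_basis[OF basis[OF z]] structure_equations[OF z] by metis+
  ultimately have "c11 v z * B w = c11 w z * B v" "c21 v z * B w = c21 w z * B v" for v w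
    by (simp_all add: Omega_bilinear_simps eqs[OF z] B_def algebra_simps)
  then have "B w *\<^sub>R om v z = B v *\<^sub>R om w z" for v w
    by (simp add: plane_om_def eqs[OF z] complex_eq_iff mult.commute)
  then have "om (B w *\<^sub>R v - B v *\<^sub>R w) z = 0" for v w
    using linear_diff[OF linear_om[OF z]] linear_scale[OF linear_om[OF z]] by simp
  \<comment> \<open>The choice w = i v: this vector is independent of v unless v = 0, so both
    coefficients must vanish.\<close>
  then have *: "B v *\<^sub>R (\<i> * v) = B (\<i> * v) *\<^sub>R v"
    using inj by (metis right_minus_eq)
  show ?thesis
  proof (cases "v = 0")
    case True
    then show ?thesis
      by (simp add: ddir_dir diff z Omega_bilinear_simps)
  next
    case False
    from * have "(of_real (B v) * \<i> - of_real (B (\<i> * v))) * v = 0"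
      by (simp add: scaleR_conv_of_real algebra_simps)
    with False have "of_real (B v) * \<i> - of_real (B (\<i> * v)) = 0"
      by (simp only: mult_eq_0_iff simp_thms)
    then have "B v = 0"
      by (simp add: complex_eq_iff)
    then show ?thesis by (simp add: B_def)
  qed
qed

lemma Kx_basis:
  assumes "z \<in> V"
  shows "Kx z (x1 z) = - x2 z" "Kx z (x2 z) = x1 z" "Kx z (x3 z) = x4 z" "Kx z (x4 z) = - x3 z"
  by (simp_all add: plane_K_def sympl_basisD[OF basis[OF assms]])

lemma linear_Kx: "linear (Kx z)"
  by (auto intro!: linearI simp: plane_K_def Omega_bilinear_simps algebra_simps)

lemma Kx_deriv_zero:
  assumes tr: "\<And>z v. z \<in> V \<Longrightarrow> c11 v z + c22 v z = 0"
    and et: "\<And>z v. z \<in> V \<Longrightarrow> et v z = 0"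
    and inj: "\<And>v. v \<noteq> 0 \<Longrightarrow> om v z \<noteq> 0" and z: "z \<in> V"
  shows "((\<lambda>z. Kx z w) has_derivative (\<lambda>v. 0)) (at z)"
proof -
  note D = has_derivative_ddir[OF diff(1)[OF z]] has_derivative_ddir[OF diff(2)[OF z]]
    has_derivative_ddir[OF diff(3)[OF z]] has_derivative_ddir[OF diff(4)[OF z]]
  note OD = bounded_bilinear.FDERIV[OF bounded_bilinear_Omega has_derivative_const]
  have "((\<lambda>z. Kx z w) has_derivative (\<lambda>v.
      (Omega w (x4 z) *\<^sub>R ddir x1 v z + Omega w (ddir x4 v z) *\<^sub>R x1 z)
    - (Omega w (x3 z) *\<^sub>R ddir x2 v z + Omega w (ddir x3 v z) *\<^sub>R x2 z)
    + (Omega w (x2 z) *\<^sub>R ddir x3 v z + Omega w (ddir x2 v z) *\<^sub>R x3 z)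
    - (Omega w (x1 z) *\<^sub>R ddir x4 v z + Omega w (ddir x1 v z) *\<^sub>R x4 z))) (at z)"
    unfolding plane_K_def
    using OD[OF D(1), of w] OD[OF D(2), of w] OD[OF D(3), of w] OD[OF D(4), of w]
    by (intro has_derivative_add has_derivative_diff has_derivative_scaleR D)
      (simp_all add: Omega_bilinear_simps)
  moreover have "(Omega w (x4 z) *\<^sub>R ddir x1 v z + Omega w (ddir x4 v z) *\<^sub>R x1 z)
    - (Omega w (x3 z) *\<^sub>R ddir x2 v z + Omega w (ddir x3 v z) *\<^sub>R x2 z)
    + (Omega w (x2 z) *\<^sub>R ddir x3 v z + Omega w (ddir x2 v z) *\<^sub>R x3 z)
    - (Omega w (x1 z) *\<^sub>R ddir x4 v z + Omega w (ddir x1 v z) *\<^sub>R x4 z) = 0" for v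
  proof -
    \<comment> \<open>Of the ten entries of a symplectic \<theta> six remain free, the others being
      equal to these up to sign. They describe the copy of sl(2,C) that commutes with the complex
      structure.\<close>
    define p m q r b b' where "p = a11 v z" "m = a21 v z" "q = c11 v z" "r = c21 v z"
      "b = b11 v z" "b' = b21 v z"
    have "a22 v z = p" "a12 v z = - m" "c22 v z = - q" "b22 v z = - b"
      using et[OF z, of v] tr[OF z, of v] beta_trace_free[OF assms, of v]
      by (simp_all add: plane_et_def complex_eq_iff p_m_q_r_b_b'_def)
    then have E: "ddir x1 v z = p *\<^sub>R x1 z + m *\<^sub>R x2 z + q *\<^sub>R x3 z + r *\<^sub>R x4 z"
      "ddir x2 v z = (- m) *\<^sub>R x1 z + p *\<^sub>R x2 z + r *\<^sub>R x3 z + (- q) *\<^sub>R x4 z"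
      "ddir x3 v z = b *\<^sub>R x1 z + b' *\<^sub>R x2 z + (- p) *\<^sub>R x3 z + m *\<^sub>R x4 z"
      "ddir x4 v z = b' *\<^sub>R x1 z + (- b) *\<^sub>R x2 z + (- m) *\<^sub>R x3 z + (- p) *\<^sub>R x4 z"
      using structure_equations[OF z, of v] by (simp_all add: p_m_q_r_b_b'_def)
    show ?thesis
      unfolding E by (simp add: Omega_bilinear_simps algebra_simps)
  qed
  ultimately show ?thesis by simp
qed

end

section \<open>Charts and changes of coordinates\<close>

lemma chart_inv_snd: "is_chart c \<Longrightarrow> q \<in> chart_dom c \<Longrightarrow> chart_inv c (snd c q) = q"
  by (auto simp: is_chart_def homeomorphism_def)

lemma snd_chart_inv: "z \<in> snd c ` chart_dom c \<Longrightarrow> snd c (chart_inv c z) = z"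
  by (simp add: f_inv_into_f)

lemma chart_inv_mem: "z \<in> snd c ` chart_dom c \<Longrightarrow> chart_inv c z \<in> chart_dom c"
  by (simp add: inv_into_into)

lemma chart_inv_image:
  assumes "is_chart c" "z \<in> snd c ` (chart_dom c \<inter> U)"
  shows "chart_inv c z \<in> chart_dom c \<inter> U"
  using assms chart_inv_snd by fastforce

lemma open_chart_dom: "is_chart c \<Longrightarrow> open (chart_dom c)"
  by (simp add: is_chart_def)

lemma open_chart_image:
  assumes "is_chart c" "open U"
  shows "open (snd c ` (chart_dom c \<inter> U))"
proof -
  have "openin (top_of_set (snd c ` chart_dom c)) (snd c ` (chart_dom c \<inter> U))"
    using assms by (intro homeomorphism_imp_open_map[of "chart_dom c" _ "snd c" "chart_inv c"])
      (auto simp: is_chart_def)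
  then show ?thesis
    using assms(1) by (auto simp: is_chart_def elim: openin_open_trans)
qed

lemma continuous_chart_inv: "is_chart c \<Longrightarrow> continuous_on (snd c ` chart_dom c) (chart_inv c)"
  by (auto simp: is_chart_def homeomorphism_def)

lemma open_chart_preimage:
  assumes "is_chart c" "open V" "V \<subseteq> snd c ` chart_dom c"
  shows "open (chart_inv c ` V)"
proof -
  have "homeomorphism (snd c ` chart_dom c) (chart_dom c) (chart_inv c) (snd c)"
    using assms(1) homeomorphism_symD by (auto simp: is_chart_def)
  then have "openin (top_of_set (chart_dom c)) (chart_inv c ` V)"
    using assms by (intro homeomorphism_imp_open_map) (auto intro: open_subset)
  then show ?thesis
    using open_chart_dom[OF assms(1)] openin_open_trans by blast
qed

lemma dif_ddir: "dif c F q v = ddir (F \<circ> chart_inv c) v (snd c q)"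
  by (simp add: dif_def ddir_def)

lemma local_change:
  assumes c: "is_chart c" and z: "z \<in> snd d ` (chart_dom d \<inter> chart_dom c)" and d: "is_chart d"
  shows "(F \<circ> chart_inv d) z = (F \<circ> chart_inv c) (transition d c z)"
  using chart_inv_image[OF d z] chart_inv_snd[OF c] by (simp add: transition_def)

lemma has_derivative_change:
  assumes c: "is_chart c" and d: "is_chart d" and q: "q \<in> chart_dom c" "q \<in> chart_dom d"
    and T: "transition d c differentiable (at (snd d q))"
    and F: "(F \<circ> chart_inv c) differentiable (at (snd c q))"
  shows "((F \<circ> chart_inv d) has_derivative (\<lambda>v. dif c F q (dif d (snd c) q v))) (at (snd d q))"
proof -
  let ?S = "snd d ` (chart_dom d \<inter> chart_dom c)"
  have T': "(transition d c has_derivative (\<lambda>v. dif d (snd c) q v)) (at (snd d q))"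
    using has_derivative_ddir[OF T] by (simp add: dif_ddir transition_def)
  have "transition d c (snd d q) = snd c q"
    using chart_inv_snd[OF d q(2)] by (simp add: transition_def)
  then have "((F \<circ> chart_inv c) has_derivative (\<lambda>v. dif c F q v)) (at (transition d c (snd d q)))"
    using has_derivative_ddir[OF F] by (simp add: dif_ddir)
  from has_derivative_compose[OF T' this]
  have "((\<lambda>z. (F \<circ> chart_inv c) (transition d c z)) has_derivative (\<lambda>v. dif c F q (dif d (snd c) q v)))
      (at (snd d q))" .
  then show ?thesis
    by (rule has_derivative_transform_within_open[OF _ open_chart_image[OF d open_chart_dom[OF c]]])
      (use q in \<open>auto intro!: local_change[OF c _ d, symmetric] simp del: o_apply\<close>)
qed

lemma dif_change:
  assumes "is_chart c" "is_chart d" "q \<in> chart_dom c" "q \<in> chart_dom d"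
    "transition d c differentiable (at (snd d q))" "(F \<circ> chart_inv c) differentiable (at (snd c q))"
  shows "dif d F q v = dif c F q (dif d (snd c) q v)"
  using ddir_eq[OF has_derivative_change[OF assms]] by (simp add: dif_ddir)

text \<open>Frames and new coordinates are constructed in a single chart; this yields their
  smoothness in every other chart on the overlap.\<close>

lemma smooth_change:
  assumes c: "is_chart c" and d: "is_chart d" and T: "smooth_on (transition_dom d c) (transition d c)"
    and U: "open U" and F: "smooth_on (snd c ` (chart_dom c \<inter> U)) (F \<circ> chart_inv c)"
  shows "smooth_on (snd d ` (chart_dom d \<inter> (chart_dom c \<inter> U))) (F \<circ> chart_inv d)"
proof -
  let ?S = "snd d ` (chart_dom d \<inter> (chart_dom c \<inter> U))"
  have S: "open ?S"
    by (intro open_chart_image d open_Int open_chart_dom c U)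
  have sub: "?S \<subseteq> transition_dom d c"
    by (auto simp: transition_dom_def)
  have "smooth_on ?S (\<lambda>z. (F \<circ> chart_inv c) (transition d c z))"
  proof (rule smooth_on_compose[OF S open_chart_image[OF c U] _ _ F])
    show "transition d c ` ?S \<subseteq> snd c ` (chart_dom c \<inter> U)"
      using chart_inv_snd[OF d] by (auto simp: transition_def)
    show "smooth_on ?S (transition d c)"
      using T sub by (rule smooth_on_subset)
  qed
  then show ?thesis
    by (rule smooth_on_cong[OF S])
      (use sub in \<open>auto intro!: local_change[OF c _ d, symmetric] simp del: o_apply\<close>)
qed

lemma oriented_transitionD:
  assumes "oriented_transition d c" "q \<in> chart_dom c" "q \<in> chart_dom d" "is_chart c" "is_chart d"
  shows "transition d c differentiable (at (snd d q))" "linear (dif d (snd c) q)"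
    "plane_det (dif d (snd c) q) > 0"
proof -
  have q: "snd d q \<in> transition_dom d c"
    using assms by (auto simp: transition_dom_def)
  then show D: "transition d c differentiable (at (snd d q))"
    using assms(1) by (auto simp: oriented_transition_def intro: smooth_onD)
  from linear_ddir[OF D] show "linear (dif d (snd c) q)"
    by (simp add: dif_ddir[abs_def] transition_def)
  show "plane_det (dif d (snd c) q) > 0"
    using assms(1) q by (auto simp: oriented_transition_def transition_def dif_def[abs_def])
qed

lemma linear_plane: "linear L \<Longrightarrow> L v = Re v *\<^sub>R L 1 + Im v *\<^sub>R L \<i>" for L :: "complex \<Rightarrow> 'a::real_vector"
proof -
  assume L: "linear L"
  have "v = Re v *\<^sub>R 1 + Im v *\<^sub>R \<i>"
    by (simp add: complex_eq_iff)
  then have "L v = L (Re v *\<^sub>R 1 + Im v *\<^sub>R \<i>)"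
    by simp
  then show ?thesis
    by (simp only: linear_add[OF L] linear_scale[OF L])
qed

lemma plane_det_compose:
  assumes "linear L" "linear M"
  shows "plane_det (\<lambda>v. L (M v)) = plane_det L * plane_det M"
  unfolding plane_det_def linear_plane[OF assms(1), of "M 1"] linear_plane[OF assms(1), of "M \<i>"]
  by (simp add: algebra_simps)

lemma plane_det_inj:
  assumes "linear L" "plane_det L \<noteq> 0" "L v = 0"
  shows "v = 0"
proof -
  have "Re v * Re (L 1) + Im v * Re (L \<i>) = 0" "Re v * Im (L 1) + Im v * Im (L \<i>) = 0"
    using assms(3) unfolding linear_plane[OF assms(1), of v] by (auto simp: complex_eq_iff)
  then have "Re v * plane_det L = 0" "Im v * plane_det L = 0"
    unfolding plane_det_def by algebra+
  then show ?thesis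
    using assms(2) by (simp add: complex_eq_iff)
qed

section \<open>Oriented planes\<close>

lemma oriented_plane_iff: "(x', y') \<in> oriented_plane x y \<longleftrightarrow>
    (\<exists>a b c d. x' = a *\<^sub>R x + b *\<^sub>R y \<and> y' = c *\<^sub>R x + d *\<^sub>R y \<and> a * d - b * c > 0)"
  by (auto simp: oriented_plane_def)

lemma oriented_plane_refl: "(x, y) \<in> oriented_plane x y"
  unfolding oriented_plane_iff
  by (rule exI[of _ 1], rule exI[of _ 0], rule exI[of _ 0], rule exI[of _ 1]) simp

lemma oriented_plane_trans:
  assumes "p \<in> oriented_plane x' y'" "(x', y') \<in> oriented_plane x y"
  shows "p \<in> oriented_plane x y"
proof -
  obtain a b c d where 1: "fst p = a *\<^sub>R x' + b *\<^sub>R y'" "snd p = c *\<^sub>R x' + d *\<^sub>R y'" "a * d - b * c > 0"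
    using assms(1) oriented_plane_iff[of "fst p" "snd p"] by auto
  obtain a' b' c' d' where 2: "x' = a' *\<^sub>R x + b' *\<^sub>R y" "y' = c' *\<^sub>R x + d' *\<^sub>R y" "a' * d' - b' * c' > 0"
    using assms(2) oriented_plane_iff by blast
  have "(a * a' + b * c') * (c * b' + d * d') - (a * b' + b * d') * (c * a' + d * c')
      = (a * d - b * c) * (a' * d' - b' * c')"
    by algebra
  then have "(a * a' + b * c') * (c * b' + d * d') - (a * b' + b * d') * (c * a' + d * c') > 0"
    using 1(3) 2(3) by simp
  moreover have "fst p = (a * a' + b * c') *\<^sub>R x + (a * b' + b * d') *\<^sub>R y"
    "snd p = (c * a' + d * c') *\<^sub>R x + (c * b' + d * d') *\<^sub>R y"
    by (simp_all add: 1(1,2) 2(1,2) algebra_simps)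
  ultimately have "(fst p, snd p) \<in> oriented_plane x y"
    unfolding oriented_plane_iff by blast
  then show ?thesis by simp
qed

lemma oriented_plane_sym:
  assumes "(x', y') \<in> oriented_plane x y"
  shows "(x, y) \<in> oriented_plane x' y'"
proof -
  obtain a b c d where 1: "x' = a *\<^sub>R x + b *\<^sub>R y" "y' = c *\<^sub>R x + d *\<^sub>R y" "a * d - b * c > 0"
    using assms oriented_plane_iff by blast
  define e where "e = 1 / (a * d - b * c)"
  have e: "e * (a * d - b * c) = 1" "e > 0"
    using 1(3) by (simp_all add: e_def)
  have "x = (e * (a * d - b * c)) *\<^sub>R x" "y = (e * (a * d - b * c)) *\<^sub>R y"
    by (simp_all only: e(1) scaleR_one)
  then have "x = (e * d) *\<^sub>R x' + (- (e * b)) *\<^sub>R y'" "y = (- (e * c)) *\<^sub>R x' + (e * a) *\<^sub>R y'"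
    unfolding 1(1,2) by (simp_all add: algebra_simps)
  moreover have "(e * d) * (e * a) - (- (e * b)) * (- (e * c)) = e * (e * (a * d - b * c))"
    by (simp add: algebra_simps)
  ultimately show ?thesis
    unfolding oriented_plane_iff using e by (metis mult.right_neutral)
qed

lemma oriented_plane_eq:
  assumes "(x', y') \<in> oriented_plane x y"
  shows "oriented_plane x' y' = oriented_plane x y"
  using oriented_plane_trans[OF _ assms] oriented_plane_trans[OF _ oriented_plane_sym[OF assms]] by blast

text \<open>The bases are listed in the reversed order of \<open>gauss_map\<close>. Reversing both
  of them leaves the determinant of the change of basis equal to \<open>plane_det L\<close>, so the
  Gauss map does not depend on the chart.\<close>

lemma oriented_plane_change:
  fixes L :: "complex \<Rightarrow> complex" and G :: "complex \<Rightarrow> real^4"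
  assumes "linear L" "linear G" "plane_det L > 0"
  shows "oriented_plane (G (L \<i>)) (G (L 1)) = oriented_plane (G \<i>) (G 1)"
proof (rule oriented_plane_eq)
  have "G (L \<i>) = Im (L \<i>) *\<^sub>R G \<i> + Re (L \<i>) *\<^sub>R G 1" "G (L 1) = Im (L 1) *\<^sub>R G \<i> + Re (L 1) *\<^sub>R G 1"
    using linear_plane[OF assms(2), of "L 1"] linear_plane[OF assms(2), of "L \<i>"] by (simp_all add: add.commute)
  moreover have "Im (L \<i>) * Re (L 1) - Re (L \<i>) * Im (L 1) > 0"
    using assms(3) by (simp add: plane_det_def mult.commute)
  ultimately show "(G (L \<i>), G (L 1)) \<in> oriented_plane (G \<i>) (G 1)"
    unfolding oriented_plane_iff by blast
qed

section \<open>Frames in coordinates\<close>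

definition frame_col :: "'a chart \<Rightarrow> ('a \<Rightarrow> real^4^4) \<Rightarrow> 4 \<Rightarrow> complex \<Rightarrow> real^4" where
  "frame_col c X j z = column j (X (chart_inv c z))"

lemma column_mult: "column j (M ** N) = M *v column j N" for M N :: "real^4^4"
  by (simp add: vec_eq_iff column_def matrix_matrix_mult_def matrix_vector_mult_def)

lemma frame_theta_entry:
  assumes "(X \<circ> chart_inv c) differentiable (at (snd c q))"
  shows "frame_theta c X q v $ i $ j = (matrix_inv (X q) *v ddir (frame_col c X j) v (snd c q)) $ i"
proof -
  have "frame_theta c X q v $ i $ j = column j (frame_theta c X q v) $ i"
    by (simp add: column_def)
  also have "\<dots> = (matrix_inv (X q) *v column j (dif c X q v)) $ i"
    by (simp add: frame_theta_def column_mult)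
  also have "column j (dif c X q v) = ddir (frame_col c X j) v (snd c q)"
    using ddir_linear[OF bounded_linear_column assms, of j v]
    by (simp add: dif_ddir frame_col_def[abs_def])
  finally show ?thesis .
qed

lemma differentiable_frame_col:
  "(X \<circ> chart_inv c) differentiable (at z) \<Longrightarrow> frame_col c X j differentiable (at z)"
  using bounded_linear.has_derivative[OF bounded_linear_column, of "X \<circ> chart_inv c" _ "at z" j]
  by (auto simp: frame_col_def[abs_def] o_def differentiable_def)

lemma frame_theta_gamma:
  assumes "(X \<circ> chart_inv c) differentiable (at (snd c q))" "X q \<in> Sp4" "chart_inv c (snd c q) = q"
  defines "z \<equiv> snd c q" and "y \<equiv> \<lambda>j. frame_col c X j (snd c q)"
  shows "frame_theta c X q v $ 3 $ j = Omega (y 1) (ddir (frame_col c X j) v z)"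
    "frame_theta c X q v $ 4 $ j = Omega (y 2) (ddir (frame_col c X j) v z)"
    "frame_theta c X q v $ 1 $ j = Omega (ddir (frame_col c X j) v z) (y 3)"
    "frame_theta c X q v $ 2 $ j = Omega (ddir (frame_col c X j) v z) (y 4)"
  unfolding frame_theta_entry[OF assms(1)] Sp4_inv_mult[OF assms(2)] z_def y_def
  by (simp_all add: frame_col_def assms(3))

lemma planar_frame_cols:
  assumes c: "is_chart c" and "c \<in> A" and X: "symplectic_frame A U X"
  shows "planar_frame (snd c ` (chart_dom c \<inter> U)) (frame_col c X 1) (frame_col c X 2)
    (frame_col c X 3) (frame_col c X 4)"
proof -
  let ?V = "snd c ` (chart_dom c \<inter> U)"
  have V: "open ?V"
    using X by (intro open_chart_image[OF c]) (simp add: symplectic_frame_def)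
  have "smooth_on ?V (frame_col c X j)" for j
    using X \<open>c \<in> A\<close> smooth_on_linear[OF V bounded_linear_column, of "X \<circ> chart_inv c" j]
    by (simp add: symplectic_frame_def smooth_on_surface_def frame_col_def[abs_def])
  moreover have "sympl_basis (frame_col c X 1 z) (frame_col c X 2 z) (frame_col c X 3 z) (frame_col c X 4 z)"
    if "z \<in> ?V" for z
    using X chart_inv_image[OF c that] unfolding frame_col_def Sp4_iff[symmetric]
    by (auto simp: symplectic_frame_def)
  ultimately show ?thesis
    by (simp add: planar_frame_def V)
qed

lemma symplectic_frame_point:
  assumes c: "is_chart c" and "c \<in> A" and X: "symplectic_frame A U X" and q: "q \<in> U" "q \<in> chart_dom c"
  shows "(X \<circ> chart_inv c) differentiable (at (snd c q))" "X q \<in> Sp4" "chart_inv c (snd c q) = q"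
    "snd c q \<in> snd c ` (chart_dom c \<inter> U)"
  using assms chart_inv_snd[OF c q(2)] smooth_onD[of "snd c ` (chart_dom c \<inter> U)"]
  by (auto simp: symplectic_frame_def smooth_on_surface_def)

lemma frame_forms_planar:
  assumes "(X \<circ> chart_inv c) differentiable (at (snd c q))" "X q \<in> Sp4" "chart_inv c (snd c q) = q"
  shows "frame_omega c X q v = plane_om (frame_col c X 1) (frame_col c X 2) v (snd c q)"
    "frame_eta c X q v = plane_et (frame_col c X 1) (frame_col c X 2)
        (frame_col c X 3) (frame_col c X 4) v (snd c q)"
  unfolding frame_omega_def frame_eta_def plane_om_def plane_et_def frame_theta_gamma[OF assms]
  by (simp_all add: complex_eq_iff)

definition col_frame :: "'a chart \<Rightarrow> (complex \<Rightarrow> real^4) \<Rightarrow> (complex \<Rightarrow> real^4) \<Rightarrow> (complex \<Rightarrow> real^4) \<Rightarrow>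
    (complex \<Rightarrow> real^4) \<Rightarrow> 'a \<Rightarrow> real^4^4" where
  "col_frame c x1 x2 x3 x4 q = of_columns (x1 (snd c q)) (x2 (snd c q)) (x3 (snd c q)) (x4 (snd c q))"

lemma frame_col_col_frame:
  assumes "z \<in> snd c ` chart_dom c"
  shows "frame_col c (col_frame c x1 x2 x3 x4) 1 z = x1 z" "frame_col c (col_frame c x1 x2 x3 x4) 2 z = x2 z"
    "frame_col c (col_frame c x1 x2 x3 x4) 3 z = x3 z" "frame_col c (col_frame c x1 x2 x3 x4) 4 z = x4 z"
  by (simp_all add: frame_col_def col_frame_def snd_chart_inv[OF assms])

lemma gauss_map_transition:
  assumes ch: "is_chart c" "is_chart d" "oriented_transition d c" and q: "q \<in> chart_dom c" "q \<in> chart_dom d"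
    and F: "(f \<circ> chart_inv c) differentiable (at (snd c q))"
  shows "gauss_map d f q = gauss_map c f q"
proof -
  note T = oriented_transitionD[OF ch(3) q ch(1,2)]
  have "linear (dif c f q)"
    using linear_ddir[OF F] by (simp add: dif_ddir[abs_def])
  from oriented_plane_change[OF T(2) this T(3)]
  show ?thesis
    by (simp add: gauss_map_def dif_change[OF ch(1,2) q T(1) F])
qed

lemma smooth_on_surface_differentiable:
  assumes "smooth_on_surface A UNIV f" "c \<in> A" "q \<in> chart_dom c"
  shows "(f \<circ> chart_inv c) differentiable (at (snd c q))"
  using assms smooth_onD[of "snd c ` (chart_dom c \<inter> UNIV)"] by (auto simp: smooth_on_surface_def)

lemma gauss_map_change:
  assumes A: "oriented_surface A" and f: "smooth_on_surface A UNIV f" and cd: "c \<in> A" "d \<in> A"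
    and q: "q \<in> chart_dom c" "q \<in> chart_dom d"
  shows "gauss_map d f q = gauss_map c f q"
  using A cd by (intro gauss_map_transition q smooth_on_surface_differentiable[OF f])
    (auto simp: oriented_surface_def)

text \<open>Passage from a planar construction to a frame field on the surface. A frame field needs
  a connected domain, so later uses restrict to a ball first.\<close>

lemma first_order_col_frame:
  assumes A: "oriented_surface A" and f: "smooth_on_surface A UNIV f" and c: "c \<in> A"
    and V: "open V" "connected V" "V \<subseteq> snd c ` chart_dom c" and P: "planar_frame V x1 x2 x3 x4"
    and plane: "\<And>z. z \<in> V \<Longrightarrow> (ddir (f \<circ> chart_inv c) \<i> z, ddir (f \<circ> chart_inv c) 1 z) \<in> oriented_plane (x1 z) (x2 z)"
  shows "first_order_frame A f (chart_inv c ` V) (col_frame c x1 x2 x3 x4)"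
proof -
  let ?U = "chart_inv c ` V" and ?X = "col_frame c x1 x2 x3 x4"
  interpret P: planar_frame V x1 x2 x3 x4 by (rule P)
  have ch: "is_chart c"
    using A c by (auto simp: oriented_surface_def)
  have U: "open ?U" "?U \<subseteq> chart_dom c"
    using open_chart_preimage[OF ch V(1,3)] V(3) by (auto simp: subset_iff intro: chart_inv_mem)
  have inverse_q: "snd c q \<in> V" "chart_inv c (snd c q) = q" if q: "q \<in> ?U" for q
  proof -
    obtain z where z: "z \<in> V" "q = chart_inv c z"
      using q by blast
    then have "snd c q = z"
      using V(3) by (auto intro: snd_chart_inv)
    then show "snd c q \<in> V" "chart_inv c (snd c q) = q"
      using z by simp_all
  qed
  have im: "snd c ` (chart_dom c \<inter> ?U) = V"
  proof
    show "snd c ` (chart_dom c \<inter> ?U) \<subseteq> V"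
      using inverse_q(1) by blast
    show "V \<subseteq> snd c ` (chart_dom c \<inter> ?U)"
    proof
      fix z assume z: "z \<in> V"
      then have "snd c (chart_inv c z) = z"
        using V(3) by (auto intro: snd_chart_inv)
      moreover have "chart_inv c z \<in> chart_dom c \<inter> ?U"
        using z U(2) by auto
      ultimately show "z \<in> snd c ` (chart_dom c \<inter> ?U)"
        by (intro image_eqI[where x = "chart_inv c z"]) simp_all
    qed
  qed
  have "connected ?U"
    by (rule connected_continuous_image[OF continuous_on_subset[OF continuous_chart_inv[OF ch] V(3)] V(2)])
  moreover have "smooth_on_surface A ?U ?X"
    unfolding smooth_on_surface_def
  proof
    fix d assume d: "d \<in> A"
    have d': "is_chart d" "smooth_on (transition_dom d c) (transition d c)"
      using A c d by (auto simp: oriented_surface_def oriented_transition_def)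
    have "smooth_on V (\<lambda>z. \<chi> i. \<chi> j::4. if j = 1 then x1 z $ i else if j = 2 then x2 z $ i
        else if j = 3 then x3 z $ i else x4 z $ i)"
    proof (intro smooth_on_vec_lambda V(1))
      fix i j :: 4
      show "smooth_on V (\<lambda>z. if j = 1 then x1 z $ i else if j = 2 then x2 z $ i
        else if j = 3 then x3 z $ i else x4 z $ i)"
        using smooth_on_linear[OF V(1) bounded_linear_vec_nth P.smooth(1), of i]
          smooth_on_linear[OF V(1) bounded_linear_vec_nth P.smooth(2), of i]
          smooth_on_linear[OF V(1) bounded_linear_vec_nth P.smooth(3), of i]
          smooth_on_linear[OF V(1) bounded_linear_vec_nth P.smooth(4), of i]
        by (cases "j = 1"; cases "j = 2"; cases "j = 3"; simp)
    qed
    then have "smooth_on V (?X \<circ> chart_inv c)"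
      by (rule smooth_on_cong[OF V(1)])
        (use V(3) in \<open>simp add: col_frame_def of_columns_def snd_chart_inv subset_iff\<close>)
    then have "smooth_on (snd d ` (chart_dom d \<inter> (chart_dom c \<inter> ?U))) (?X \<circ> chart_inv d)"
      by (intro smooth_change[OF ch d' U(1)]) (simp add: im)
    then show "smooth_on (snd d ` (chart_dom d \<inter> ?U)) (?X \<circ> chart_inv d)"
      using U(2) by (simp add: inf_absorb2)
  qed
  moreover have "?X q \<in> Sp4" if "q \<in> ?U" for q
    using P.basis[OF inverse_q(1)[OF that]] by (simp add: Sp4_iff col_frame_def)
  moreover have "gauss_map d f q = oriented_plane (column 1 (?X q)) (column 2 (?X q))"
    if "d \<in> A" "q \<in> ?U \<inter> chart_dom d" for d q
  proof -
    have "gauss_map d f q = gauss_map c f q"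
      using that U(2) by (intro gauss_map_change[OF A f c]) auto
    also have "\<dots> = oriented_plane (x1 (snd c q)) (x2 (snd c q))"
      unfolding gauss_map_def dif_ddir using that by (intro oriented_plane_eq plane inverse_q) simp
    finally show ?thesis by (simp add: col_frame_def)
  qed
  ultimately show ?thesis
    using U(1) by (auto simp: first_order_frame_def symplectic_frame_def)
qed

section \<open>Existence of third order frames\<close>

lemma Omega_J4_right: "Omega x (J4 *v u) = - (x \<bullet> u)"
  by (simp add: Omega_expand matrix_vector_mult_def sum_4 J4_entries inner_vec_def)

lemma Omega_J4_both: "Omega (J4 *v x) (J4 *v y) = Omega x y"
  by (simp add: Omega_expand matrix_vector_mult_def sum_4 J4_entries)

lemma gram_ne_0:
  fixes y1 y2 :: "'a::real_inner"
  assumes "\<And>s t. s *\<^sub>R y1 + t *\<^sub>R y2 = 0 \<Longrightarrow> s = 0 \<and> t = 0"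
  shows "(y1 \<bullet> y1) * (y2 \<bullet> y2) - (y1 \<bullet> y2)\<^sup>2 \<noteq> 0"
proof
  assume 0: "(y1 \<bullet> y1) * (y2 \<bullet> y2) - (y1 \<bullet> y2)\<^sup>2 = 0"
  \<comment> \<open>Up to the factor \<open>y1 \<bullet> y1\<close> this is the component of
    \<open>y2\<close> orthogonal to \<open>y1\<close>; a vanishing Gram determinant would annihilate
    it.\<close>
  let ?w = "(- (y1 \<bullet> y2)) *\<^sub>R y1 + (y1 \<bullet> y1) *\<^sub>R y2"
  have "?w \<bullet> ?w = (y1 \<bullet> y1) * ((y1 \<bullet> y1) * (y2 \<bullet> y2) - (y1 \<bullet> y2)\<^sup>2)"
    by (simp add: inner_add_left inner_add_right inner_commute[of y2 y1] power2_eq_square algebra_simps)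
  then have "?w = 0"
    using 0 by simp
  then have "y1 = 0"
    using assms[of "- (y1 \<bullet> y2)" "y1 \<bullet> y1"] by simp
  then show False
    using assms[of 1 0] by simp
qed

text \<open>The vectors \<open>u3\<close>, \<open>u4\<close> are the basis of the plane dual to
  \<open>y1\<close>, \<open>y2\<close> for the Euclidean inner product. The map \<open>- J4\<close>
  turns inner products into \<Omega>-pairings and preserves \<Omega>, so their images complete the
  Lagrangian pair to a symplectic basis, smoothly in the point.\<close>

lemma sympl_completion:
  assumes V: "open V" and y: "smooth_on V y1" "smooth_on V y2"
    and lag: "\<And>z. z \<in> V \<Longrightarrow> Omega (y1 z) (y2 z) = 0"
    and ind: "\<And>z s t. z \<in> V \<Longrightarrow> s *\<^sub>R y1 z + t *\<^sub>R y2 z = 0 \<Longrightarrow> s = 0 \<and> t = 0"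
  shows "\<exists>y3 y4. planar_frame V y1 y2 y3 y4"
proof -
  define E F G where "E = (\<lambda>z. y1 z \<bullet> y1 z)" "F = (\<lambda>z. y1 z \<bullet> y2 z)" "G = (\<lambda>z. y2 z \<bullet> y2 z)"
  define D where "D = (\<lambda>z. E z * G z - F z * F z)"
  define u3 u4 where "u3 = (\<lambda>z. (G z / D z) *\<^sub>R y1 z - (F z / D z) *\<^sub>R y2 z)"
    "u4 = (\<lambda>z. (E z / D z) *\<^sub>R y2 z - (F z / D z) *\<^sub>R y1 z)"
  have D: "D z \<noteq> 0" if "z \<in> V" for z
    using gram_ne_0[OF ind[OF that]] by (simp add: D_def E_F_G_def power2_eq_square)
  have EFG: "smooth_on V E" "smooth_on V F" "smooth_on V G"
    unfolding E_F_G_def by (intro smooth_on_bilinear[OF V bounded_bilinear_inner] y)+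
  then have "smooth_on V D"
    unfolding D_def by (intro smooth_on_diff smooth_on_mult V)
  then have u: "smooth_on V u3" "smooth_on V u4"
    unfolding u3_u4_def by (intro smooth_on_diff smooth_on_scaleR smooth_on_divide EFG y V D; simp)+
  have "bounded_linear (\<lambda>x::real^4. - (J4 *v x))"
    by (intro bounded_linear_minus) simp
  from smooth_on_linear[OF V this u(1)] smooth_on_linear[OF V this u(2)]
  have "smooth_on V (\<lambda>z. - (J4 *v u3 z))" "smooth_on V (\<lambda>z. - (J4 *v u4 z))" .
  moreover have "sympl_basis (y1 z) (y2 z) (- (J4 *v u3 z)) (- (J4 *v u4 z))" if z: "z \<in> V" for z
  proof -
    have u': "Omega (y1 z) (- (J4 *v w)) = y1 z \<bullet> w" "Omega (y2 z) (- (J4 *v w)) = y2 z \<bullet> w" for w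
      by (simp_all add: Omega_bilinear_simps Omega_J4_right)
    have "y1 z \<bullet> u3 z = 1" "y1 z \<bullet> u4 z = 0" "y2 z \<bullet> u3 z = 0" "y2 z \<bullet> u4 z = 1"
    proof -
      have "y1 z \<bullet> u3 z = (E z * G z - F z * F z) / D z" "y1 z \<bullet> u4 z = (E z * F z - E z * F z) / D z"
        "y2 z \<bullet> u3 z = (G z * F z - G z * F z) / D z" "y2 z \<bullet> u4 z = (E z * G z - F z * F z) / D z"
        unfolding u3_u4_def by (simp_all add: E_F_G_def inner_diff_right inner_commute[of "y2 z" "y1 z"] diff_divide_distrib mult.commute)
      then show "y1 z \<bullet> u3 z = 1" "y1 z \<bullet> u4 z = 0" "y2 z \<bullet> u3 z = 0" "y2 z \<bullet> u4 z = 1"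
        using D[OF z] by (simp_all add: D_def)
    qed
    moreover have "Omega (- (J4 *v u3 z)) (- (J4 *v u4 z)) = 0"
      by (simp add: Omega_bilinear_simps Omega_J4_both u3_u4_def lag[OF z] Omega_commute[of "y2 z" "y1 z"])
    ultimately show ?thesis
      using lag[OF z] by (simp add: sympl_basis_def u')
  qed
  ultimately show ?thesis
    unfolding planar_frame_def using V y by blast
qed

lemma planar_frame_subset: "planar_frame V x1 x2 x3 x4 \<Longrightarrow> open W \<Longrightarrow> W \<subseteq> V \<Longrightarrow> planar_frame W x1 x2 x3 x4"
  unfolding planar_frame_def using smooth_on_subset by blast

lemma col_frame_gamma:
  assumes c: "is_chart c" and V: "open V" "V \<subseteq> snd c ` chart_dom c"
    and P: "planar_frame V x1 x2 x3 x4" and z: "z \<in> V"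
    and D: "(col_frame c x1 x2 x3 x4 \<circ> chart_inv c) differentiable (at z)"
  defines "q \<equiv> chart_inv c z" and "X \<equiv> col_frame c x1 x2 x3 x4"
  shows "gamma11 c X q v = Omega (x1 z) (ddir x1 v z)" "gamma21 c X q v = Omega (x2 z) (ddir x1 v z)"
    "gamma22 c X q v = Omega (x2 z) (ddir x2 v z)" "frame_omega c X q v = plane_om x1 x2 v z"
    "frame_eta c X q v = plane_et x1 x2 x3 x4 v z"
proof -
  have zi: "z \<in> snd c ` chart_dom c"
    using V z by blast
  have q: "snd c q = z" "chart_inv c (snd c q) = q"
    using snd_chart_inv[OF zi] by (simp_all add: q_def)
  have X: "X q \<in> Sp4"
    using planar_frame.basis[OF P z] by (simp add: X_def col_frame_def q Sp4_iff)
  have fc: "frame_col c X 1 z' = x1 z'" "frame_col c X 2 z' = x2 z'" "frame_col c X 3 z' = x3 z'"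
      "frame_col c X 4 z' = x4 z'" if "z' \<in> V" for z'
    using that V(2) unfolding X_def by (auto intro!: frame_col_col_frame)
  have dd: "ddir (frame_col c X 1) v z = ddir x1 v z" "ddir (frame_col c X 2) v z = ddir x2 v z"
    by (rule ddir_cong[OF V(1) z]; simp add: fc)+
  have D': "(X \<circ> chart_inv c) differentiable (at (snd c q))"
    using D by (simp add: X_def q)
  show "gamma11 c X q v = Omega (x1 z) (ddir x1 v z)" "gamma21 c X q v = Omega (x2 z) (ddir x1 v z)"
    "gamma22 c X q v = Omega (x2 z) (ddir x2 v z)"
    by (simp_all add: frame_theta_gamma[OF D' X q(2)] q fc[OF z] dd)
  show "frame_omega c X q v = plane_om x1 x2 v z" "frame_eta c X q v = plane_et x1 x2 x3 x4 v z"
    by (simp_all add: frame_forms_planar[OF D' X q(2)] q plane_om_def plane_et_def fc[OF z] dd)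
qed

text \<open>A starting frame made of coordinate derivatives. Direction i comes first because the
  Gauss map carries the orientation opposite to that of the surface.\<close>

lemma lagrangian_coordinates:
  assumes A: "oriented_surface A" and f: "lagrangian_immersion A f" and c: "c \<in> A"
  defines "V \<equiv> snd c ` chart_dom c" and "\<phi> \<equiv> f \<circ> chart_inv c"
  shows "open V" "smooth_on V \<phi>" "\<exists>x3 x4. planar_frame V (ddir \<phi> \<i>) (ddir \<phi> 1) x3 x4"
proof -
  have ch: "is_chart c"
    using A c by (auto simp: oriented_surface_def)
  show V: "open V"
    using ch by (simp add: V_def is_chart_def)
  show \<phi>: "smooth_on V \<phi>"
    using f c by (auto simp: lagrangian_immersion_def smooth_on_surface_def V_def \<phi>_def)
  have d: "ddir \<phi> v z = dif c f (chart_inv c z) v" "chart_inv c z \<in> chart_dom c" if "z \<in> V" for v z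
    using that snd_chart_inv[of z c] chart_inv_mem[of z c] by (simp_all add: V_def dif_ddir \<phi>_def)
  show "\<exists>x3 x4. planar_frame V (ddir \<phi> \<i>) (ddir \<phi> 1) x3 x4"
  proof (intro sympl_completion V smooth_on_ddir \<phi>)
    fix z assume z: "z \<in> V"
    show "Omega (ddir \<phi> \<i> z) (ddir \<phi> 1 z) = 0"
      using f c d[OF z] by (simp add: lagrangian_immersion_def)
    fix s t :: real assume "s *\<^sub>R ddir \<phi> \<i> z + t *\<^sub>R ddir \<phi> 1 z = 0"
    then have "ddir \<phi> (s *\<^sub>R \<i> + t *\<^sub>R 1) z = ddir \<phi> 0 z"
      by (simp only: ddir_dir[OF smooth_onD[OF \<phi> z]])
    then have "s *\<^sub>R \<i> + t *\<^sub>R 1 = 0"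
      using f c d[OF z] by (auto simp: lagrangian_immersion_def dest: injD)
    then show "s = 0 \<and> t = 0"
      by (simp add: complex_eq_iff)
  qed
qed

text \<open>Ellipticity is a condition on frame fields of the surface. Restricting the planar frame
  to a ball around the point makes it such a field, and positivity of g is read off in the same
  chart.\<close>

lemma elliptic_planar:
  assumes A: "oriented_surface A" and f: "elliptic A f" and c: "c \<in> A"
    and V: "open V" "V \<subseteq> snd c ` chart_dom c" and P: "planar_frame V x1 x2 x3 x4"
    and plane: "\<And>z. z \<in> V \<Longrightarrow> (ddir (f \<circ> chart_inv c) \<i> z, ddir (f \<circ> chart_inv c) 1 z) \<in> oriented_plane (x1 z) (x2 z)"
    and z: "z \<in> V" and v: "v \<noteq> 0"
  shows "(Omega (x2 z) (ddir x1 v z))\<^sup>2 - Omega (x1 z) (ddir x1 v z) * Omega (x2 z) (ddir x2 v z) > 0"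
proof -
  have ch: "is_chart c"
    using A c by (auto simp: oriented_surface_def)
  obtain e where e: "e > 0" "ball z e \<subseteq> V"
    using V(1) z openE by blast
  let ?B = "ball z e" and ?X = "col_frame c x1 x2 x3 x4"
  have P': "planar_frame ?B x1 x2 x3 x4"
    by (rule planar_frame_subset[OF P _ e(2)]) simp
  have sm: "smooth_on_surface A UNIV f"
    using f by (simp add: elliptic_def lagrangian_immersion_def)
  have B: "?B \<subseteq> snd c ` chart_dom c"
    using e(2) V(2) by blast
  have fo: "first_order_frame A f (chart_inv c ` ?B) ?X"
    using e(2) plane by (intro first_order_col_frame[OF A sm c _ _ B P']) auto
  let ?q = "chart_inv c z"
  have zc: "z \<in> snd c ` chart_dom c" "z \<in> ?B"
    using V(2) z e(1) by auto
  have q: "?q \<in> chart_inv c ` ?B" "?q \<in> chart_dom c" "snd c ?q = z"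
    using chart_inv_mem[OF zc(1)] snd_chart_inv[OF zc(1)] zc(2) by auto
  have D: "(?X \<circ> chart_inv c) differentiable (at z)"
    using fo symplectic_frame_point(1)[OF ch c _ q(1,2)] by (simp add: first_order_frame_def q(3))
  have "frame_g c ?X ?q v > 0"
    using f fo c q(1,2) v unfolding elliptic_def by blast
  then show ?thesis
    using col_frame_gamma[OF ch open_ball B P' zc(2) D] by (simp add: frame_g_def)
qed

text \<open>The coefficients of a positive definite combination of two symmetric forms orthogonal to both:
  the cross product of \<open>(a\<^sub>1, b\<^sub>1, c\<^sub>1)\<close> and \<open>(a\<^sub>2, b\<^sub>2, c\<^sub>2)\<close>.\<close>

lemma orthogonal_positive_form:
  fixes a1 a2 b1 b2 c1 c2 :: real
  assumes pos: "\<And>s t. s \<noteq> 0 \<or> t \<noteq> 0 \<Longrightarrow>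
      (s * b1 + t * b2)\<^sup>2 - (s * a1 + t * a2) * (s * c1 + t * c2) > 0"
  defines "p \<equiv> b1 * c2 - c1 * b2" and "q \<equiv> (c1 * a2 - a1 * c2) / 2" and "r \<equiv> a1 * b2 - b1 * a2"
  shows "p \<noteq> 0" "r / p - (q / p)\<^sup>2 > 0"
proof -
  show p: "p \<noteq> 0"
  proof
    assume "p = 0"
    then have 0: "b2 * c1 - b1 * c2 = 0" "c2 * b1 - c1 * b2 = 0"
      by (simp_all add: p_def algebra_simps)
    \<comment> \<open>If p = 0, the pairs (b1, b2) and (c1, c2) are proportional, so some nonzero
      (s, t) annihilates both and makes the supposedly positive form vanish.\<close>
    consider "b2 \<noteq> 0 \<or> - b1 \<noteq> 0" | "c2 \<noteq> 0 \<or> - c1 \<noteq> 0" | "b1 = 0" "b2 = 0" "c1 = 0" "c2 = 0"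
      by auto
    then show False
    proof cases
      case 1
      have e: "b2 * b1 + - b1 * b2 = 0" "b2 * c1 + - b1 * c2 = 0"
        using 0 by (simp_all add: algebra_simps)
      show False using pos[OF 1] unfolding e by simp
    next
      case 2
      have e: "c2 * b1 + - c1 * b2 = 0" "c2 * c1 + - c1 * c2 = 0"
        using 0 by (simp_all add: algebra_simps)
      show False using pos[OF 2] unfolding e by simp
    next
      case 3
      then show False using pos[of 1 0] by simp
    qed
  qed
  \<comment> \<open>Coefficients of the given positive form. Its value at (G, -F) is G (EG - F^2),
    which gives positive determinant, and this determinant equals pr - q^2.\<close>
  define E F G where "E = b1\<^sup>2 - a1 * c1" "F = b1 * b2 - (a1 * c2 + a2 * c1) / 2" "G = b2\<^sup>2 - a2 * c2"
  have form: "(s * b1 + t * b2)\<^sup>2 - (s * a1 + t * a2) * (s * c1 + t * c2) = E * s\<^sup>2 + 2 * F * s * t + G * t\<^sup>2" for s t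
    unfolding E_F_G_def by (simp add: power2_eq_square algebra_simps)
  have G: "G > 0"
    using pos[of 0 1] by (simp add: E_F_G_def)
  then have "G * (E * G - F\<^sup>2) > 0"
    using pos[of G "- F"] unfolding form by (simp add: power2_eq_square algebra_simps)
  then have "E * G - F\<^sup>2 > 0"
    using G by (simp add: zero_less_mult_iff)
  moreover have "E * G - F\<^sup>2 = p * r - q\<^sup>2"
    unfolding E_F_G_def p_def q_def r_def by (simp add: power2_eq_square field_simps)
  moreover have "r / p - (q / p)\<^sup>2 = (p * r - q\<^sup>2) / p\<^sup>2"
    using p by (simp add: power2_eq_square field_simps)
  ultimately show "r / p - (q / p)\<^sup>2 > 0"
    using p by simp
qed

section \<open>Normalisation of planar frames to second and third order\<close>

lemma ddir_scaleR:
  assumes "s differentiable (at z)" "y differentiable (at z)"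
  shows "ddir (\<lambda>z. s z *\<^sub>R y z) v z = s z *\<^sub>R ddir y v z + ddir s v z *\<^sub>R y z"
  by (intro ddir_eq bounded_bilinear.FDERIV[OF bounded_bilinear_scaleR] has_derivative_ddir assms)

lemma ddir_add:
  assumes "x differentiable (at z)" "y differentiable (at z)"
  shows "ddir (\<lambda>z. x z + y z) v z = ddir x v z + ddir y v z"
  by (intro ddir_eq has_derivative_add has_derivative_ddir assms)

context planar_frame
begin

lemma independent12:
  assumes "z \<in> V" "s *\<^sub>R x1 z + t *\<^sub>R x2 z = 0"
  shows "s = 0 \<and> t = 0"
proof -
  have "Omega (s *\<^sub>R x1 z + t *\<^sub>R x2 z) (x3 z) = s" "Omega (s *\<^sub>R x1 z + t *\<^sub>R x2 z) (x4 z) = t"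
    by (simp_all add: Omega_bilinear_simps sympl_basisD[OF basis[OF assms(1)]])
  then show ?thesis
    unfolding assms(2) by (simp add: Omega_bilinear_simps)
qed

text \<open>The coefficients (p, 2q, r) annihilate the triple (\<open>c11\<close>,
  \<open>c21\<close>, \<open>c22\<close>) in the directions 1 and i, hence in all directions. By
  ellipticity the quadratic form with coefficients p, q, r is definite, so it can be divided by p
  and written as the sum of squares of a new tangent basis.\<close>

lemma second_order_exists:
  assumes ell: "\<And>z v. z \<in> V \<Longrightarrow> v \<noteq> 0 \<Longrightarrow> (c21 v z)\<^sup>2 - c11 v z * c22 v z > 0"
  shows "\<exists>y1 y2 y3 y4. planar_frame V y1 y2 y3 y4 \<and> (\<forall>z\<in>V. (y1 z, y2 z) \<in> oriented_plane (x1 z) (x2 z)) \<and>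
    (\<forall>z\<in>V. \<forall>v. Omega (y1 z) (ddir y1 v z) + Omega (y2 z) (ddir y2 v z) = 0)"
proof -
  define p q r where "p = (\<lambda>z. c21 1 z * c22 \<i> z - c22 1 z * c21 \<i> z)"
    "q = (\<lambda>z. (c22 1 z * c11 \<i> z - c11 1 z * c22 \<i> z) / 2)"
    "r = (\<lambda>z. c11 1 z * c21 \<i> z - c21 1 z * c11 \<i> z)"
  define s where "s = (\<lambda>z. q z / p z)"
  define e where "e = (\<lambda>z. r z / p z - s z * s z)"
  define d where "d = (\<lambda>z. sqrt (e z))"
  have lin: "c11 v z = Re v * c11 1 z + Im v * c11 \<i> z" "c21 v z = Re v * c21 1 z + Im v * c21 \<i> z"
    "c22 v z = Re v * c22 1 z + Im v * c22 \<i> z" if "z \<in> V" for v z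
    unfolding linear_plane[OF linear_ddir[OF diff(1)[OF that]], of v]
      linear_plane[OF linear_ddir[OF diff(2)[OF that]], of v]
    by (simp_all add: Omega_bilinear_simps)
  have pe: "p z \<noteq> 0" "e z > 0" if z: "z \<in> V" for z
  proof -
    have "(s * c21 1 z + t * c21 \<i> z)\<^sup>2 - (s * c11 1 z + t * c11 \<i> z) * (s * c22 1 z + t * c22 \<i> z) > 0"
      if "s \<noteq> 0 \<or> t \<noteq> 0" for s t
      using ell[OF z, of "Complex s t"] lin[OF z, of "Complex s t"] that by (auto simp: complex_eq_iff)
    from orthogonal_positive_form[OF this] show "p z \<noteq> 0" "e z > 0"
      by (simp_all add: p_q_r_def e_def s_def power2_eq_square)
  qed
  have sc: "smooth_on V (\<lambda>z. c11 v z)" "smooth_on V (\<lambda>z. c21 v z)" "smooth_on V (\<lambda>z. c22 v z)" for v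
    by (intro smooth_on_bilinear[OF open_V bounded_bilinear_Omega] smooth smooth_on_ddir)+
  have pqr: "smooth_on V p" "smooth_on V q" "smooth_on V r"
    unfolding p_q_r_def
    by (intro smooth_on_diff smooth_on_mult smooth_on_divide sc open_V smooth_on_const; simp)+
  have s: "smooth_on V s"
    unfolding s_def by (intro smooth_on_divide pqr open_V pe)
  have "smooth_on V e"
    unfolding e_def by (intro smooth_on_diff smooth_on_mult smooth_on_divide pqr s open_V pe)
  then have d: "smooth_on V d"
    unfolding d_def by (intro smooth_on_sqrt open_V pe)
  \<comment> \<open>A triangular change of basis suffices: the trace of the new \<gamma> is
    \<open>c11 + 2 s c21 + (s^2 + d^2) c22\<close>, which matches (p, 2q, r) / p for s = q / p and
    s^2 + d^2 = r / p.\<close>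
  define y1 y2 where "y1 = (\<lambda>z. x1 z + s z *\<^sub>R x2 z)" "y2 = (\<lambda>z. d z *\<^sub>R x2 z)"
  have y: "smooth_on V y1" "smooth_on V y2"
    unfolding y1_y2_def by (intro smooth_on_add smooth_on_scaleR smooth s d open_V)+
  have d0: "d z > 0" "d z * d z = e z" if "z \<in> V" for z
    using pe(2)[OF that] by (simp_all add: d_def)
  have "\<exists>y3 y4. planar_frame V y1 y2 y3 y4"
  proof (rule sympl_completion[OF open_V y])
    fix z assume z: "z \<in> V"
    show "Omega (y1 z) (y2 z) = 0"
      by (simp add: y1_y2_def Omega_bilinear_simps sympl_basisD[OF basis[OF z]])
    fix a b assume "a *\<^sub>R y1 z + b *\<^sub>R y2 z = 0"
    then have "a *\<^sub>R x1 z + (a * s z + b * d z) *\<^sub>R x2 z = 0"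
      by (simp add: y1_y2_def algebra_simps)
    then show "a = 0 \<and> b = 0"
      using independent12[OF z, of a "a * s z + b * d z"] d0[OF z] by auto
  qed
  moreover have "(y1 z, y2 z) \<in> oriented_plane (x1 z) (x2 z)" if "z \<in> V" for z
    unfolding oriented_plane_iff
    using d0[OF that] by (intro exI[of _ 1] exI[of _ "s z"] exI[of _ 0] exI[of _ "d z"]) (simp add: y1_y2_def)
  moreover have "Omega (y1 z) (ddir y1 v z) + Omega (y2 z) (ddir y2 v z) = 0" if z: "z \<in> V" for z v
  proof -
    have sd: "s differentiable (at z)" "d differentiable (at z)"
      using s d z by (auto intro: smooth_onD)
    have "(\<lambda>z. s z *\<^sub>R x2 z) differentiable (at z)"
      by (rule smooth_onD[OF smooth_on_scaleR[OF open_V s smooth(2)] z])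
    then have dy: "ddir y1 v z = ddir x1 v z + (s z *\<^sub>R ddir x2 v z + ddir s v z *\<^sub>R x2 z)"
      "ddir y2 v z = d z *\<^sub>R ddir x2 v z + ddir d v z *\<^sub>R x2 z"
      unfolding y1_y2_def by (simp_all add: ddir_add ddir_scaleR diff[OF z] sd)
    have "Omega (y1 z) (ddir y1 v z) + Omega (y2 z) (ddir y2 v z)
        = c11 v z + 2 * s z * c21 v z + (s z * s z + d z * d z) * c22 v z"
      unfolding dy unfolding y1_y2_def
      by (simp add: Omega_bilinear_simps sympl_basisD[OF basis[OF z]] structure_symmetries[OF z] algebra_simps)
    also have "\<dots> = (p z * c11 v z + 2 * q z * c21 v z + r z * c22 v z) / p z"
      unfolding d0(2)[OF z] e_def s_def using pe(1)[OF z] by (simp add: field_simps)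
    also have "p z * c11 v z + 2 * q z * c21 v z + r z * c22 v z = 0"
      unfolding lin[OF z, of v] p_q_r_def by (simp add: field_simps)
    finally show ?thesis by simp
  qed
  ultimately show ?thesis by blast
qed

text \<open>Adding \<open>(2 * l z) *\<^sub>R x2 z\<close> to the last column keeps the basis
  symplectic and leaves \<omega> alone, while \<eta> loses l times the conjugate of \<omega>. It
  remains to choose l equal to the coefficient \<ell>.\<close>

lemma third_order_exists:
  assumes tr: "\<And>z v. z \<in> V \<Longrightarrow> c11 v z + c22 v z = 0" and inj: "\<And>z v. z \<in> V \<Longrightarrow> v \<noteq> 0 \<Longrightarrow> om v z \<noteq> 0"
  shows "\<exists>y4. planar_frame V x1 x2 x3 y4 \<and>
    (\<forall>z\<in>V. \<exists>h. \<forall>v. plane_et x1 x2 x3 y4 v z = h * om v z)"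
proof -
  \<comment> \<open>Imaginary parts of \<eta> \<and> \<omega> and of the wedge of the conjugate of
    \<omega> with \<omega>, both on the vectors 1 and i. Both values are purely imaginary and the
    first is \<ell> times the second, so \<ell> = N / D.\<close>
  define N D where "N = (\<lambda>z. Im (et 1 z * om \<i> z - et \<i> z * om 1 z))"
    "D = (\<lambda>z. 2 * Im (cnj (om 1 z) * om \<i> z))"
  have D: "D z \<noteq> 0" if z: "z \<in> V" for z
  proof
    assume "D z = 0"
    then have "Re (om 1 z) *\<^sub>R om \<i> z = Re (om \<i> z) *\<^sub>R om 1 z" "Im (om 1 z) *\<^sub>R om \<i> z = Im (om \<i> z) *\<^sub>R om 1 z"
      by (simp_all add: N_D_def complex_eq_iff algebra_simps)
    then have "om (Re (om 1 z) *\<^sub>R \<i> - Re (om \<i> z) *\<^sub>R 1) z = 0" "om (Im (om 1 z) *\<^sub>R \<i> - Im (om \<i> z) *\<^sub>R 1) z = 0"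
      using linear_diff[OF linear_om[OF z]] linear_scale[OF linear_om[OF z]] by simp_all
    then have "Re (om 1 z) *\<^sub>R \<i> - Re (om \<i> z) *\<^sub>R 1 = 0" "Im (om 1 z) *\<^sub>R \<i> - Im (om \<i> z) *\<^sub>R 1 = 0"
      using inj[OF z] by blast+
    then have "om 1 z = 0"
      by (simp add: complex_eq_iff)
    then show False
      using inj[OF z, of 1] by simp
  qed
  define l where "l = (\<lambda>z. N z / D z)"
  have so: "smooth_on V (\<lambda>z. om v z)" "smooth_on V (\<lambda>z. et v z)" for v
    unfolding plane_om_def plane_et_def
    by (intro smooth_on_Complex smooth_on_divide smooth_on_minus smooth_on_diff smooth_on_add
        smooth_on_bilinear[OF open_V bounded_bilinear_Omega] smooth smooth_on_ddir open_V smooth_on_const; simp)+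
  have "smooth_on V N" "smooth_on V D"
    unfolding N_D_def
    by (intro smooth_on_Re_Im(2) smooth_on_diff smooth_on_mult so open_V smooth_on_const
        smooth_on_linear[OF open_V bounded_linear_cnj])+
  then have l: "smooth_on V l"
    unfolding l_def by (intro smooth_on_divide open_V D)
  define y4 where "y4 = (\<lambda>z. x4 z + (2 * l z) *\<^sub>R x2 z)"
  have "smooth_on V y4"
    unfolding y4_def by (intro smooth_on_add smooth_on_scaleR smooth_on_mult smooth_on_const l smooth open_V)
  moreover have "sympl_basis (x1 z) (x2 z) (x3 z) (y4 z)" if "z \<in> V" for z
    using basis[OF that] by (simp add: sympl_basis_def y4_def Omega_bilinear_simps Omega_commute[of "x3 z" "x2 z"])
  ultimately have "planar_frame V x1 x2 x3 y4"
    using open_V smooth by (simp add: planar_frame_def)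
  moreover have "\<exists>h. \<forall>v. plane_et x1 x2 x3 y4 v z = h * om v z" if z: "z \<in> V" for z
  proof -
    have et': "plane_et x1 x2 x3 y4 v z = et v z - l z *\<^sub>R cnj (om v z)" for v
    proof -
      have "c22 v z = - c11 v z"
        using tr[OF z, of v] by simp
      then show ?thesis
        using Omega_commute[of "ddir x1 v z" "x2 z"] Omega_commute[of "ddir x2 v z" "x2 z"]
        by (simp add: plane_et_def plane_om_def y4_def complex_eq_iff Omega_bilinear_simps field_simps)
    qed
    let ?k = "et 1 z * om \<i> z - et \<i> z * om 1 z"
    have "Re ?k = 0"
      by (rule Re_wedge_om_et[OF tr z])
    moreover have "Im ?k = l z * D z"
      using D[OF z] by (simp add: l_def N_D_def)
    ultimately have k: "?k = l z *\<^sub>R (cnj (om 1 z) * om \<i> z - cnj (om \<i> z) * om 1 z)"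
      by (simp add: complex_eq_iff N_D_def algebra_simps)
    define h where "h = (et 1 z - l z *\<^sub>R cnj (om 1 z)) / om 1 z"
    have o1: "om 1 z \<noteq> 0"
      using inj[OF z, of 1] by simp
    have h1: "et 1 z - l z *\<^sub>R cnj (om 1 z) = h * om 1 z"
      using o1 by (simp add: h_def)
    have "(et \<i> z - l z *\<^sub>R cnj (om \<i> z)) * om 1 z = (et 1 z - l z *\<^sub>R cnj (om 1 z)) * om \<i> z"
      using k by (simp add: algebra_simps)
    then have hi: "et \<i> z - l z *\<^sub>R cnj (om \<i> z) = h * om \<i> z"
      using o1 unfolding h1 by simp
    have "plane_et x1 x2 x3 y4 v z = h * om v z" for v
    proof -
      have "et v z - l z *\<^sub>R cnj (om v z) =
          Re v *\<^sub>R (et 1 z - l z *\<^sub>R cnj (om 1 z)) + Im v *\<^sub>R (et \<i> z - l z *\<^sub>R cnj (om \<i> z))"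
        unfolding linear_plane[OF linear_om[OF z], of v] linear_plane[OF linear_et[OF z], of v]
        by (simp add: algebra_simps)
      also have "\<dots> = h * om v z"
        unfolding h1 hi linear_plane[OF linear_om[OF z], of v] by (simp add: algebra_simps)
      finally show ?thesis by (simp add: et')
    qed
    then show ?thesis by blast
  qed
  ultimately show ?thesis by blast
qed

end

lemma third_order_frame_exists:
  assumes A: "oriented_surface A" and f: "elliptic A f" and c: "c \<in> A" and q0: "q0 \<in> chart_dom c"
  obtains U X where "q0 \<in> U" "third_order_frame A f U X"
proof -
  define V \<phi> where "V = snd c ` chart_dom c" "\<phi> = f \<circ> chart_inv c"
  have lag: "lagrangian_immersion A f" "smooth_on_surface A UNIV f"
    using f by (simp_all add: elliptic_def lagrangian_immersion_def)
  have ch: "is_chart c"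
    using A c by (auto simp: oriented_surface_def)
  note L = lagrangian_coordinates[OF A lag(1) c, folded V_\<phi>_def]
  obtain y3 y4 where Y: "planar_frame V (ddir \<phi> \<i>) (ddir \<phi> 1) y3 y4"
    using L(3) by blast
  have "(Omega (ddir \<phi> 1 z) (ddir (ddir \<phi> \<i>) v z))\<^sup>2 -
      Omega (ddir \<phi> \<i> z) (ddir (ddir \<phi> \<i>) v z) * Omega (ddir \<phi> 1 z) (ddir (ddir \<phi> 1) v z) > 0"
    if "z \<in> V" "v \<noteq> 0" for z v
    by (rule elliptic_planar[OF A f c L(1) _ Y _ that]) (simp_all add: V_\<phi>_def oriented_plane_refl)
  from planar_frame.second_order_exists[OF Y this]
  obtain x1 x2 x3 x where X': "planar_frame V x1 x2 x3 x"
    "\<And>z. z \<in> V \<Longrightarrow> (x1 z, x2 z) \<in> oriented_plane (ddir \<phi> \<i> z) (ddir \<phi> 1 z)"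
    "\<And>z v. z \<in> V \<Longrightarrow> Omega (x1 z) (ddir x1 v z) + Omega (x2 z) (ddir x2 v z) = 0"
    by blast
  have pl: "(ddir \<phi> \<i> z, ddir \<phi> 1 z) \<in> oriented_plane (x1 z) (x2 z)" if "z \<in> V" for z
    by (rule oriented_plane_sym[OF X'(2)[OF that]])
  have om: "plane_om x1 x2 v z \<noteq> 0" if "z \<in> V" "v \<noteq> 0" for z v
  proof -
    \<comment> \<open>For trace-free \<gamma> this quantity is the squared modulus of \<omega>.
      Ellipticity is applied a second time, now to the renormalised frame.\<close>
    have "(Omega (x2 z) (ddir x1 v z))\<^sup>2 - Omega (x1 z) (ddir x1 v z) * Omega (x2 z) (ddir x2 v z) > 0"
      by (rule elliptic_planar[OF A f c L(1) _ X'(1) _ that]) (use pl in \<open>simp_all add: V_\<phi>_def\<close>)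
    moreover have "Omega (x2 z) (ddir x2 v z) = - Omega (x1 z) (ddir x1 v z)"
      using X'(3)[OF that(1), of v] by simp
    ultimately show ?thesis
      by (auto simp: plane_om_def complex_eq_iff)
  qed
  from planar_frame.third_order_exists[OF X'(1,3) om]
  obtain x4 where X: "planar_frame V x1 x2 x3 x4"
    "\<And>z. z \<in> V \<Longrightarrow> \<exists>h. \<forall>v. plane_et x1 x2 x3 x4 v z = h * plane_om x1 x2 v z"
    by blast
  have z0: "snd c q0 \<in> V"
    using q0 by (simp add: V_\<phi>_def)
  obtain e where e: "e > 0" "ball (snd c q0) e \<subseteq> V"
    using L(1) z0 openE by blast
  let ?B = "ball (snd c q0) e"
  let ?U = "chart_inv c ` ?B" and ?X = "col_frame c x1 x2 x3 x4"
  have P: "planar_frame ?B x1 x2 x3 x4"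
    by (rule planar_frame_subset[OF X(1) _ e(2)]) simp
  have B: "?B \<subseteq> snd c ` chart_dom c"
    using e(2) by (simp add: V_\<phi>_def)
  have fo: "first_order_frame A f ?U ?X"
    using e(2) pl by (intro first_order_col_frame[OF A lag(2) c _ _ B P]) (auto simp: V_\<phi>_def)
  \<comment> \<open>The conditions are known in the chart \<open>c\<close> only. In another chart
    \<theta> is the same form evaluated on the transformed tangent vector, so conditions required of
    all vectors carry over.\<close>
  have third: "gamma11 d ?X q v + gamma22 d ?X q v = 0" "\<exists>h. eta_coeffs d ?X q h 0"
    if d: "d \<in> A" "q \<in> ?U" "q \<in> chart_dom d" for d q v
  proof -
    have ch': "is_chart d" "oriented_transition d c"
      using A c d(1) by (auto simp: oriented_surface_def)
    obtain z where z: "z \<in> ?B" "q = chart_inv c z"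
      using d(2) by blast
    then have qc: "q \<in> chart_dom c" "snd c q = z" "z \<in> V"
      using B e(2) chart_inv_mem[of z c] snd_chart_inv[of z c] by auto
    have D: "(?X \<circ> chart_inv c) differentiable (at (snd c q))"
      using fo symplectic_frame_point(1)[OF ch c _ d(2) qc(1)] by (simp add: first_order_frame_def)
    note G = col_frame_gamma[OF ch open_ball B P z(1) D[unfolded qc(2)], folded z(2)]
    have "dif d ?X q v = dif c ?X q (dif d (snd c) q v)" for v
      using oriented_transitionD(1)[OF ch'(2) qc(1) d(3) ch ch'(1)]
      by (rule dif_change[OF ch ch'(1) qc(1) d(3) _ D])
    then have th: "frame_theta d ?X q v = frame_theta c ?X q (dif d (snd c) q v)" for v
      by (simp add: frame_theta_def)
    show "gamma11 d ?X q v + gamma22 d ?X q v = 0"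
      unfolding th G by (rule X'(3)[OF qc(3)])
    obtain h where h: "\<And>v. plane_et x1 x2 x3 x4 v z = h * plane_om x1 x2 v z"
      using X(2)[OF qc(3)] by blast
    have "frame_eta d ?X q v = h * frame_omega d ?X q v" for v
    proof -
      have "frame_eta d ?X q v = frame_eta c ?X q (dif d (snd c) q v)"
        "frame_omega d ?X q v = frame_omega c ?X q (dif d (snd c) q v)"
        by (simp_all add: frame_eta_def frame_omega_def th)
      then show ?thesis
        by (simp add: G h)
    qed
    then show "\<exists>h. eta_coeffs d ?X q h 0"
      by (auto simp: eta_coeffs_def)
  qed
  have "third_order_frame A f ?U ?X"
    using fo third by (auto simp: third_order_frame_def second_order_frame_def)
  moreover have "q0 \<in> ?U"
    using e(1) chart_inv_snd[OF ch q0] by (intro image_eqI[where x = "snd c q0"]) auto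
  ultimately show ?thesis
    using that by blast
qed

section \<open>The constant complex structure of a totally umbilic immersion\<close>

lemma chart_at:
  assumes "oriented_surface A"
  obtains c where "c \<in> A" "q \<in> chart_dom c"
proof -
  have "q \<in> \<Union> (chart_dom ` A)"
    using assms by (simp add: oriented_surface_def)
  then show ?thesis
    using that by blast
qed

lemma third_order_frame_at:
  assumes A: "oriented_surface A" and f: "elliptic A f"
  shows "\<exists>U X. q \<in> U \<and> third_order_frame A f U X"
proof -
  obtain c where c: "c \<in> A" "q \<in> chart_dom c"
    by (rule chart_at[OF A])
  show ?thesis
    by (rule third_order_frame_exists[OF A f c]) blast
qed

lemma (in planar_frame) om_surj:
  assumes "z \<in> V" and inj: "\<And>v. v \<noteq> 0 \<Longrightarrow> om v z \<noteq> 0"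
  obtains v where "om v z = k"
proof -
  have lin: "linear (\<lambda>v. om v z)"
    using assms(1) by (rule linear_om)
  have "inj (\<lambda>v. om v z)"
    unfolding linear_injective_0[OF lin] using inj by blast
  then have "surj (\<lambda>v. om v z)"
    by (rule linear_inj_imp_surj[OF lin])
  then show ?thesis
    using that by (metis surjD)
qed

lemma tangent_planar:
  assumes \<phi>: "\<phi> differentiable (at z)" and P: "sympl_basis x1 x2 x3 x4"
    and plane: "(ddir \<phi> \<i> z, ddir \<phi> 1 z) \<in> oriented_plane x1 x2"
  shows "Omega x1 (ddir \<phi> v z) = 0" "Omega x2 (ddir \<phi> v z) = 0"
    "ddir \<phi> v z = Omega (ddir \<phi> v z) x3 *\<^sub>R x1 + Omega (ddir \<phi> v z) x4 *\<^sub>R x2"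
proof -
  obtain a b c d where "ddir \<phi> \<i> z = a *\<^sub>R x1 + b *\<^sub>R x2" "ddir \<phi> 1 z = c *\<^sub>R x1 + d *\<^sub>R x2"
    using plane unfolding oriented_plane_iff by blast
  then show "Omega x1 (ddir \<phi> v z) = 0" "Omega x2 (ddir \<phi> v z) = 0"
    unfolding linear_plane[OF linear_ddir[OF \<phi>], of v]
    by (simp_all add: Omega_bilinear_simps sympl_basisD[OF P])
  then show "ddir \<phi> v z = Omega (ddir \<phi> v z) x3 *\<^sub>R x1 + Omega (ddir \<phi> v z) x4 *\<^sub>R x2"
    using sympl_basis_expand[OF P, of "ddir \<phi> v z"] by simp
qed

lemma first_order_frame_planar:
  assumes c: "is_chart c" "c \<in> A" and f: "smooth_on_surface A UNIV f" and X: "first_order_frame A f U X"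
  defines "V \<equiv> snd c ` (chart_dom c \<inter> U)" and "\<phi> \<equiv> f \<circ> chart_inv c"
  shows "planar_frame V (frame_col c X 1) (frame_col c X 2) (frame_col c X 3) (frame_col c X 4)"
    "smooth_on V \<phi>"
    "\<And>z. z \<in> V \<Longrightarrow> (ddir \<phi> \<i> z, ddir \<phi> 1 z) \<in> oriented_plane (frame_col c X 1 z) (frame_col c X 2 z)"
proof -
  have sf: "symplectic_frame A U X"
    using X by (simp add: first_order_frame_def)
  show "planar_frame V (frame_col c X 1) (frame_col c X 2) (frame_col c X 3) (frame_col c X 4)"
    unfolding V_def by (rule planar_frame_cols[OF c sf])
  show "smooth_on V \<phi>"
    unfolding V_def \<phi>_def by (rule smooth_on_subset[of "snd c ` (chart_dom c \<inter> UNIV)"])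
      (use f c(2) in \<open>auto simp: smooth_on_surface_def\<close>)
  fix z assume z: "z \<in> V"
  let ?q = "chart_inv c z"
  have q: "?q \<in> chart_dom c \<inter> U" "snd c ?q = z"
    using chart_inv_image[OF c(1), of z U] z snd_chart_inv[of z c] by (auto simp: V_def)
  then have "gauss_map c f ?q = oriented_plane (column 1 (X ?q)) (column 2 (X ?q))"
    using X c(2) by (auto simp: first_order_frame_def)
  then show "(ddir \<phi> \<i> z, ddir \<phi> 1 z) \<in> oriented_plane (frame_col c X 1 z) (frame_col c X 2 z)"
    using oriented_plane_refl[of "ddir \<phi> \<i> z" "ddir \<phi> 1 z"]
    by (simp add: gauss_map_def dif_ddir q frame_col_def \<phi>_def)
qed

text \<open>The Hopf differential has the factor |t|, nonzero because f is an immersion and \<tau> =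
  t \<omega>, and the factor \<omega>, nonzero on nonzero vectors because g is the squared modulus
  of \<omega> here. Its vanishing is therefore that of \<eta>.\<close>

lemma umbilic_planar:
  assumes A: "oriented_surface A" and f: "totally_umbilic A f" and c: "c \<in> A" and X: "third_order_frame A f U X"
  defines "V \<equiv> snd c ` (chart_dom c \<inter> U)"
    and "x1 \<equiv> frame_col c X 1" and "x2 \<equiv> frame_col c X 2" and "x3 \<equiv> frame_col c X 3" and "x4 \<equiv> frame_col c X 4"
  shows "planar_frame V x1 x2 x3 x4"
    "\<And>z v. z \<in> V \<Longrightarrow> Omega (x1 z) (ddir x1 v z) + Omega (x2 z) (ddir x2 v z) = 0"
    "\<And>z v. z \<in> V \<Longrightarrow> plane_et x1 x2 x3 x4 v z = 0"
    "\<And>z v. z \<in> V \<Longrightarrow> v \<noteq> 0 \<Longrightarrow> plane_om x1 x2 v z \<noteq> 0"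
proof -
  define \<phi> where "\<phi> = f \<circ> chart_inv c"
  have ch: "is_chart c"
    using A c by (auto simp: oriented_surface_def)
  have ell: "elliptic A f" and lag: "lagrangian_immersion A f" "smooth_on_surface A UNIV f"
    using f by (simp_all add: totally_umbilic_def elliptic_def lagrangian_immersion_def)
  have so: "second_order_frame A f U X" and fo: "first_order_frame A f U X" and sf: "symplectic_frame A U X"
    using X by (simp_all add: third_order_frame_def second_order_frame_def first_order_frame_def)
  note FP = first_order_frame_planar[OF ch c lag(2) fo, folded V_def x1_def x2_def x3_def x4_def \<phi>_def]
  show P: "planar_frame V x1 x2 x3 x4"
    by (rule FP(1))
  interpret P: planar_frame V x1 x2 x3 x4 by (rule P)
  have point: "chart_inv c z \<in> U \<inter> chart_dom c" "snd c (chart_inv c z) = z" if "z \<in> V" for z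
    using that chart_inv_image[OF ch, of z U] snd_chart_inv[of z c] by (auto simp: V_def)
  have forms: "gamma11 c X q v = P.c11 v z" "gamma22 c X q v = P.c22 v z" "gamma21 c X q v = P.c21 v z"
    "frame_omega c X q v = P.om v z" "frame_eta c X q v = P.et v z"
    if z: "z \<in> V" and q: "q = chart_inv c z" for z q v
  proof -
    have q': "q \<in> U" "q \<in> chart_dom c" "snd c q = z"
      using point[OF z] by (simp_all add: q)
    note S = symplectic_frame_point[OF ch c sf q'(1,2)]
    show "gamma11 c X q v = P.c11 v z" "gamma22 c X q v = P.c22 v z" "gamma21 c X q v = P.c21 v z"
      unfolding frame_theta_gamma[OF S(1-3)] by (simp_all add: q'(3) x1_def x2_def)
    show "frame_omega c X q v = P.om v z" "frame_eta c X q v = P.et v z"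
      unfolding frame_forms_planar[OF S(1-3)] by (simp_all add: q'(3) x1_def x2_def x3_def x4_def)
  qed
  show tr: "P.c11 v z + P.c22 v z = 0" if z: "z \<in> V" for z v
    using so c point[OF z] unfolding second_order_frame_def by (metis forms(1,2)[OF z refl])
  show om: "P.om v z \<noteq> 0" if z: "z \<in> V" and v: "v \<noteq> 0" for z v
  proof -
    have "frame_g c X (chart_inv c z) v > 0"
      using ell fo c point[OF z] v unfolding elliptic_def by blast
    moreover have "P.c22 v z = - P.c11 v z"
      using tr[OF z, of v] by simp
    ultimately show ?thesis
      by (auto simp: frame_g_def forms[OF z refl] plane_om_def complex_eq_iff)
  qed
  fix z v assume z: "z \<in> V"
  define q where "q = chart_inv c z"
  have q: "q \<in> U" "q \<in> chart_dom c" "snd c q = z"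
    using point[OF z] by (simp_all add: q_def)
  note S = symplectic_frame_point[OF ch c sf q(1,2)]
  note tan = tangent_planar[OF smooth_onD[OF FP(2)] P.basis FP(3)]
  define ta where "ta v = Complex (Omega (ddir \<phi> v z) (x3 z)) (- Omega (ddir \<phi> v z) (x4 z))" for v
  have tau: "frame_tau_cx c f X q v = ta v" for v
    unfolding frame_tau_cx_def frame_tau_def Sp4_inv_mult[OF S(2)] ta_def
    by (simp add: dif_ddir q(3) \<phi>_def x3_def x4_def frame_col_def q_def[symmetric])
  have "ta v * P.om w z = ta w * P.om v z" for v w
    unfolding ta_def by (rule P.wedge_tau_om[OF tr z FP(2) tan(1,2)])
  then have t: "ta v = (ta 1 / P.om 1 z) * P.om v z" for v
    using om[OF z, of 1] by (simp add: field_simps)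
  \<comment> \<open>\<open>frame_t\<close> is a definite description: existence of t comes from
    \<tau> \<and> \<omega> = 0 and uniqueness from \<omega> being nonzero on the vector 1.\<close>
  have "frame_t c f X q = ta 1 / P.om 1 z"
    unfolding frame_t_def tau forms(4)[OF z q_def]
  proof (rule the_equality)
    show "\<forall>v. ta v = ta 1 / P.om 1 z * P.om v z"
      using t by blast
    show "t = ta 1 / P.om 1 z" if "\<forall>v. ta v = t * P.om v z" for t
      using that om[OF z, of 1] by (simp add: field_simps)
  qed
  moreover have "ta 1 \<noteq> 0"
  proof
    assume "ta 1 = 0"
    then have "ddir \<phi> 1 z = 0"
      using tan(3)[OF z z z, of 1] by (simp add: ta_def complex_eq_iff)
    then have "dif c f q 1 = dif c f q 0"
      using ddir_dir(3)[OF smooth_onD[OF FP(2) z]] by (simp add: dif_ddir q(3) \<phi>_def)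
    moreover have "inj (dif c f q)"
      using lag(1) c q(2) by (auto simp: lagrangian_immersion_def)
    ultimately show False
      by (metis injD zero_neq_one)
  qed
  ultimately have "cmod (frame_t c f X q) powr (2 / 3) \<noteq> 0"
    using om[OF z, of 1] by simp
  moreover have "hopf c f X q v = 0"
    using f X c q by (auto simp: totally_umbilic_def)
  ultimately have "P.et v z * P.om v z = 0"
    by (simp add: hopf_def forms[OF z q_def])
  then show "P.et v z = 0"
    using om[OF z, of v] linear_0[OF P.linear_et[OF z]] by (cases "v = 0") auto
qed

section \<open>The complex structure K and its independence of the frame\<close>

definition frame_K :: "('a \<Rightarrow> real^4^4) \<Rightarrow> 'a \<Rightarrow> real^4 \<Rightarrow> real^4" where
  "frame_K X q w = Omega w (column 4 (X q)) *\<^sub>R column 1 (X q) - Omega w (column 3 (X q)) *\<^sub>R column 2 (X q)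
     + Omega w (column 2 (X q)) *\<^sub>R column 3 (X q) - Omega w (column 1 (X q)) *\<^sub>R column 4 (X q)"

lemma plane_K_frame:
  "plane_K (frame_col c X 1) (frame_col c X 2) (frame_col c X 3) (frame_col c X 4) z = frame_K X (chart_inv c z)"
  by (simp add: plane_K_def[abs_def] frame_K_def[abs_def] frame_col_def)

lemma umbilic_K_ball:
  assumes A: "oriented_surface A" and f: "totally_umbilic A f" and c: "c \<in> A" and X: "third_order_frame A f U X"
    and B: "ball z0 e \<subseteq> snd c ` (chart_dom c \<inter> U)" and z: "z \<in> ball z0 e"
  shows "frame_K X (chart_inv c z) = frame_K X (chart_inv c z0)"
proof
  fix w
  note U = umbilic_planar[OF A f c X]
  have "\<exists>k. \<forall>z\<in>ball z0 e. frame_K X (chart_inv c z) w = k"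
  proof (rule has_derivative_zero_constant)
    fix y assume "y \<in> ball z0 e"
    then have y: "y \<in> snd c ` (chart_dom c \<inter> U)"
      using B by blast
    show "((\<lambda>z. frame_K X (chart_inv c z) w) has_derivative (\<lambda>h. 0)) (at y within ball z0 e)"
      using planar_frame.Kx_deriv_zero[OF U(1) U(2,3) U(4)[OF y] y, of w]
      unfolding plane_K_frame by (rule has_derivative_at_withinI)
  qed simp
  moreover have "z0 \<in> ball z0 e"
    using z by (metis centre_in_ball dist_not_less_zero dist_commute mem_ball order_le_less_trans zero_le_dist)
  ultimately show "frame_K X (chart_inv c z) w = frame_K X (chart_inv c z0) w"
    using z by metis
qed

text \<open>By Lagrange's identity the determinant equals the common squared length of the two
  orthogonal columns, so the matrix is a similarity. It serves for the change between second order
  frames and for transitions between conformal charts.\<close>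

lemma conformal_basis_change:
  fixes a b c d :: real
  assumes "a\<^sup>2 + c\<^sup>2 = b\<^sup>2 + d\<^sup>2" "a * b + c * d = 0" "a * d - b * c > 0"
  shows "d = a" "c = - b"
proof -
  have "(a * d - b * c)\<^sup>2 = (a\<^sup>2 + c\<^sup>2) * (b\<^sup>2 + d\<^sup>2) - (a * b + c * d)\<^sup>2"
    by algebra
  then have "(a * d - b * c)\<^sup>2 = (a\<^sup>2 + c\<^sup>2)\<^sup>2"
    using assms(1,2) by (simp add: power2_eq_square)
  then have "a * d - b * c = a\<^sup>2 + c\<^sup>2"
    using assms(3) by (simp add: power2_eq_iff_nonneg)
  moreover have "(a - d)\<^sup>2 + (b + c)\<^sup>2 = (a\<^sup>2 + c\<^sup>2) + (b\<^sup>2 + d\<^sup>2) - 2 * (a * d - b * c)"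
    by (simp add: power2_eq_square algebra_simps)
  ultimately have "(a - d)\<^sup>2 + (b + c)\<^sup>2 = 0"
    using assms(1) by simp
  then show "d = a" "c = - b"
    by (simp_all add: sum_power2_eq_zero_iff)
qed

text \<open>In the new basis the trace of \<gamma> is a combination of \<open>c11\<close> and
  \<open>c21\<close>. These are the real and imaginary parts of \<omega>, which is onto, so both
  coefficients vanish and the change of basis is conformal. On the plane this fixes K.\<close>

lemma second_order_change:
  assumes P: "planar_frame V x1 x2 x3 x4" and P': "planar_frame V y1 y2 y3 y4"
    and tr: "\<And>z v. z \<in> V \<Longrightarrow> Omega (x1 z) (ddir x1 v z) + Omega (x2 z) (ddir x2 v z) = 0"
      "\<And>z v. z \<in> V \<Longrightarrow> Omega (y1 z) (ddir y1 v z) + Omega (y2 z) (ddir y2 v z) = 0"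
    and inj: "\<And>z v. z \<in> V \<Longrightarrow> v \<noteq> 0 \<Longrightarrow> plane_om x1 x2 v z \<noteq> 0"
    and pl: "\<And>z. z \<in> V \<Longrightarrow> (y1 z, y2 z) \<in> oriented_plane (x1 z) (x2 z)"
    and z: "z \<in> V"
  obtains a b where "y1 z = a *\<^sub>R x1 z + b *\<^sub>R x2 z" "y2 z = (- b) *\<^sub>R x1 z + a *\<^sub>R x2 z"
proof -
  interpret P: planar_frame V x1 x2 x3 x4 by (rule P)
  interpret P': planar_frame V y1 y2 y3 y4 by (rule P')
  have lag: "Omega (x1 z) (y1 z) = 0" "Omega (x2 z) (y1 z) = 0" "Omega (x1 z) (y2 z) = 0" "Omega (x2 z) (y2 z) = 0"
    if z: "z \<in> V" for z
    using pl[OF z] unfolding oriented_plane_iff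
    by (auto simp: Omega_bilinear_simps sympl_basisD[OF P.basis[OF z]])
  \<comment> \<open>Old and new tangent columns span the same Lagrangian plane, so their pairings
    vanish identically and the derivative can be moved from one factor to the other. The
    coefficients a, b, c, d are thus never differentiated.\<close>
  have swap: "Omega (x z) (ddir y v z) = Omega (y z) (ddir x v z)"
    if "x differentiable (at z)" "y differentiable (at z)" "\<And>z. z \<in> V \<Longrightarrow> Omega (x z) (y z) = 0" for x y v
    using ddir_zero_on[OF P.open_V z, of "\<lambda>z. Omega (x z) (y z)" 0 v] that(3) ddir_Omega[OF that(1,2), of v]
      Omega_commute[of "ddir x v z" "y z"] by simp
  note sw = swap[OF P.diff(1)[OF z] P'.diff(1)[OF z] lag(1)] swap[OF P.diff(2)[OF z] P'.diff(1)[OF z] lag(2)]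
    swap[OF P.diff(1)[OF z] P'.diff(2)[OF z] lag(3)] swap[OF P.diff(2)[OF z] P'.diff(2)[OF z] lag(4)]
  obtain a b c d where y: "y1 z = a *\<^sub>R x1 z + b *\<^sub>R x2 z" "y2 z = c *\<^sub>R x1 z + d *\<^sub>R x2 z" "a * d - b * c > 0"
    using pl[OF z] unfolding oriented_plane_iff by blast
  have rel: "(a\<^sup>2 + c\<^sup>2 - b\<^sup>2 - d\<^sup>2) * P.c11 v z + 2 * (a * b + c * d) * P.c21 v z = 0" for v
  proof -
    have "P.c22 v z = - P.c11 v z"
      using tr(1)[OF z, of v] by simp
    moreover have "Omega (y1 z) (ddir y1 v z) = a * Omega (y1 z) (ddir x1 v z) + b * Omega (y1 z) (ddir x2 v z)"
      by (subst y(1)) (simp add: Omega_bilinear_simps sw)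
    moreover have "Omega (y2 z) (ddir y2 v z) = c * Omega (y2 z) (ddir x1 v z) + d * Omega (y2 z) (ddir x2 v z)"
      by (subst y(2)) (simp add: Omega_bilinear_simps sw)
    ultimately show ?thesis
      using tr(2)[OF z, of v] unfolding y(1,2)
      by (simp add: Omega_bilinear_simps P.structure_symmetries(1)[OF z] power2_eq_square algebra_simps)
  qed
  have c11: "P.c11 v z = Re (P.om v z)" "P.c21 v z = Im (P.om v z)" for v
    using tr(1)[OF z, of v] by (simp_all add: plane_om_def)
  obtain v1 v2 where "P.om v1 z = 1" "P.om v2 z = \<i>"
    using P.om_surj[OF z inj[OF z]] by metis
  then have "a\<^sup>2 + c\<^sup>2 - b\<^sup>2 - d\<^sup>2 = 0" "a * b + c * d = 0"
    using rel[of v1] rel[of v2] by (simp_all add: c11)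
  then have "d = a" "c = - b"
    using conformal_basis_change[of a c b d] y(3) by simp_all
  then show ?thesis
    using that y by simp
qed

lemma umbilic_K_unique:
  assumes A: "oriented_surface A" and f: "totally_umbilic A f"
    and X: "third_order_frame A f U X" "q \<in> U" and Y: "third_order_frame A f U' Y" "q \<in> U'"
  shows "frame_K X q = frame_K Y q"
proof -
  obtain c where c: "c \<in> A" "q \<in> chart_dom c"
    by (rule chart_at[OF A])
  have ch: "is_chart c"
    using A c by (auto simp: oriented_surface_def)
  have lag: "smooth_on_surface A UNIV f"
    using f by (simp add: totally_umbilic_def elliptic_def lagrangian_immersion_def)
  have fo: "first_order_frame A f U X" "first_order_frame A f U' Y"
    using X Y by (simp_all add: third_order_frame_def second_order_frame_def)
  define z0 where "z0 = snd c q"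
  have "open U" "open U'"
    using fo by (simp_all add: first_order_frame_def symplectic_frame_def)
  then have "open (snd c ` (chart_dom c \<inter> (U \<inter> U')))"
    by (intro open_chart_image ch open_Int)
  moreover have "z0 \<in> snd c ` (chart_dom c \<inter> (U \<inter> U'))"
    using c X(2) Y(2) by (auto simp: z0_def)
  ultimately obtain e where e: "e > 0" "ball z0 e \<subseteq> snd c ` (chart_dom c \<inter> (U \<inter> U'))"
    using openE by blast
  define B where "B = ball z0 e"
  have BU: "B \<subseteq> snd c ` (chart_dom c \<inter> U)" "B \<subseteq> snd c ` (chart_dom c \<inter> U')" and z0: "z0 \<in> B"
    using e by (auto simp: B_def)
  define x1 x2 x3 x4 where x: "x1 = frame_col c X 1" "x2 = frame_col c X 2" "x3 = frame_col c X 3" "x4 = frame_col c X 4"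
  define y1 y2 y3 y4 where y: "y1 = frame_col c Y 1" "y2 = frame_col c Y 2" "y3 = frame_col c Y 3" "y4 = frame_col c Y 4"
  note UX = umbilic_planar[OF A f c(1) X(1), folded x]
  note UY = umbilic_planar[OF A f c(1) Y(1), folded y]
  have P: "planar_frame B x1 x2 x3 x4" "planar_frame B y1 y2 y3 y4"
    using planar_frame_subset[OF UX(1) _ BU(1)] planar_frame_subset[OF UY(1) _ BU(2)] by (simp_all add: B_def)
  interpret P: planar_frame B x1 x2 x3 x4 by (rule P(1))
  interpret P': planar_frame B y1 y2 y3 y4 by (rule P(2))
  \<comment> \<open>On the ball both structures are constant, hence so is their difference. A fixed
    linear map that kills the tangent columns at every point also kills the derivatives of these
    columns.\<close>
  define N where "N w = P.Kx z0 w - P'.Kx z0 w" for w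
  have linN: "linear N"
    unfolding N_def by (intro linear_compose_sub P.linear_Kx P'.linear_Kx)
  have K: "P.Kx z = P.Kx z0" "P'.Kx z = P'.Kx z0" if "z \<in> B" for z
    using umbilic_K_ball[OF A f c(1) X(1), of z0 e z] umbilic_K_ball[OF A f c(1) Y(1), of z0 e z] BU that
    unfolding B_def x y plane_K_frame by blast+
  have N12: "N (y1 z) = 0" "N (y2 z) = 0" if z: "z \<in> B" for z
  proof -
    note FX = first_order_frame_planar(3)[OF ch c(1) lag fo(1), folded x]
      first_order_frame_planar(3)[OF ch c(1) lag fo(2), folded y]
    have pl: "(y1 z, y2 z) \<in> oriented_plane (x1 z) (x2 z)" if "z \<in> B" for z
      by (rule oriented_plane_trans[OF oriented_plane_sym[OF FX(2)[OF subsetD[OF BU(2) that]]]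
            FX(1)[OF subsetD[OF BU(1) that]]])
    obtain a b where ab: "y1 z = a *\<^sub>R x1 z + b *\<^sub>R x2 z" "y2 z = (- b) *\<^sub>R x1 z + a *\<^sub>R x2 z"
    proof (rule second_order_change[OF P _ _ _ pl z])
      show "P.c11 v z + P.c22 v z = 0" "P'.c11 v z + P'.c22 v z = 0" if "z \<in> B" for z v
        by (rule UX(2)[OF subsetD[OF BU(1) that]], rule UY(2)[OF subsetD[OF BU(2) that]])
      show "P.om v z \<noteq> 0" if "z \<in> B" "v \<noteq> 0" for z v
        by (rule UX(4)[OF subsetD[OF BU(1) that(1)] that(2)])
    qed
    have KX: "P.Kx z (s *\<^sub>R x1 z + t *\<^sub>R x2 z) = s *\<^sub>R (- x2 z) + t *\<^sub>R x1 z" for s t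
      by (simp only: linear_add[OF P.linear_Kx] linear_scale[OF P.linear_Kx] P.Kx_basis[OF z])
    have "P.Kx z (y1 z) = - y2 z" "P.Kx z (y2 z) = y1 z"
      unfolding ab KX by simp_all
    then show "N (y1 z) = 0" "N (y2 z) = 0"
      using P'.Kx_basis[OF z] by (simp_all add: N_def K[OF z, symmetric])
  qed
  have Nd: "N (ddir y1 v z0) = 0" for v
    using ddir_linear[OF _ P'.diff(1)[OF z0], of N v] linN ddir_zero_on[OF P.open_V z0, of "\<lambda>z. N (y1 z)" 0 v] N12(1)
    by (simp add: linear_conv_bounded_linear)
  have "N (y3 z0) = 0" "N (y4 z0) = 0"
  proof -
    \<comment> \<open>Modulo the tangent columns the derivative of \<open>y1\<close> is
      \<open>c11\<close> times \<open>y3\<close> plus \<open>c21\<close> times \<open>y4\<close>,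
      and surjectivity of \<omega> makes the coefficients arbitrary.\<close>
    have c: "P'.c11 v z0 *\<^sub>R N (y3 z0) + P'.c21 v z0 *\<^sub>R N (y4 z0) = 0" for v
      using Nd[of v] arg_cong[OF P'.structure_equations(1)[OF z0, of v], of N]
      by (simp add: linear_add[OF linN] linear_scale[OF linN] N12[OF z0])
    have z0': "z0 \<in> snd c ` (chart_dom c \<inter> U')"
      using BU z0 by blast
    have c11: "P'.c11 v z0 = Re (P'.om v z0)" "P'.c21 v z0 = Im (P'.om v z0)" for v
      using UY(2)[OF z0', of v] by (simp_all add: plane_om_def)
    obtain v1 v2 where "P'.om v1 z0 = 1" "P'.om v2 z0 = \<i>"
      using P'.om_surj[OF z0 UY(4)[OF z0']] by metis
    then show "N (y3 z0) = 0" "N (y4 z0) = 0"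
      using c[of v1] c[of v2] by (simp_all add: c11)
  qed
  then have "N w = 0" for w
    by (subst sympl_basis_expand[OF P'.basis[OF z0], of w])
      (simp add: linear_add[OF linN] linear_scale[OF linN] N12[OF z0])
  then have "P.Kx z0 = P'.Kx z0"
    by (simp add: N_def fun_eq_iff)
  then show ?thesis
    unfolding x y plane_K_frame by (simp add: z0_def chart_inv_snd[OF ch c(2)])
qed

lemma umbilic_K_constant:
  assumes A: "oriented_surface A" and f: "totally_umbilic A f" and M: "connected (UNIV :: 'a set)"
  obtains K where "\<And>U X q. third_order_frame A f U X \<Longrightarrow> q \<in> U \<Longrightarrow> frame_K X (q :: 'a::t2_space) = K"
proof -
  have "elliptic A f"
    using f by (simp add: totally_umbilic_def)
  then have "\<exists>U X. q \<in> U \<and> third_order_frame A f U X" for q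
    by (rule third_order_frame_at[OF A])
  then obtain UU XX where fr: "\<And>q. q \<in> UU q" "\<And>q. third_order_frame A f (UU q) (XX q)"
    by metis
  \<comment> \<open>A frame is chosen separately at each point. By uniqueness the frame chosen at q
    computes \<kappa> at all nearby points too, which reduces local constancy to a single
    frame.\<close>
  define \<kappa> where "\<kappa> q = frame_K (XX q) q" for q
  have \<kappa>: "frame_K X q = \<kappa> q" if "third_order_frame A f U X" "q \<in> U" for U X q
    unfolding \<kappa>_def by (rule umbilic_K_unique[OF A f that fr(2,1)])
  have loc: "eventually (\<lambda>y. \<kappa> q = \<kappa> y) (at q)" for q
  proof -
    obtain c where c: "c \<in> A" "q \<in> chart_dom c"
      by (rule chart_at[OF A])
    have ch: "is_chart c"
      using A c by (auto simp: oriented_surface_def)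
    let ?V = "snd c ` (chart_dom c \<inter> UU q)"
    have "open (UU q)"
      using fr(2) by (simp add: third_order_frame_def second_order_frame_def first_order_frame_def symplectic_frame_def)
    then have "open ?V"
      by (rule open_chart_image[OF ch])
    moreover have "snd c q \<in> ?V"
      using c fr(1) by auto
    ultimately obtain e where e: "e > 0" "ball (snd c q) e \<subseteq> ?V"
      using openE by blast
    let ?W = "chart_inv c ` ball (snd c q) e"
    have sub: "ball (snd c q) e \<subseteq> snd c ` chart_dom c"
      using e(2) by blast
    have W: "open ?W"
      by (rule open_chart_preimage[OF ch open_ball sub])
    have qW: "q \<in> ?W"
      using e(1) chart_inv_snd[OF ch c(2)] by (intro image_eqI[where x = "snd c q"]) auto
    have "\<kappa> q = \<kappa> y" if y: "y \<in> ?W" for y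
    proof -
      obtain z where z: "z \<in> ball (snd c q) e" "y = chart_inv c z"
        using y by blast
      have "y \<in> UU q"
        using chart_inv_image[OF ch, of z "UU q"] z e(2) by blast
      then have "\<kappa> y = frame_K (XX q) (chart_inv c z)"
        using \<kappa>[OF fr(2)] z(2) by metis
      also have "\<dots> = frame_K (XX q) (chart_inv c (snd c q))"
        by (rule umbilic_K_ball[OF A f c(1) fr(2) e(2) z(1)])
      finally show ?thesis
        by (simp add: \<kappa>_def chart_inv_snd[OF ch c(2)])
    qed
    then show ?thesis
      using W qW unfolding eventually_at_topological by blast
  qed
  have "\<kappa> p = \<kappa> q" for p q
    using connected_local_const[OF M, of p q \<kappa>] loc by simp
  then show ?thesis
    using that \<kappa> by metis
qed

section \<open>Transfer of K to multiplication by i in C^2\<close>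

lemma Sp4_matrix_inv:
  assumes "X \<in> Sp4"
  shows "matrix_inv X \<in> Sp4"
proof -
  let ?Y = "matrix_inv X"
  have X: "transpose X ** J4 ** X = J4"
    using assms by (simp add: Sp4_def)
  have t: "transpose ?Y ** transpose X = mat 1"
    by (simp add: matrix_transpose_mul[symmetric] Sp4_inv[OF assms])
  have "transpose ?Y ** J4 ** ?Y = transpose ?Y ** (transpose X ** J4 ** X) ** ?Y"
    by (simp add: X)
  also have "\<dots> = (transpose ?Y ** transpose X) ** J4 ** (X ** ?Y)"
    by (simp add: matrix_mul_assoc)
  also have "\<dots> = J4"
    by (simp add: t Sp4_inv[OF assms])
  finally show ?thesis
    using Sp4_inv[OF assms] by (auto simp: Sp4_def invertible_def)
qed

lemma to_C2_components: "to_C2 x $ 1 = Complex (x $ 1) (- x $ 2)" "to_C2 x $ 2 = Complex (x $ 3) (x $ 4)"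
  by (simp_all add: to_C2_def)

lemma bounded_linear_to_C2: "bounded_linear to_C2"
  unfolding linear_conv_bounded_linear[symmetric]
  by (auto intro!: linearI simp: vec_eq_iff forall_2 to_C2_components complex_eq_iff)

lemma to_C2_eq_0: "to_C2 x = 0 \<longleftrightarrow> x = 0"
  by (auto simp: vec_eq_iff forall_2 forall_4 to_C2_components complex_eq_iff)

lemma Omega_wedge2: "Omega x y = Re (wedge2 (to_C2 x) (to_C2 y))"
  by (simp add: Omega_expand wedge2_def to_C2_components)

text \<open>This is what fixes the signs in \<open>frame_K\<close>: in frame coordinates the map is
  the standard complex structure of the identification with C^2.\<close>

lemma to_C2_frame_K:
  assumes "X q \<in> Sp4"
  shows "to_C2 (matrix_inv (X q) *v frame_K X q w) = \<i> *s to_C2 (matrix_inv (X q) *v w)"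
proof -
  note sb = sympl_basisD[OF assms[unfolded Sp4_iff]]
  show ?thesis
    unfolding vec_eq_iff forall_2 to_C2_components vector_smult_component Sp4_inv_mult[OF assms]
    using Omega_commute[of w "column 1 (X q)"] Omega_commute[of w "column 2 (X q)"]
    by (simp add: complex_eq_iff frame_K_def Omega_bilinear_simps sb)
qed

lemma umbilic_complex_tangents:
  assumes A: "oriented_surface A" and f: "totally_umbilic A f" and M: "connected (UNIV :: 'a::t2_space set)"
  obtains Y where "Y \<in> Sp4"
    "\<And>c q. c \<in> A \<Longrightarrow> (q :: 'a) \<in> chart_dom c \<Longrightarrow> \<exists>u T. u \<noteq> 0 \<and> linear T \<and> plane_det T > 0 \<and>
       (\<forall>v. to_C2 (Y *v dif c f q v) = T v *s u)"
proof -
  obtain K where K: "\<And>U X q. third_order_frame A f U X \<Longrightarrow> q \<in> U \<Longrightarrow> frame_K X (q::'a) = K"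
    using umbilic_K_constant[OF A f M] by blast
  have ell: "elliptic A f" and lag: "smooth_on_surface A UNIV f"
    using f by (simp_all add: totally_umbilic_def elliptic_def lagrangian_immersion_def)
  have spX: "X q \<in> Sp4" if "third_order_frame A f U X" "q \<in> U" for U X q
    using that by (simp add: third_order_frame_def second_order_frame_def first_order_frame_def symplectic_frame_def)
  have ex: "\<exists>U X. q \<in> U \<and> third_order_frame A f U X" for q :: 'a
    by (rule third_order_frame_at[OF A ell])
  fix q0 :: 'a
  obtain U0 X0 where X0: "q0 \<in> U0" "third_order_frame A f U0 X0"
    using ex by blast
  define Y where "Y = matrix_inv (X0 q0)"
  have Y: "Y \<in> Sp4"
    unfolding Y_def by (rule Sp4_matrix_inv[OF spX[OF X0(2,1)]])
  have YK: "to_C2 (Y *v K w) = \<i> *s to_C2 (Y *v w)" for w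
    using to_C2_frame_K[of X0 q0, OF spX[OF X0(2,1)]] by (simp add: K[OF X0(2,1)] Y_def)
  have "\<exists>u T. u \<noteq> 0 \<and> linear T \<and> plane_det T > 0 \<and> (\<forall>v. to_C2 (Y *v dif c f q v) = T v *s u)"
    if c: "c \<in> A" and q: "q \<in> chart_dom c" for c and q :: 'a
  proof -
    have ch: "is_chart c"
      using A c by (auto simp: oriented_surface_def)
    obtain U X where X: "q \<in> U" "third_order_frame A f U X"
      using ex by blast
    have fo: "first_order_frame A f U X"
      using X(2) by (simp_all add: third_order_frame_def second_order_frame_def)
    note F = first_order_frame_planar[OF ch c lag fo]
    have z: "snd c q \<in> snd c ` (chart_dom c \<inter> U)"
      using q X(1) by blast
    define x where "x j = column j (X q)" for j
    have fc: "frame_col c X j (snd c q) = x j" for j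
      by (simp add: frame_col_def chart_inv_snd[OF ch q] x_def)
    have sb: "sympl_basis (x 1) (x 2) (x 3) (x 4)"
      using spX[OF X(2,1)] by (simp add: x_def Sp4_iff)
    have Df: "(f \<circ> chart_inv c) differentiable (at (snd c q))"
      by (rule smooth_onD[OF F(2) z])
    have pl: "(dif c f q \<i>, dif c f q 1) \<in> oriented_plane (x 1) (x 2)"
      using F(3)[OF z] by (simp add: dif_ddir fc)
    have tan: "dif c f q v = Omega (dif c f q v) (x 3) *\<^sub>R x 1 + Omega (dif c f q v) (x 4) *\<^sub>R x 2" for v
      using tangent_planar(3)[OF Df sb] pl by (simp add: dif_ddir)
    \<comment> \<open>The complex form \<tau>. The vector \<open>x 2\<close> equals minus K of
      \<open>x 1\<close>, so it goes to -i times u, and the real combination of two columns becomes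
      the complex multiple T v of u.\<close>
    define T where "T v = Complex (Omega (dif c f q v) (x 3)) (- Omega (dif c f q v) (x 4))" for v
    define u where "u = to_C2 (Y *v x 1)"
    have "x 1 \<noteq> 0"
      using sympl_basisD(2)[OF sb] by (auto simp: Omega_bilinear_simps)
    then have "Y *v x 1 \<noteq> 0"
      using Sp4_inv(2)[OF Y] by (metis matrix_vector_mul_assoc matrix_vector_mul_lid matrix_vector_mult_0_right)
    then have "u \<noteq> 0"
      by (simp add: u_def to_C2_eq_0)
    moreover have "linear T"
      unfolding T_def dif_ddir
      by (auto intro!: linearI simp: ddir_dir[OF Df] Omega_bilinear_simps complex_eq_iff)
    moreover have "plane_det T > 0"
    proof -
      obtain a b c' d where "dif c f q \<i> = a *\<^sub>R x 1 + b *\<^sub>R x 2" "dif c f q 1 = c' *\<^sub>R x 1 + d *\<^sub>R x 2" "a * d - b * c' > 0"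
        using pl unfolding oriented_plane_iff by blast
      then show ?thesis
        by (simp add: plane_det_def T_def Omega_bilinear_simps sympl_basisD[OF sb] mult.commute)
    qed
    moreover have "to_C2 (Y *v dif c f q v) = T v *s u" for v
    proof -
      have "K (x 1) = - x 2"
        unfolding K[OF X(2,1), symmetric] frame_K_def x_def[symmetric] by (simp add: sympl_basisD[OF sb])
      then have "x 2 = - K (x 1)"
        by simp
      then have "to_C2 (Y *v x 2) = - to_C2 (Y *v K (x 1))"
        by (simp only: linear_neg[OF bounded_linear.linear[OF bounded_linear_to_C2]]
            linear_neg[OF matrix_vector_mul_linear[of Y]])
      then have "to_C2 (Y *v x 2) = (- \<i>) *s u"
        unfolding YK by (simp add: u_def vec_eq_iff)
      then have *: "to_C2 (Y *v (s *\<^sub>R x 1 + t *\<^sub>R x 2)) = s *\<^sub>R u + t *\<^sub>R ((- \<i>) *s u)" for s t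
        using linear_add[OF bounded_linear.linear[OF bounded_linear_to_C2]]
          linear_scale[OF bounded_linear.linear[OF bounded_linear_to_C2]]
        by (simp add: matrix_vector_right_distrib matrix_vector_mult_scaleR u_def)
      show ?thesis
        by (subst tan, subst *) (simp add: T_def vec_eq_iff complex_eq_iff)
    qed
    ultimately show ?thesis by blast
  qed
  with Y show ?thesis
    using that by blast
qed

section \<open>Frames along complex curves\<close>

lemma Omega_Sp4:
  assumes "Y \<in> Sp4"
  shows "Omega (Y *v x) (Y *v y) = Omega x y"
  unfolding matrix_vector_mult_columns[of Y] Omega_sympl_basis[OF assms[unfolded Sp4_iff]]
  by (simp add: Omega_expand)

lemma wedge2_simps:
  "wedge2 (a *s x) y = a * wedge2 x y" "wedge2 x (a *s y) = a * wedge2 x y" "wedge2 x x = 0"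
  "wedge2 (x + x') y = wedge2 x y + wedge2 x' y"
  by (simp_all add: wedge2_def algebra_simps)

text \<open>The vector \<open>L (x y)\<close> stays on the complex line of \<open>\<xi> y\<close>.
  Differentiating the vanishing wedge product gives the wedge of \<xi> with the derivative of
  \<open>L x\<close>, without differentiating the complex factor between them.\<close>

lemma Omega_ddir_complex_curve:
  fixes L :: "real^4 \<Rightarrow> complex^2" and \<xi> :: "complex \<Rightarrow> complex^2"
  assumes V: "open V" "z \<in> V" and L: "bounded_linear L" "\<And>x y. Omega x y = Re (wedge2 (L x) (L y))"
    and \<xi>: "\<And>k. ((\<lambda>z. \<xi> z $ k) has_field_derivative \<xi>' $ k) (at z)"
    and x: "x differentiable (at z)" "\<And>y. y \<in> V \<Longrightarrow> wedge2 (L (x y)) (\<xi> y) = 0"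
    and a: "L w = a *s \<xi> z" "L (x z) = b *s \<xi> z"
  shows "Omega w (ddir x v z) = Re (a * b * v * wedge2 (\<xi> z) \<xi>')"
proof -
  have Lk: "((\<lambda>z. L (x z) $ k) has_derivative (\<lambda>v. L (ddir x v z) $ k)) (at z)" for k
    by (intro bounded_linear.has_derivative[OF bounded_linear_vec_nth]
        bounded_linear.has_derivative[OF L(1)] has_derivative_ddir x)
  have xk: "((\<lambda>z. \<xi> z $ k) has_derivative (\<lambda>v. \<xi>' $ k * v)) (at z)" for k
    using \<xi>[of k] by (simp add: has_field_derivative_def)
  have "((\<lambda>z. wedge2 (L (x z)) (\<xi> z)) has_derivative
      (\<lambda>v. (L (x z) $ 1 * (\<xi>' $ 2 * v) + L (ddir x v z) $ 1 * \<xi> z $ 2)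
         - (L (x z) $ 2 * (\<xi>' $ 1 * v) + L (ddir x v z) $ 2 * \<xi> z $ 1))) (at z)"
    unfolding wedge2_def by (intro has_derivative_diff has_derivative_mult Lk xk)
  note D = ddir_eq[OF this, of v]
  have "ddir (\<lambda>z. wedge2 (L (x z)) (\<xi> z)) v z = 0"
    by (rule ddir_zero_on[OF V x(2)])
  with D have "(L (x z) $ 1 * (\<xi>' $ 2 * v) + L (ddir x v z) $ 1 * \<xi> z $ 2)
         - (L (x z) $ 2 * (\<xi>' $ 1 * v) + L (ddir x v z) $ 2 * \<xi> z $ 1) = 0"
    by (simp only:)
  then have "wedge2 (\<xi> z) (L (ddir x v z)) = b * v * wedge2 (\<xi> z) \<xi>'"
    by (simp add: a(2) wedge2_def algebra_simps)
  then show ?thesis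
    by (simp add: L(2) a(1) wedge2_simps mult.assoc)
qed

lemma dif_affine_to_C2:
  assumes "(f \<circ> chart_inv d) differentiable (at (snd d q))"
  shows "dif d (to_C2 \<circ> affine_act D \<circ> f) q v = to_C2 (snd D *v dif d f q v)"
    "(to_C2 \<circ> affine_act D \<circ> f \<circ> chart_inv d) differentiable (at (snd d q))"
proof -
  have "((\<lambda>z. fst D + snd D *v (f \<circ> chart_inv d) z) has_derivative
      (\<lambda>v. 0 + snd D *v ddir (f \<circ> chart_inv d) v (snd d q))) (at (snd d q))"
    by (intro has_derivative_add has_derivative_const has_derivative_ddir assms
        bounded_linear.has_derivative[OF matrix_vector_mul_bounded_linear])
  from bounded_linear.has_derivative[OF bounded_linear_to_C2 this]
  have *: "((to_C2 \<circ> affine_act D \<circ> f \<circ> chart_inv d) has_derivative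
      (\<lambda>v. to_C2 (snd D *v ddir (f \<circ> chart_inv d) v (snd d q)))) (at (snd d q))"
    by (simp add: affine_act_def o_def)
  then show "dif d (to_C2 \<circ> affine_act D \<circ> f) q v = to_C2 (snd D *v dif d f q v)"
    by (simp add: dif_ddir ddir_eq)
  show "(to_C2 \<circ> affine_act D \<circ> f \<circ> chart_inv d) differentiable (at (snd d q))"
    using * by (auto simp: differentiable_def)
qed

lemma dif_holomorphic:
  assumes F: "(F \<circ> chart_inv d) differentiable (at (snd d q))" and d: "is_chart d" "q \<in> chart_dom d"
    and hol: "\<And>k. (\<lambda>z. F (chart_inv d z) $ k) holomorphic_on snd d ` chart_dom d"
  shows "dif d F q v = v *s curve_z d F q"
proof -
  have op: "open (snd d ` chart_dom d)" and z: "snd d q \<in> snd d ` chart_dom d"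
    using d by (auto simp: is_chart_def)
  have "dif d F q v $ k = deriv (\<lambda>z. F (chart_inv d z) $ k) (snd d q) * v" for k
  proof -
    have "ddir (\<lambda>z. (F \<circ> chart_inv d) z $ k) v (snd d q) = dif d F q v $ k"
      unfolding dif_ddir by (rule ddir_linear[OF bounded_linear_vec_nth F])
    moreover have "ddir (\<lambda>z. F (chart_inv d z) $ k) v (snd d q) = deriv (\<lambda>z. F (chart_inv d z) $ k) (snd d q) * v"
      using holomorphic_derivI[OF hol op z] by (intro ddir_eq) (simp add: has_field_derivative_def)
    ultimately show ?thesis by simp
  qed
  then show ?thesis
    by (simp add: vec_eq_iff curve_z_def mult.commute)
qed

text \<open>Stated for one chart and an affine symplectic D, so that it serves both directions: with
  the identity for a given complex curve, and with the transformation of the converse in charts of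
  the induced structure.\<close>

lemma complex_curve_frame:
  assumes d: "is_chart d" and Y: "snd D \<in> Sp4" and F: "F = to_C2 \<circ> affine_act D \<circ> f"
    and hol: "\<And>k. (\<lambda>z. F (chart_inv d z) $ k) holomorphic_on snd d ` chart_dom d"
    and U: "open U" and f: "\<And>p. p \<in> chart_dom d \<Longrightarrow> (f \<circ> chart_inv d) differentiable (at (snd d p))"
    and X: "\<And>p. p \<in> U \<inter> chart_dom d \<Longrightarrow> (X \<circ> chart_inv d) differentiable (at (snd d p))"
      "\<And>p. p \<in> U \<Longrightarrow> X p \<in> Sp4"
    and gauss: "\<And>p. p \<in> U \<inter> chart_dom d \<Longrightarrow> gauss_map d f p = oriented_plane (column 1 (X p)) (column 2 (X p))"
    and q: "q \<in> U" "q \<in> chart_dom d"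
  defines "W \<equiv> wedge2 (curve_z d F q) (curve_zz d F q)"
  shows "\<exists>a1 a2. Im (cnj a1 * a2) < 0 \<and>
    to_C2 (snd D *v column 1 (X q)) = a1 *s curve_z d F q \<and> to_C2 (snd D *v column 2 (X q)) = a2 *s curve_z d F q \<and>
    (\<forall>v. gamma11 d X q v = Re (a1 * a1 * v * W) \<and> gamma21 d X q v = Re (a1 * a2 * v * W) \<and>
      gamma22 d X q v = Re (a2 * a2 * v * W))"
proof -
  define L where "L x = to_C2 (snd D *v x)" for x
  define \<xi> where "\<xi> z = curve_z d F (chart_inv d z)" for z
  have L: "bounded_linear L"
    unfolding L_def by (intro bounded_linear_compose[OF bounded_linear_to_C2] matrix_vector_mul_bounded_linear)
  have OL: "Omega x y = Re (wedge2 (L x) (L y))" for x y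
    unfolding L_def Omega_wedge2[symmetric] by (simp add: Omega_Sp4[OF Y])
  have dF: "L (dif d f p v) = v *s curve_z d F p" if "p \<in> chart_dom d" for p v
  proof -
    have "(F \<circ> chart_inv d) differentiable (at (snd d p))"
      unfolding F by (rule dif_affine_to_C2(2)[OF f[OF that]])
    then have "dif d F p v = v *s curve_z d F p"
      by (rule dif_holomorphic[OF _ d that hol])
    moreover have "dif d F p v = L (dif d f p v)"
      unfolding F L_def by (rule dif_affine_to_C2(1)[OF f[OF that]])
    ultimately show ?thesis by simp
  qed
  have cols: "\<exists>a1 a2. L (column 1 (X p)) = a1 *s curve_z d F p \<and> L (column 2 (X p)) = a2 *s curve_z d F p
      \<and> Im (cnj a1 * a2) < 0" if p: "p \<in> U" "p \<in> chart_dom d" for p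
  proof -
    have "(dif d f p \<i>, dif d f p 1) \<in> oriented_plane (column 1 (X p)) (column 2 (X p))"
      using gauss[of p] p oriented_plane_refl by (auto simp: gauss_map_def)
    from oriented_plane_sym[OF this] obtain a b c e
      where e: "column 1 (X p) = a *\<^sub>R dif d f p \<i> + b *\<^sub>R dif d f p 1"
        "column 2 (X p) = c *\<^sub>R dif d f p \<i> + e *\<^sub>R dif d f p 1" "a * e - b * c > 0"
      unfolding oriented_plane_iff by blast
    \<comment> \<open>The directions i and 1 go to i times \<open>curve_z\<close> and to
      \<open>curve_z\<close>, so a real combination with coefficients s, t is the complex multiple t
      + i s. The reversed order of the basis makes the imaginary part of \<open>cnj a1 * a2\<close>
      negative.\<close>
    have "L (s *\<^sub>R dif d f p \<i> + t *\<^sub>R dif d f p 1) = Complex t s *s curve_z d F p" for s t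
      unfolding linear_add[OF bounded_linear.linear[OF L]] linear_scale[OF bounded_linear.linear[OF L]] dF[OF p(2)]
      by (simp add: vec_eq_iff complex_eq_iff)
    then show ?thesis
      unfolding e(1,2) using e(3)
      by (intro exI[of _ "Complex b a"] exI[of _ "Complex e c"]) (simp add: mult.commute)
  qed
  obtain a1 a2 where a: "L (column 1 (X q)) = a1 *s curve_z d F q" "L (column 2 (X q)) = a2 *s curve_z d F q"
    "Im (cnj a1 * a2) < 0"
    using cols[OF q] by blast
  define z where "z = snd d q"
  let ?V = "snd d ` (chart_dom d \<inter> U)"
  have V: "open ?V" "z \<in> ?V"
    using open_chart_image[OF d U] q by (auto simp: z_def)
  have zq: "chart_inv d z = q"
    by (simp add: z_def chart_inv_snd[OF d q(2)])
  have op: "open (snd d ` chart_dom d)" "z \<in> snd d ` chart_dom d"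
    using d q by (auto simp: is_chart_def z_def)
  have \<xi>k: "\<xi> y $ k = deriv (\<lambda>z. F (chart_inv d z) $ k) y" if "y \<in> snd d ` chart_dom d" for y k
    by (simp add: \<xi>_def curve_z_def snd_chart_inv[OF that])
  have \<xi>': "((\<lambda>z. \<xi> z $ k) has_field_derivative curve_zz d F q $ k) (at z)" for k
  proof -
    have "(deriv (\<lambda>z. F (chart_inv d z) $ k) has_field_derivative curve_zz d F q $ k) (at z)"
      using holomorphic_derivI[OF holomorphic_deriv[OF hol op(1)] op] by (simp add: curve_zz_def z_def)
    then show ?thesis
      by (rule has_field_derivative_transform_within_open[OF _ op]) (simp add: \<xi>k)
  qed
  have wz: "wedge2 (L (frame_col d X j y)) (\<xi> y) = 0" if y: "y \<in> ?V" and j: "j = 1 \<or> j = 2" for y j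
  proof -
    have "chart_inv d y \<in> chart_dom d \<inter> U"
      by (rule chart_inv_image[OF d y])
    then show ?thesis
      using cols[of "chart_inv d y"] j by (auto simp: frame_col_def \<xi>_def wedge2_simps)
  qed
  have D: "(X \<circ> chart_inv d) differentiable (at z)"
    using X(1) q by (simp add: z_def)
  have fc: "frame_col d X j z = column j (X q)" for j
    by (simp add: frame_col_def zq)
  have \<xi>z: "\<xi> z = curve_z d F q"
    by (simp add: \<xi>_def zq)
  have "Omega w (ddir (frame_col d X j) v z) = Re (s * t * v * W)"
    if "L w = s *s curve_z d F q" "L (column j (X q)) = t *s curve_z d F q" "j = 1 \<or> j = 2" for w s t j v
    unfolding W_def \<xi>z[symmetric]
    by (rule Omega_ddir_complex_curve[OF V L OL \<xi>' differentiable_frame_col[OF D] wz])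
      (use that in \<open>simp_all add: fc \<xi>z\<close>)
  note O = this
  show ?thesis
  proof (intro exI conjI allI)
    show "Im (cnj a1 * a2) < 0"
      by (rule a(3))
    show "to_C2 (snd D *v column 1 (X q)) = a1 *s curve_z d F q" "to_C2 (snd D *v column 2 (X q)) = a2 *s curve_z d F q"
      using a by (simp_all add: L_def)
    note FT = frame_theta_gamma[OF D[unfolded z_def] X(2)[OF q(1)] zq[unfolded z_def], folded z_def]
    show "gamma11 d X q v = Re (a1 * a1 * v * W)" for v
      unfolding FT fc by (rule O[OF a(1,1)]) simp
    show "gamma21 d X q v = Re (a1 * a2 * v * W)" for v
      unfolding FT fc using O[OF a(2,1), of v] by (simp add: mult.commute)
    show "gamma22 d X q v = Re (a2 * a2 * v * W)" for v
      unfolding FT fc by (rule O[OF a(2,2)]) simp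
  qed
qed

text \<open>Absorbing a square root of P into a1 and a2 reduces this to the case P = 1, an
  elementary identity for the parallelogram spanned by two complex numbers.\<close>

lemma frame_g_complex:
  fixes a1 a2 P :: complex
  shows "- Re (a1 * a1 * P) * Re (a2 * a2 * P) + (Re (a1 * a2 * P))\<^sup>2 = (cmod P)\<^sup>2 * (Im (cnj a1 * a2))\<^sup>2"
  unfolding cmod_power2 by (simp add: power2_eq_square) algebra

section \<open>Real coordinates on C^2 and multiplication by i\<close>

definition of_C2 :: "complex^2 \<Rightarrow> real^4" where
  "of_C2 w = (\<chi> i. if i = 1 then Re (w $ 1) else if i = 2 then - Im (w $ 1)
     else if i = 3 then Re (w $ 2) else Im (w $ 2))"

lemma of_C2_components: "of_C2 w $ 1 = Re (w $ 1)" "of_C2 w $ 2 = - Im (w $ 1)"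
  "of_C2 w $ 3 = Re (w $ 2)" "of_C2 w $ 4 = Im (w $ 2)"
  by (simp_all add: of_C2_def)

lemma of_C2_to_C2: "of_C2 (to_C2 x) = x" and to_C2_of_C2: "to_C2 (of_C2 w) = w"
  by (simp_all add: vec_eq_iff forall_2 forall_4 of_C2_components to_C2_components complex_eq_iff)

lemma bounded_linear_of_C2: "bounded_linear of_C2"
  unfolding linear_conv_bounded_linear[symmetric]
  by (auto intro!: linearI simp: vec_eq_iff forall_4 of_C2_components)

lemma complex_curve_smooth:
  assumes ch: "\<And>c. c \<in> A \<Longrightarrow> is_chart c" and F: "complex_curve A (to_C2 \<circ> f)"
  shows "smooth_on_surface A UNIV f"
  unfolding smooth_on_surface_def
proof
  fix c assume c: "c \<in> A"
  let ?V = "snd c ` chart_dom c"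
  have V: "open ?V"
    using ch[OF c] by (simp add: is_chart_def)
  have "smooth_on ?V (\<lambda>z. \<chi> k. to_C2 (f (chart_inv c z)) $ k)"
    using F c by (intro smooth_on_vec_lambda V smooth_on_holomorphic) (auto simp: complex_curve_def)
  from smooth_on_linear[OF V bounded_linear_of_C2 this]
  show "smooth_on (snd c ` (chart_dom c \<inter> UNIV)) (f \<circ> chart_inv c)"
    by (simp add: of_C2_to_C2 o_def)
qed

definition mult_i :: "real^4 \<Rightarrow> real^4" where
  "mult_i x = of_C2 (\<i> *s to_C2 x)"

lemma bounded_linear_mult_i: "bounded_linear mult_i"
  unfolding linear_conv_bounded_linear[symmetric]
  by (auto intro!: linearI simp: mult_i_def vec_eq_iff forall_4 of_C2_components to_C2_components)

lemma mult_i_mult_i: "mult_i (mult_i x) = - x"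
  by (simp add: mult_i_def vec_eq_iff forall_4 of_C2_components to_C2_components)

text \<open>Multiplication by i is self-adjoint, rather than symplectic, because \<Omega> is the
  real part of a complex bilinear form.\<close>

lemma Omega_mult_i: "Omega (mult_i x) y = Omega x (mult_i y)"
  by (simp add: Omega_expand mult_i_def of_C2_components to_C2_components)

text \<open>The multiple \<open>m\<close> of the conjugate of \<open>\<omega>\<close> is all that is left of \<open>\<eta>\<close> for a second order frame
  along a complex curve, so that third order frames have \<open>\<eta> = 0\<close>.\<close>

lemma (in planar_frame) et_complex_curve:
  assumes x2: "\<And>z. z \<in> V \<Longrightarrow> x2 z = - mult_i (x1 z)" and z: "z \<in> V"
    and tr: "\<And>v. c11 v z + c22 v z = 0"
  obtains m where "\<And>v. et v z = of_real m * cnj (om v z)"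
proof -
  note neg = linear_neg[OF bounded_linear.linear[OF bounded_linear_mult_i]]
  \<comment> \<open>The only coordinate of i times \<open>x3\<close> that stays free: the others are
    forced by moving i across \<Omega> and by the relation between \<open>x1\<close> and
    \<open>x2\<close>.\<close>
  define m where "m = Omega (mult_i (x3 z)) (x4 z)"
  have ix2: "mult_i (x2 z) = x1 z"
    by (simp add: x2[OF z] neg mult_i_mult_i)
  have "Omega (x1 z) (mult_i (x3 z)) = 0" "Omega (x2 z) (mult_i (x3 z)) = 1"
    using x2[OF z] sympl_basisD[OF basis[OF z]] ix2
    by (simp_all add: Omega_mult_i[symmetric] flip: Omega_bilinear_simps(5)) (metis Omega_bilinear_simps(5) minus_zero add.inverse_inverse)
  moreover have "Omega (mult_i (x3 z)) (x3 z) = 0"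
    using Omega_mult_i[of "x3 z" "x3 z"] Omega_commute[of "x3 z" "mult_i (x3 z)"] by simp
  ultimately have ix3: "mult_i (x3 z) = m *\<^sub>R x2 z + x4 z"
    using sympl_basis_expand[OF basis[OF z], of "mult_i (x3 z)"] by (simp add: m_def)
  have ix4: "mult_i (x4 z) = - x3 z - m *\<^sub>R x1 z"
  proof -
    have "mult_i (mult_i (x3 z)) = m *\<^sub>R x1 z + mult_i (x4 z)"
      unfolding ix3 by (simp add: linear_add linear_scale bounded_linear.linear[OF bounded_linear_mult_i] ix2)
    then show ?thesis
      by (simp add: mult_i_mult_i algebra_simps)
  qed
  have dx2: "ddir x2 v z = - mult_i (ddir x1 v z)" for v
  proof -
    have "ddir x2 v z = ddir (\<lambda>z. - mult_i (x1 z)) v z"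
      by (rule ddir_cong[OF open_V z x2])
    also have "\<dots> = - mult_i (ddir x1 v z)"
      by (rule ddir_linear[OF bounded_linear_minus[OF bounded_linear_mult_i] diff(1)[OF z]])
    finally show ?thesis .
  qed
  have "et v z = of_real (m / 2) * cnj (om v z)" for v
  proof -
    have "a22 v z = a11 v z + m * Omega (ddir x1 v z) (x1 z)"
      "a12 v z = - (m * Omega (ddir x1 v z) (x2 z)) - a21 v z"
      unfolding dx2 by (simp_all add: Omega_bilinear_simps Omega_mult_i ix3 ix4)
    moreover have "Omega (ddir x1 v z) (x1 z) = - c11 v z" "Omega (ddir x1 v z) (x2 z) = - c21 v z"
      by (rule Omega_commute)+
    moreover have "c22 v z = - c11 v z"
      using tr[of v] by simp
    ultimately show ?thesis
      by (simp add: plane_et_def plane_om_def complex_eq_iff)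
  qed
  then show ?thesis
    using that by blast
qed

theorem complex_curve_totally_umbilic:
  assumes A: "riemann_surface A" and F: "complex_curve A (to_C2 \<circ> f)" and flex: "\<nexists>q. flex_point A (to_C2 \<circ> f) q"
  shows "totally_umbilic A f"
proof -
  have ch: "is_chart c" if "c \<in> A" for c
    using A that by (simp add: riemann_surface_def)
  let ?D = "(0, mat 1) :: (real^4) \<times> (real^4^4)"
  let ?F = "to_C2 \<circ> f"
  have D1: "snd ?D \<in> Sp4"
    by (auto simp: Sp4_def invertible_def intro!: exI[of _ "mat 1"])
  have D2: "?F = to_C2 \<circ> affine_act ?D \<circ> f"
    by (simp add: fun_eq_iff affine_act_def)
  have f: "smooth_on_surface A UNIV f"
    by (rule complex_curve_smooth[OF ch F])
  have hol: "(\<lambda>z. ?F (chart_inv c z) $ k) holomorphic_on snd c ` chart_dom c" if "c \<in> A" for c k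
    using F that by (simp add: complex_curve_def)
  note df = smooth_on_surface_differentiable[OF f]
  have z0: "curve_z c ?F q \<noteq> 0" if "c \<in> A" "q \<in> chart_dom c" for c q
    using F that by (auto simp: complex_curve_def)
  have dF: "to_C2 (dif c f q v) = v *s curve_z c ?F q" if c: "c \<in> A" "q \<in> chart_dom c" for c q v
  proof -
    have "(?F \<circ> chart_inv c) differentiable (at (snd c q))"
      unfolding D2 by (rule dif_affine_to_C2(2)[OF df[OF c]])
    then have "dif c ?F q v = v *s curve_z c ?F q"
      by (rule dif_holomorphic[OF _ ch[OF c(1)] c(2) hol[OF c(1)]])
    moreover have "dif c ?F q v = to_C2 (snd ?D *v dif c f q v)"
      unfolding D2 by (rule dif_affine_to_C2(1)[OF df[OF c]])
    ultimately show ?thesis by simp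
  qed
  have lag: "lagrangian_immersion A f"
    unfolding lagrangian_immersion_def
  proof (intro conjI f ballI allI)
    fix c q assume c: "c \<in> A" "q \<in> chart_dom c"
    show "inj (dif c f q)"
    proof (rule injI)
      fix v w assume "dif c f q v = dif c f q w"
      then have "v *s curve_z c ?F q = w *s curve_z c ?F q"
        by (simp add: dF[OF c, symmetric])
      then show "v = w"
        using z0[OF c] by (simp add: vector_mul_rcancel)
    qed
    show "Omega (dif c f q v) (dif c f q w) = 0" for v w
      by (simp add: Omega_wedge2 dF[OF c] wedge2_simps)
  qed
  have W: "wedge2 (curve_z c ?F q) (curve_zz c ?F q) \<noteq> 0" if "c \<in> A" "q \<in> chart_dom c" for c q
    using flex that by (auto simp: flex_point_def)
  have frame: "\<exists>a1 a2. Im (cnj a1 * a2) < 0 \<and>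
      to_C2 (column 1 (X q)) = a1 *s curve_z c ?F q \<and> to_C2 (column 2 (X q)) = a2 *s curve_z c ?F q \<and>
      (\<forall>v. gamma11 c X q v = Re (a1 * a1 * v * wedge2 (curve_z c ?F q) (curve_zz c ?F q)) \<and>
        gamma21 c X q v = Re (a1 * a2 * v * wedge2 (curve_z c ?F q) (curve_zz c ?F q)) \<and>
        gamma22 c X q v = Re (a2 * a2 * v * wedge2 (curve_z c ?F q) (curve_zz c ?F q)))"
    if X: "first_order_frame A f U X" and c: "c \<in> A" "q \<in> U" "q \<in> chart_dom c" for U X c q
  proof -
    have sf: "symplectic_frame A U X"
      using X by (simp add: first_order_frame_def)
    have U: "open U" "\<And>p. p \<in> U \<Longrightarrow> X p \<in> Sp4"
      using sf by (simp_all add: symplectic_frame_def)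
    have DX: "(X \<circ> chart_inv c) differentiable (at (snd c p))" if "p \<in> U \<inter> chart_dom c" for p
      using symplectic_frame_point(1)[OF ch[OF c(1)] c(1) sf] that by blast
    have G: "gauss_map c f p = oriented_plane (column 1 (X p)) (column 2 (X p))" if "p \<in> U \<inter> chart_dom c" for p
      using X c(1) that by (auto simp: first_order_frame_def)
    show ?thesis
      using complex_curve_frame[OF ch[OF c(1)] D1 D2 hol[OF c(1)] U(1) df[OF c(1)] DX U(2) G c(2,3)]
      by (simp only: snd_conv matrix_vector_mul_lid)
  qed
  have ell: "elliptic A f"
    unfolding elliptic_def
  proof (intro conjI lag allI impI ballI)
    fix U X c q v
    assume X: "first_order_frame A f U X" and c: "c \<in> A" "q \<in> U \<inter> chart_dom c" and v: "v \<noteq> (0::complex)"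
    let ?W = "wedge2 (curve_z c ?F q) (curve_zz c ?F q)"
    obtain a1 a2 where a: "Im (cnj a1 * a2) < 0"
      "\<And>v. gamma11 c X q v = Re (a1 * a1 * v * ?W)" "\<And>v. gamma21 c X q v = Re (a1 * a2 * v * ?W)"
      "\<And>v. gamma22 c X q v = Re (a2 * a2 * v * ?W)"
      using frame[OF X c(1)] c(2) by blast
    have "frame_g c X q v = (cmod (v * ?W))\<^sup>2 * (Im (cnj a1 * a2))\<^sup>2"
      using frame_g_complex[of a1 "v * ?W" a2] by (simp only: frame_g_def a(2-4) mult.assoc)
    then show "frame_g c X q v > 0"
      using a(1) v W[of c q] c by (simp del: cnj.sel times_complex.sel)
  qed
  show ?thesis
    unfolding totally_umbilic_def
  proof (intro conjI ell allI impI ballI)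
    fix U X c q v
    assume X: "third_order_frame A f U X" and c: "c \<in> A" and q: "q \<in> U \<inter> chart_dom c"
    have so: "second_order_frame A f U X" and fo: "first_order_frame A f U X" and sf: "symplectic_frame A U X"
      using X by (simp_all add: third_order_frame_def second_order_frame_def first_order_frame_def)
    have second: "\<exists>a. a \<noteq> 0 \<and> column 2 (X p) = - mult_i (column 1 (X p)) \<and>
        (\<forall>v. frame_omega c X p v = a * v)" if p: "p \<in> U \<inter> chart_dom c" for p
    proof -
      let ?W = "wedge2 (curve_z c ?F p) (curve_zz c ?F p)"
      obtain a1 a2 where a: "Im (cnj a1 * a2) < 0"
        "to_C2 (column 1 (X p)) = a1 *s curve_z c ?F p" "to_C2 (column 2 (X p)) = a2 *s curve_z c ?F p"
        "\<And>v. gamma11 c X p v = Re (a1 * a1 * v * ?W)" "\<And>v. gamma21 c X p v = Re (a1 * a2 * v * ?W)"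
        "\<And>v. gamma22 c X p v = Re (a2 * a2 * v * ?W)"
        using frame[OF fo c, of p] p by blast
      have W0: "?W \<noteq> 0"
        using W[OF c] p by blast
      have "Re ((a1 * a1 + a2 * a2) * v * ?W) = 0" for v
      proof -
        have "gamma11 c X p v + gamma22 c X p v = 0"
          using so c p by (auto simp: second_order_frame_def)
        then show ?thesis
          unfolding a(4,6) by (simp only: distrib_right plus_complex.sel)
      qed
      \<comment> \<open>A complex number whose products with all v have real part zero is zero: its
        conjugate is taken for v.\<close>
      from this[of "cnj ((a1 * a1 + a2 * a2) * ?W)"]
      have "Re (((a1 * a1 + a2 * a2) * ?W) * cnj ((a1 * a1 + a2 * a2) * ?W)) = 0"
        by (simp only: ac_simps)
      then have "(a1 * a1 + a2 * a2) * ?W = 0"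
        by (simp only: complex_norm_square[symmetric] Re_complex_of_real power2_eq_iff_nonneg zero_eq_power2 norm_eq_zero)
      then have "a1 * a1 + a2 * a2 = 0"
        using W0 by (simp only: mult_eq_0_iff simp_thms)
      then have "(a2 - \<i> * a1) * (a2 + \<i> * a1) = 0"
        by (simp add: algebra_simps)
      \<comment> \<open>The orientation decides between the two square roots: this one would make
        the imaginary part of \<open>cnj a1 * a2\<close> nonnegative.\<close>
      moreover have "a2 \<noteq> \<i> * a1"
      proof
        assume "a2 = \<i> * a1"
        then have "Im (cnj a1 * a2) = (Re a1)\<^sup>2 + (Im a1)\<^sup>2"
          by (simp add: power2_eq_square)
        then show False
          using a(1) sum_power2_ge_zero[of "Re a1" "Im a1"] by linarith
      qed
      ultimately have a2: "a2 = - \<i> * a1"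
        by (simp add: eq_neg_iff_add_eq_0)
      have "a1 \<noteq> 0"
        using a(1) by auto
      moreover have "column 2 (X p) = - mult_i (column 1 (X p))"
      proof -
        have "to_C2 (column 2 (X p)) = (- \<i>) *s to_C2 (column 1 (X p))"
          unfolding a(2,3) a2 by (simp add: vec_eq_iff)
        then have "column 2 (X p) = of_C2 ((- \<i>) *s to_C2 (column 1 (X p)))"
          by (metis of_C2_to_C2)
        then show ?thesis
          by (simp add: mult_i_def vec_eq_iff forall_4 of_C2_components)
      qed
      moreover have "frame_omega c X p v = a1 * a1 * ?W * v" for v
      proof -
        have "a2 * a2 * v * ?W = - (a1 * a1 * v * ?W)" "a1 * a2 * v * ?W = - \<i> * (a1 * a1 * v * ?W)"
          unfolding a2 by (simp_all add: algebra_simps)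
        then have "frame_omega c X p v = a1 * a1 * v * ?W"
          unfolding frame_omega_def a(4-6) by (simp add: complex_eq_iff del: times_complex.sel)
        then show ?thesis
          by (simp add: ac_simps)
      qed
      ultimately show ?thesis
        using W0 by (intro exI[of _ "a1 * a1 * ?W"]) auto
    qed
    let ?V = "snd c ` (chart_dom c \<inter> U)"
    interpret P: planar_frame ?V "frame_col c X 1" "frame_col c X 2" "frame_col c X 3" "frame_col c X 4"
      by (rule planar_frame_cols[OF ch[OF c] c sf])
    define z where "z = snd c q"
    have z: "z \<in> ?V"
      using q by (auto simp: z_def)
    have q': "q \<in> U" "q \<in> chart_dom c"
      using q by auto
    note S = symplectic_frame_point[OF ch[OF c] c sf q']
    have forms: "frame_omega c X q v = P.om v z" "frame_eta c X q v = P.et v z" for v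
      using frame_forms_planar[OF S(1-3)] by (simp_all add: z_def)
    have "frame_col c X 2 y = - mult_i (frame_col c X 1 y)" if "y \<in> ?V" for y
      using second[of "chart_inv c y"] chart_inv_image[OF ch[OF c] that] by (auto simp: frame_col_def)
    moreover have "P.c11 v z + P.c22 v z = 0" for v
    proof -
      have "gamma11 c X q v + gamma22 c X q v = 0"
        using so c q by (auto simp: second_order_frame_def)
      then show ?thesis
        unfolding frame_theta_gamma[OF S(1-3)] z_def .
    qed
    ultimately obtain m where m: "\<And>v. P.et v z = of_real m * cnj (P.om v z)"
      using P.et_complex_curve[OF _ z] by metis
    obtain a where a: "a \<noteq> 0" "\<And>v. P.om v z = a * v"
      using second[OF q] by (auto simp: forms)
    obtain h where h: "\<And>v. P.et v z = h * P.om v z"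
    proof -
      have "\<exists>h. eta_coeffs c X q h 0"
        using X c q unfolding third_order_frame_def by blast
      then show ?thesis
        using that by (auto simp: eta_coeffs_def forms)
    qed
    \<comment> \<open>The values of \<omega> exhaust C, so a conjugate-linear map coincides with a
      complex linear one, and both must be zero.\<close>
    have "of_real m * cnj k = h * k" for k
      using m[of "k / a"] h[of "k / a"] a by simp
    from this[of 1] this[of \<i>] have "m = 0"
      by (auto simp: complex_eq_iff)
    then show "hopf c f X q v = 0"
      by (simp add: hopf_def forms m)
  qed
qed

section \<open>The inverse function theorem in the plane\<close>

text \<open>Cramer's rule, spelled out so that the derivative of an inverse map is visibly a smooth
  function of the point.\<close>

lemma plane_linear_inverse:
  assumes "linear S" "plane_det S \<noteq> 0" "S v = w"
  shows "v = Complex ((Re w * Im (S \<i>) - Im w * Re (S \<i>)) / plane_det S)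
    ((Re (S 1) * Im w - Im (S 1) * Re w) / plane_det S)"
proof -
  have "Re w = Re v * Re (S 1) + Im v * Re (S \<i>)" "Im w = Re v * Im (S 1) + Im v * Im (S \<i>)"
    using linear_plane[OF assms(1), of v] assms(3) by auto
  then have "Re w * Im (S \<i>) - Im w * Re (S \<i>) = Re v * plane_det S"
    "Re (S 1) * Im w - Im (S 1) * Re w = Im v * plane_det S"
    by (simp_all add: plane_det_def algebra_simps)
  then show ?thesis
    using assms(2) by (simp add: complex_eq_iff)
qed

lemma smooth_on_plane_det:
  assumes V: "open V" and \<psi>: "smooth_on V \<psi>"
  shows "smooth_on V (\<lambda>z. plane_det (\<lambda>v. ddir \<psi> v z))"
proof -
  have "smooth_on V (\<lambda>z. Re (ddir \<psi> v z))" "smooth_on V (\<lambda>z. Im (ddir \<psi> v z))" for v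
    by (intro smooth_on_Re_Im smooth_on_ddir V \<psi>)+
  then show ?thesis
    unfolding plane_det_def by (intro smooth_on_diff smooth_on_mult V)
qed

text \<open>Bootstrapping: the derivative of g is a smooth function composed with g, so if g has k
  continuous derivatives it has one more.\<close>

lemma smooth_on_inverse_plane:
  assumes U: "open U" and W: "open W" and hom: "homeomorphism U W \<psi> g" and \<psi>: "smooth_on U \<psi>"
    and det: "\<And>z. z \<in> U \<Longrightarrow> plane_det (\<lambda>v. ddir \<psi> v z) \<noteq> 0"
    and g: "\<And>y. y \<in> W \<Longrightarrow> g differentiable (at y)"
  shows "smooth_on W g"
  unfolding smooth_on_def
proof
  fix k
  have gU: "g ` W \<subseteq> U" "continuous_on W g" "\<And>y. y \<in> W \<Longrightarrow> \<psi> (g y) = y"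
    using hom by (auto simp: homeomorphism_def)
  define G where "G w z = Complex ((Re w * Im (ddir \<psi> \<i> z) - Im w * Re (ddir \<psi> \<i> z)) / plane_det (\<lambda>v. ddir \<psi> v z))
    ((Re (ddir \<psi> 1 z) * Im w - Im (ddir \<psi> 1 z) * Re w) / plane_det (\<lambda>v. ddir \<psi> v z))" for w z
  have RI: "smooth_on U (\<lambda>z. Re (ddir \<psi> v z))" "smooth_on U (\<lambda>z. Im (ddir \<psi> v z))" for v
    by (intro smooth_on_Re_Im smooth_on_ddir U \<psi>)+
  have G: "smooth_on U (G w)" for w
    unfolding G_def
    by (intro smooth_on_Complex smooth_on_divide smooth_on_diff smooth_on_mult smooth_on_const RI
        smooth_on_plane_det U \<psi> det; assumption)
  have dg: "(g has_derivative (\<lambda>w. G w (g y))) (at y)" if y: "y \<in> W" for y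
  proof -
    have gy: "g y \<in> U"
      using gU y by blast
    note D\<psi> = smooth_onD[OF \<psi> gy]
    have "((\<lambda>y. \<psi> (g y)) has_derivative (\<lambda>w. ddir \<psi> (ddir g w y) (g y))) (at y)"
      by (rule has_derivative_compose[OF has_derivative_ddir[OF g[OF y]] has_derivative_ddir[OF D\<psi>]])
    moreover have "((\<lambda>y. \<psi> (g y)) has_derivative (\<lambda>w. w)) (at y)"
      by (rule has_derivative_transform_within_open[OF has_derivative_ident W y]) (simp add: gU(3))
    ultimately have "ddir \<psi> (ddir g w y) (g y) = w" for w
      using has_derivative_unique by metis
    from plane_linear_inverse[OF linear_ddir[OF D\<psi>] det[OF gy] this]
    have "ddir g w y = G w (g y)" for w
      unfolding G_def .
    then show ?thesis
      using has_derivative_ddir[OF g[OF y]] by simp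
  qed
  show "Ck_on k W g"
  proof (induction k)
    case 0
    then show ?case using gU(2) by simp
  next
    case (Suc k)
    show ?case
    proof (rule Ck_on_SucI[OF W dg])
      show "Ck_on k W (\<lambda>y. G w (g y))" for w
        using G[of w] by (intro Ck_on_compose[OF W U gU(1) Suc]) (simp add: smooth_on_def)
    qed
  qed
qed

lemma inverse_function_plane:
  fixes \<psi> :: "complex \<Rightarrow> complex"
  assumes V: "open V" and \<psi>: "smooth_on V \<psi>" and z0: "z0 \<in> V" and det: "plane_det (\<lambda>v. ddir \<psi> v z0) > 0"
  obtains U W g where "open U" "U \<subseteq> V" "z0 \<in> U" "open W" "homeomorphism U W \<psi> g" "smooth_on W g"
    "\<And>z. z \<in> U \<Longrightarrow> plane_det (\<lambda>v. ddir \<psi> v z) > 0"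
proof -
  \<comment> \<open>Restricting beforehand to positive determinant gives orientation and
    invertibility of the derivative on all of the resulting neighbourhood, not just at
    \<open>z0\<close>.\<close>
  define V' where "V' = {z \<in> V. plane_det (\<lambda>v. ddir \<psi> v z) > 0}"
  have "continuous_on V (\<lambda>z. plane_det (\<lambda>v. ddir \<psi> v z))"
    by (intro smooth_on_imp_continuous_on smooth_on_plane_det V \<psi>)
  then have "open ((\<lambda>z. plane_det (\<lambda>v. ddir \<psi> v z)) -` {0<..} \<inter> V)"
    by (rule continuous_on_open_vimage[OF V, THEN iffD1, rule_format]) simp
  moreover have "(\<lambda>z. plane_det (\<lambda>v. ddir \<psi> v z)) -` {0<..} \<inter> V = V'"
    by (auto simp: V'_def)
  ultimately have V': "open V'"
    by simp
  have z0': "z0 \<in> V'" and sub: "V' \<subseteq> V"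
    using z0 det by (auto simp: V'_def)
  define \<psi>' where "\<psi>' z = Blinfun (\<lambda>v. ddir \<psi> v z)" for z
  have D: "(\<psi> has_derivative (\<lambda>v. ddir \<psi> v z)) (at z)" if "z \<in> V'" for z
    using smooth_onD[OF \<psi>] that sub by (intro has_derivative_ddir) blast
  have \<psi>': "blinfun_apply (\<psi>' z) = (\<lambda>v. ddir \<psi> v z)" if "z \<in> V'" for z
    unfolding \<psi>'_def using has_derivative_bounded_linear[OF D[OF that]] by (rule bounded_linear_Blinfun_apply)
  have "continuous_on V' \<psi>'"
  proof (rule continuous_on_blinfun_componentwise)
    fix i :: complex
    have "continuous_on V' (ddir \<psi> i)"
      using smooth_on_imp_continuous_on[OF smooth_on_ddir[OF \<psi>]] sub by (rule continuous_on_subset)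
    then show "continuous_on V' (\<lambda>z. blinfun_apply (\<psi>' z) i)"
      by (rule continuous_on_eq) (simp add: \<psi>')
  qed
  moreover obtain h where h: "linear h" "h \<circ> (\<lambda>v. ddir \<psi> v z0) = id"
  proof -
    have lin: "linear (\<lambda>v. ddir \<psi> v z0)"
      using D[OF z0'] by (rule has_derivative_linear)
    have "inj (\<lambda>v. ddir \<psi> v z0)"
      unfolding linear_injective_0[OF lin] using plane_det_inj[OF lin] det by auto
    then show ?thesis
      using linear_injective_left_inverse[OF lin] that by blast
  qed
  then have "Blinfun h o\<^sub>L \<psi>' z0 = id_blinfun"
    by (intro blinfun_eqI) (simp add: \<psi>'[OF z0'] bounded_linear_Blinfun_apply linear_conv_bounded_linear fun_eq_iff)
  ultimately obtain U W g g' where I: "open U" "U \<subseteq> V'" "z0 \<in> U" "open W" "homeomorphism U W \<psi> g"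
      "\<And>y. y \<in> W \<Longrightarrow> (g has_derivative (g' y)) (at y)"
    using inverse_function_theorem[OF V' _ _ z0', of \<psi> \<psi>' "Blinfun h"] D \<psi>' by metis
  have det': "plane_det (\<lambda>v. ddir \<psi> v z) > 0" if "z \<in> U" for z
    using I(2) that by (auto simp: V'_def)
  have "smooth_on W g"
  proof (rule smooth_on_inverse_plane[OF I(1,4,5)])
    show "smooth_on U \<psi>"
      using \<psi> I(2) sub by (meson smooth_on_subset subset_trans)
  qed (use det' I(6) in \<open>force simp: differentiable_def\<close>)+
  then show ?thesis
    using that I sub det' by blast
qed

section \<open>The complex structure induced by a totally umbilic immersion\<close>

text \<open>Membership in the maximal oriented smooth atlas: the part of the definition of
  \<open>induced_structure\<close> that does not involve g.\<close>

definition compatible_chart :: "'a::topological_space chart set \<Rightarrow> 'a chart \<Rightarrow> bool" where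
  "compatible_chart A d \<longleftrightarrow> is_chart d \<and> (\<forall>c\<in>A. oriented_transition c d \<and> oriented_transition d c)"

lemma compatible_chart_atlas: "oriented_surface A \<Longrightarrow> c \<in> A \<Longrightarrow> compatible_chart A c"
  by (simp add: compatible_chart_def oriented_surface_def)

lemma compatible_chart_differentiable:
  assumes d: "compatible_chart A d" and c: "c \<in> A" "is_chart c" and q: "q \<in> chart_dom c" "q \<in> chart_dom d"
    and F: "(F \<circ> chart_inv c) differentiable (at (snd c q))"
  shows "(F \<circ> chart_inv d) differentiable (at (snd d q))" "dif d F q v = dif c F q (dif d (snd c) q v)"
    "dif c F q v = dif d F q (dif c (snd d) q v)"
proof -
  have d': "is_chart d" "oriented_transition d c" "oriented_transition c d"
    using d c by (simp_all add: compatible_chart_def)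
  note T = oriented_transitionD(1)[OF d'(2) q c(2) d'(1)] and T' = oriented_transitionD(1)[OF d'(3) q(2,1) d'(1) c(2)]
  show Fd: "(F \<circ> chart_inv d) differentiable (at (snd d q))"
    using has_derivative_change[OF c(2) d'(1) q T F] by (auto simp: differentiable_def)
  show "dif d F q v = dif c F q (dif d (snd c) q v)"
    by (rule dif_change[OF c(2) d'(1) q T F])
  show "dif c F q v = dif d F q (dif c (snd d) q v)"
    by (rule dif_change[OF d'(1) c(2) q(2,1) T' Fd])
qed

lemma dif_self:
  assumes "is_chart d" "q \<in> chart_dom d"
  shows "dif d (snd d) q v = v" "(snd d \<circ> chart_inv d) differentiable (at (snd d q))"
proof -
  have "((snd d \<circ> chart_inv d) has_derivative (\<lambda>v. v)) (at (snd d q))"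
    by (rule has_derivative_transform_within_open[OF has_derivative_ident, of "snd d ` chart_dom d"])
      (use assms snd_chart_inv[of _ d] in \<open>auto simp: is_chart_def\<close>)
  then show "dif d (snd d) q v = v" "(snd d \<circ> chart_inv d) differentiable (at (snd d q))"
    by (auto simp: dif_ddir ddir_eq differentiable_def)
qed

lemma compatible_chart_inverse:
  assumes d: "compatible_chart A d" and c: "c \<in> A" "is_chart c" and q: "q \<in> chart_dom c" "q \<in> chart_dom d"
  shows "dif c (snd d) q (dif d (snd c) q v) = v" "dif d (snd c) q (dif c (snd d) q v) = v"
    "(snd d \<circ> chart_inv c) differentiable (at (snd c q))"
proof -
  have d': "is_chart d" "oriented_transition c d"
    using d c by (simp_all add: compatible_chart_def)
  show D: "(snd d \<circ> chart_inv c) differentiable (at (snd c q))"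
    using oriented_transitionD(1)[OF d'(2) q(2,1) d'(1) c(2)] by (simp add: transition_def)
  show "dif c (snd d) q (dif d (snd c) q v) = v"
    using compatible_chart_differentiable(2)[OF d c q D, of v] dif_self(1)[OF d'(1) q(2)] by simp
  show "dif d (snd c) q (dif c (snd d) q v) = v"
    using compatible_chart_differentiable(3)[OF d c q dif_self(2)[OF c(2) q(1)], of v] dif_self(1)[OF c(2) q(1)] by simp
qed

text \<open>Comparing lengths at 1, i and 1 + i shows that the images of 1 and i are orthogonal and
  of equal length. With positive determinant S is then multiplication by \<open>S 1\<close>.\<close>

lemma conformal_linear:
  assumes S: "linear S" "plane_det S > 0" and conf: "\<And>w. r0 * (cmod (S w))\<^sup>2 = r * (cmod w)\<^sup>2" and r0: "r0 > 0"
  shows "S w = w * S 1"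
proof -
  define k0 where "k0 = r / r0"
  have k: "(cmod (S v))\<^sup>2 = k0 * (cmod v)\<^sup>2" for v
    using conf[of v] r0 by (simp add: k0_def field_simps)
  have S1i: "S (1 + \<i>) = S 1 + S \<i>"
    by (rule linear_add[OF S(1)])
  have "(Re (S 1))\<^sup>2 + (Im (S 1))\<^sup>2 = k0" "(Re (S \<i>))\<^sup>2 + (Im (S \<i>))\<^sup>2 = k0"
    "(Re (S 1) + Re (S \<i>))\<^sup>2 + (Im (S 1) + Im (S \<i>))\<^sup>2 = k0 * 2"
    using k[of 1] k[of \<i>] k[of "1 + \<i>"] unfolding S1i cmod_power2 by simp_all
  then have "(Re (S 1))\<^sup>2 + (Im (S 1))\<^sup>2 = (Re (S \<i>))\<^sup>2 + (Im (S \<i>))\<^sup>2"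
    "Re (S 1) * Re (S \<i>) + Im (S 1) * Im (S \<i>) = 0"
    by (simp_all add: power2_eq_square algebra_simps)
  moreover have "Re (S 1) * Im (S \<i>) - Re (S \<i>) * Im (S 1) > 0"
    using S(2) by (simp add: plane_det_def mult.commute)
  ultimately have "Im (S \<i>) = Re (S 1)" "Im (S 1) = - Re (S \<i>)"
    by (rule conformal_basis_change)+
  then show ?thesis
    unfolding linear_plane[OF S(1), of w] by (simp add: complex_eq_iff mult.commute)
qed

text \<open>Complex linearity of the real differential is the Cauchy-Riemann system, and the vector
  u is the complex derivative.\<close>

lemma complex_tangents_holomorphic:
  fixes F :: "'a::topological_space \<Rightarrow> complex^2"
  assumes d: "is_chart d" and F: "\<And>q. q \<in> chart_dom d \<Longrightarrow> (F \<circ> chart_inv d) differentiable (at (snd d q))"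
    and lin: "\<And>q. q \<in> chart_dom d \<Longrightarrow> \<exists>u. u \<noteq> 0 \<and> (\<forall>v. dif d F q v = v *s u)"
  shows "(\<lambda>z. F (chart_inv d z) $ k) holomorphic_on snd d ` chart_dom d"
    "q \<in> chart_dom d \<Longrightarrow> curve_z d F q \<noteq> 0"
proof -
  have D: "((\<lambda>z. F (chart_inv d z) $ k) has_field_derivative u $ k) (at (snd d q))"
    if q: "q \<in> chart_dom d" and u: "\<And>v. dif d F q v = v *s u" for q u k
  proof -
    have "((\<lambda>z. (F \<circ> chart_inv d) z $ k) has_derivative (\<lambda>v. ddir (F \<circ> chart_inv d) v (snd d q) $ k)) (at (snd d q))"
      by (intro bounded_linear.has_derivative[OF bounded_linear_vec_nth] has_derivative_ddir F q)
    moreover have "(\<lambda>v. ddir (F \<circ> chart_inv d) v (snd d q) $ k) = times (u $ k)"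
      using u by (simp add: dif_ddir fun_eq_iff mult.commute)
    ultimately show ?thesis
      by (simp add: has_field_derivative_def)
  qed
  show "(\<lambda>z. F (chart_inv d z) $ k) holomorphic_on snd d ` chart_dom d"
  proof (rule holomorphic_onI)
    fix z assume "z \<in> snd d ` chart_dom d"
    then obtain q where q: "z = snd d q" "q \<in> chart_dom d"
      by blast
    then show "(\<lambda>z. F (chart_inv d z) $ k) field_differentiable at z within snd d ` chart_dom d"
      using D lin[OF q(2)] unfolding field_differentiable_def by (metis has_field_derivative_at_within)
  qed
  show "curve_z d F q \<noteq> 0" if q: "q \<in> chart_dom d"
  proof -
    obtain u where u: "u \<noteq> 0" "\<And>v. dif d F q v = v *s u"
      using lin[OF q] by blast
    have "curve_z d F q = u"
      using DERIV_imp_deriv[OF D[OF q u(2)]] by (simp add: curve_z_def vec_eq_iff)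
    then show ?thesis
      using u(1) by simp
  qed
qed

text \<open>What the constancy of K delivers. In a chart of the oriented atlas the differential is u
  times a merely real-linear, orientation-preserving T, which stands in for the differential of a
  holomorphic coordinate yet to be found.\<close>

locale elliptic_complex_tangents =
  fixes A :: "'a::t2_space chart set" and f :: "'a \<Rightarrow> real^4" and D :: "(real^4) \<times> (real^4^4)"
  assumes A: "oriented_surface A" and ell: "elliptic A f" and D: "snd D \<in> Sp4"
    and tangents: "\<And>c q. c \<in> A \<Longrightarrow> q \<in> chart_dom c \<Longrightarrow> \<exists>u T. u \<noteq> 0 \<and> linear T \<and> plane_det T > 0 \<and>
       (\<forall>v. to_C2 (snd D *v dif c f q v) = T v *s u)"
begin

definition "F = to_C2 \<circ> affine_act D \<circ> f"

lemma f_smooth: "smooth_on_surface A UNIV f"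
  using ell by (simp add: elliptic_def lagrangian_immersion_def)

lemma chart_A: "c \<in> A \<Longrightarrow> is_chart c"
  using A by (simp add: oriented_surface_def)

lemma compat_A: "c \<in> A \<Longrightarrow> compatible_chart A c"
  by (rule compatible_chart_atlas[OF A])

lemma f_diff:
  assumes d: "compatible_chart A d" and q: "q \<in> chart_dom d"
  shows "(f \<circ> chart_inv d) differentiable (at (snd d q))"
proof -
  obtain c where c: "c \<in> A" "q \<in> chart_dom c"
    by (rule chart_at[OF A])
  show ?thesis
    by (rule compatible_chart_differentiable(1)[OF d c(1) chart_A[OF c(1)] c(2) q
          smooth_on_surface_differentiable[OF f_smooth c]])
qed

lemma F_diff: "compatible_chart A d \<Longrightarrow> q \<in> chart_dom d \<Longrightarrow> (F \<circ> chart_inv d) differentiable (at (snd d q))"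
  unfolding F_def by (rule dif_affine_to_C2(2)[OF f_diff])

lemma frame_point:
  assumes X: "first_order_frame A f U X" and d: "compatible_chart A d" and q: "q \<in> U \<inter> chart_dom d"
  shows "(X \<circ> chart_inv d) differentiable (at (snd d q))"
    "gauss_map d f q = oriented_plane (column 1 (X q)) (column 2 (X q))"
proof -
  obtain c where c: "c \<in> A" "q \<in> chart_dom c"
    by (rule chart_at[OF A])
  have q': "q \<in> U" "q \<in> chart_dom d"
    using q by auto
  have ch: "is_chart d" "oriented_transition d c"
    using d c(1) by (simp_all add: compatible_chart_def)
  have sf: "symplectic_frame A U X"
    using X by (simp add: first_order_frame_def)
  show "(X \<circ> chart_inv d) differentiable (at (snd d q))"
    by (rule compatible_chart_differentiable(1)[OF d c(1) chart_A[OF c(1)] c(2) q'(2)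
          symplectic_frame_point(1)[OF chart_A[OF c(1)] c(1) sf q'(1) c(2)]])
  have "gauss_map d f q = gauss_map c f q"
    by (rule gauss_map_transition[OF chart_A[OF c(1)] ch c(2) q'(2) smooth_on_surface_differentiable[OF f_smooth c]])
  then show "gauss_map d f q = oriented_plane (column 1 (X q)) (column 2 (X q))"
    using X c q' by (auto simp: first_order_frame_def)
qed

lemma frame_g_change:
  assumes X: "first_order_frame A f U X" and d: "compatible_chart A d" and c: "c \<in> A"
    and q: "q \<in> U" "q \<in> chart_dom c" "q \<in> chart_dom d"
  shows "frame_g c X q v = frame_g d X q (dif c (snd d) q v)"
proof -
  have "(X \<circ> chart_inv c) differentiable (at (snd c q))"
    using frame_point(1)[OF X compat_A[OF c], of q] q by simp
  from compatible_chart_differentiable(3)[OF d c chart_A[OF c] q(2,3) this]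
  show ?thesis
    by (simp add: frame_g_def frame_theta_def)
qed

text \<open>Compatible charts in which the differential of F is complex linear. By
  \<open>complex_chart_induced\<close> and \<open>induced_complex_chart\<close> they turn out to be
  exactly the charts of \<open>induced_structure\<close>.\<close>

definition complex_chart :: "'a chart \<Rightarrow> bool" where
  "complex_chart d \<longleftrightarrow> compatible_chart A d \<and>
     (\<forall>q\<in>chart_dom d. \<exists>u. u \<noteq> 0 \<and> (\<forall>v. dif d F q v = v *s u))"

lemma complex_chart_holomorphic:
  assumes "complex_chart d"
  shows "(\<lambda>z. F (chart_inv d z) $ k) holomorphic_on snd d ` chart_dom d"
    "q \<in> chart_dom d \<Longrightarrow> curve_z d F q \<noteq> 0"
  using assms complex_tangents_holomorphic[of d F] F_diff
  by (auto simp: complex_chart_def compatible_chart_def)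

text \<open>In such a chart g is a constant r times the squared modulus, and r contains the squared
  modulus of the wedge of the first two derivatives. Ellipticity at a single vector gives r > 0,
  hence conformality and the absence of flex points together.\<close>

lemma complex_chart_frame_g:
  assumes d: "complex_chart d" and X: "first_order_frame A f U X" and q: "q \<in> U" "q \<in> chart_dom d"
  shows "\<exists>r>0. \<forall>w. frame_g d X q w = r * (cmod w)\<^sup>2"
    "wedge2 (curve_z d F q) (curve_zz d F q) \<noteq> 0"
proof -
  let ?W = "wedge2 (curve_z d F q) (curve_zz d F q)"
  have d': "compatible_chart A d" "is_chart d"
    using d by (simp_all add: complex_chart_def compatible_chart_def)
  have U: "open U" "\<And>p. p \<in> U \<Longrightarrow> X p \<in> Sp4"
    using X by (simp_all add: first_order_frame_def symplectic_frame_def)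
  obtain a1 a2 where a: "Im (cnj a1 * a2) < 0" "\<And>v. gamma11 d X q v = Re (a1 * a1 * v * ?W)"
    "\<And>v. gamma21 d X q v = Re (a1 * a2 * v * ?W)" "\<And>v. gamma22 d X q v = Re (a2 * a2 * v * ?W)"
    using complex_curve_frame[OF d'(2) D F_def complex_chart_holomorphic(1)[OF d] U(1) f_diff[OF d'(1)]
        frame_point(1)[OF X d'(1)] U(2) frame_point(2)[OF X d'(1)] q] by blast
  define r where "r = (cmod ?W)\<^sup>2 * (Im (cnj a1 * a2))\<^sup>2"
  have g: "frame_g d X q w = r * (cmod w)\<^sup>2" for w
  proof -
    have "frame_g d X q w = (cmod (w * ?W))\<^sup>2 * (Im (cnj a1 * a2))\<^sup>2"
      using frame_g_complex[of a1 "w * ?W" a2] by (simp only: frame_g_def a(2-4) mult.assoc)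
    then show ?thesis
      by (simp only: r_def norm_mult power_mult_distrib ac_simps)
  qed
  obtain c where c: "c \<in> A" "q \<in> chart_dom c"
    by (rule chart_at[OF A])
  have "frame_g c X q 1 > 0"
    using ell X c q unfolding elliptic_def by (metis IntI zero_neq_one)
  then have "r * (cmod (dif c (snd d) q 1))\<^sup>2 > 0"
    using frame_g_change[OF X d'(1) c(1) q(1) c(2) q(2)] g by simp
  then have "r > 0"
    by (simp add: zero_less_mult_iff)
  then show "\<exists>r>0. \<forall>w. frame_g d X q w = r * (cmod w)\<^sup>2" "?W \<noteq> 0"
    using g by (auto simp: r_def)
qed

lemma complex_chart_induced:
  assumes d: "complex_chart d"
  shows "d \<in> induced_structure A f"
proof -
  have d': "compatible_chart A d"
    using d by (simp add: complex_chart_def)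
  have "\<exists>r>0. \<forall>v. frame_g c X q v = r * (cmod (dif c (snd d) q v))\<^sup>2"
    if X: "first_order_frame A f U X" and c: "c \<in> A" and q: "q \<in> U \<inter> chart_dom c \<inter> chart_dom d" for U X c q
    using complex_chart_frame_g(1)[OF d X, of q] frame_g_change[OF X d' c, of q] q by auto
  then show ?thesis
    using d' by (auto simp: induced_structure_def compatible_chart_def)
qed

text \<open>A component of F whose derivative is nonzero at \<open>q0\<close> serves as coordinate:
  where it is one, the other component has complex linear differential with respect to it.\<close>

lemma complex_chart_exists: "\<exists>d. complex_chart d \<and> q0 \<in> chart_dom d"
proof -
  obtain c where c: "c \<in> A" "q0 \<in> chart_dom c"
    by (rule chart_at[OF A])
  note ch = chart_A[OF c(1)]
  let ?V = "snd c ` chart_dom c"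
  have V: "open ?V"
    using ch by (simp add: is_chart_def)
  have dF: "\<exists>u T. u \<noteq> 0 \<and> linear T \<and> plane_det T > 0 \<and> (\<forall>v. dif c F q v = T v *s u)" if "q \<in> chart_dom c" for q
    using tangents[OF c(1) that] dif_affine_to_C2(1)[OF f_diff[OF compat_A[OF c(1)] that], of D]
    by (simp add: F_def)
  obtain u0 T0 where u0: "u0 \<noteq> 0" "linear T0" "plane_det T0 > 0" "\<And>v. dif c F q0 v = T0 v *s u0"
    using dF[OF c(2)] by blast
  obtain k where k: "u0 $ k \<noteq> 0"
    using u0(1) by (auto simp: vec_eq_iff)
  define \<psi> where "\<psi> z = F (chart_inv c z) $ k" for z
  have Fs: "smooth_on ?V (F \<circ> chart_inv c)"
  proof -
    have "smooth_on ?V (f \<circ> chart_inv c)"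
      using f_smooth c(1) by (auto simp: smooth_on_surface_def)
    then have "smooth_on ?V (\<lambda>z. to_C2 (fst D + snd D *v (f \<circ> chart_inv c) z))"
      by (intro smooth_on_linear[OF V bounded_linear_to_C2] smooth_on_add V smooth_on_const
          smooth_on_linear[OF V matrix_vector_mul_bounded_linear])
    then show ?thesis
      by (simp add: F_def affine_act_def o_def)
  qed
  have \<psi>: "smooth_on ?V \<psi>"
    using smooth_on_linear[OF V bounded_linear_vec_nth Fs, of k] by (simp add: \<psi>_def[abs_def])
  have d\<psi>: "ddir \<psi> v (snd c q) = dif c F q v $ k" if "q \<in> chart_dom c" for q v
    using ddir_linear[OF bounded_linear_vec_nth F_diff[OF compat_A[OF c(1)] that], of k v]
    by (simp add: dif_ddir \<psi>_def[abs_def])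
  \<comment> \<open>The differential of \<psi> is \<open>T0\<close> followed by multiplication by a
    nonzero complex number, a similarity that preserves orientation.\<close>
  have "plane_det (\<lambda>v. ddir \<psi> v (snd c q0)) = plane_det T0 * (cmod (u0 $ k))\<^sup>2"
    unfolding d\<psi>[OF c(2)] u0(4) by (simp add: plane_det_def cmod_power2) (simp add: power2_eq_square algebra_simps)
  then have det: "plane_det (\<lambda>v. ddir \<psi> v (snd c q0)) > 0"
    using u0(3) k by simp
  have z0: "snd c q0 \<in> ?V"
    using c(2) by blast
  obtain U W g where I: "open U" "U \<subseteq> ?V" "snd c q0 \<in> U" "open W" "homeomorphism U W \<psi> g" "smooth_on W g"
    "\<And>z. z \<in> U \<Longrightarrow> plane_det (\<lambda>v. ddir \<psi> v z) > 0"
    using inverse_function_plane[OF V \<psi> z0 det] by metis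
  define d :: "'a chart" where "d = (chart_inv c ` U, \<lambda>p. F p $ k)"
  have dom: "chart_dom d = chart_inv c ` U" and sd: "snd d p = F p $ k" for p
    by (simp_all add: d_def)
  have sub: "chart_dom d \<subseteq> chart_dom c"
    unfolding dom using I(2) by (auto intro: chart_inv_mem)
  have zU: "snd c p \<in> U" if p: "p \<in> chart_dom d" for p
    using p I(2) unfolding dom by (auto simp: snd_chart_inv subset_iff)
  have dc: "snd d p = \<psi> (snd c p)" if "p \<in> chart_dom c" for p
    by (simp add: sd \<psi>_def chart_inv_snd[OF ch that])
  have "homeomorphism (chart_dom d) U (snd c) (chart_inv c)"
  proof (rule homeomorphism_of_subsets[of "chart_dom c" ?V])
    show "homeomorphism (chart_dom c) ?V (snd c) (chart_inv c)"
      using ch by (simp add: is_chart_def)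
    show "snd c ` chart_dom d = U"
    proof
      show "snd c ` chart_dom d \<subseteq> U"
        using zU by blast
      show "U \<subseteq> snd c ` chart_dom d"
      proof
        fix z assume z: "z \<in> U"
        then have "snd c (chart_inv c z) = z"
          using I(2) by (auto intro: snd_chart_inv)
        then show "z \<in> snd c ` chart_dom d"
          using z unfolding dom by (intro image_eqI[where x = "chart_inv c z"]) auto
      qed
    qed
  qed (use sub I(2) in auto)
  from homeomorphism_compose[OF this I(5)]
  have hom: "homeomorphism (chart_dom d) W (\<psi> \<circ> snd c) (chart_inv c \<circ> g)" .
  have im: "snd d ` chart_dom d = W"
  proof -
    have "snd d ` chart_dom d = (\<psi> \<circ> snd c) ` chart_dom d"
      using dc sub by (intro image_cong) auto
    then show ?thesis
      using hom by (simp add: homeomorphism_def)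
  qed
  have inv: "chart_inv d y = chart_inv c (g y)" if y: "y \<in> W" for y
  proof -
    have "chart_inv c (g y) \<in> chart_dom d" "\<psi> (snd c (chart_inv c (g y))) = y"
      using hom y by (auto simp: homeomorphism_def)
    moreover have "inj_on (snd d) (chart_dom d)"
    proof (rule inj_onI)
      fix p p' assume p: "p \<in> chart_dom d" "p' \<in> chart_dom d" "snd d p = snd d p'"
      then have "(\<psi> \<circ> snd c) p = (\<psi> \<circ> snd c) p'"
        using dc sub by (metis comp_apply subsetD)
      then show "p = p'"
        using hom p(1,2) by (metis homeomorphism_apply1)
    qed
    ultimately show ?thesis
      using dc sub by (metis inv_into_f_f subsetD)
  qed
  have d: "is_chart d"
    unfolding is_chart_def
  proof (intro conjI)
    show "open (chart_dom d)"
      unfolding dom by (rule open_chart_preimage[OF ch I(1,2)])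
    show "open (snd d ` chart_dom d)"
      using I(4) im by simp
    show "homeomorphism (chart_dom d) (snd d ` chart_dom d) (snd d) (chart_inv d)"
      unfolding im using dc sub inv by (intro homeomorphism_cong[OF hom]) auto
  qed
  have cd: "smooth_on (snd c ` (chart_dom c \<inter> chart_dom d)) (snd d \<circ> chart_inv c)"
  proof -
    have op: "open (snd c ` (chart_dom c \<inter> chart_dom d))"
      by (intro open_chart_image ch open_chart_dom d)
    have "smooth_on (snd c ` (chart_dom c \<inter> chart_dom d)) \<psi>"
      using \<psi> by (rule smooth_on_subset) blast
    then show ?thesis
      by (rule smooth_on_cong[OF op]) (simp add: sd \<psi>_def)
  qed
  have cd_diff: "(snd d \<circ> chart_inv c) differentiable (at (snd c p))" if "p \<in> chart_dom d" for p
    by (rule smooth_onD[OF cd]) (use that sub in blast)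
  have detcd: "linear (dif c (snd d) p)" "plane_det (dif c (snd d) p) > 0" if p: "p \<in> chart_dom d" for p
  proof -
    show "linear (dif c (snd d) p)"
      using linear_ddir[OF cd_diff[OF p]] by (simp add: dif_ddir[abs_def])
    have "ddir (snd d \<circ> chart_inv c) v (snd c p) = ddir \<psi> v (snd c p)" for v
      by (simp add: sd \<psi>_def[abs_def] o_def)
    then show "plane_det (dif c (snd d) p) > 0"
      using I(7)[OF zU[OF p]] by (simp add: dif_ddir[abs_def])
  qed
  have compat: "compatible_chart A d"
    unfolding compatible_chart_def
  proof (intro conjI d ballI)
    fix c' assume c': "c' \<in> A"
    note ch' = chart_A[OF c']
    have oc: "oriented_transition c' c" "oriented_transition c c'"
      using A c(1) c' by (simp_all add: oriented_surface_def)
    have into: "smooth_on (transition_dom c' d) (transition c' d)"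
    proof -
      have "smooth_on (snd c' ` (chart_dom c' \<inter> (chart_dom c \<inter> chart_dom d))) (snd d \<circ> chart_inv c')"
        using oc(1) by (intro smooth_change[OF ch ch' _ open_chart_dom[OF d] cd]) (simp add: oriented_transition_def)
      then show ?thesis
        using sub by (simp add: transition_dom_def transition_def inf.absorb2)
    qed
    \<comment> \<open>The inverse of the new chart is the inverse of \<open>c\<close> composed with
      \<open>g\<close>; here the smoothness of the inverse function enters.\<close>
    have back_smooth: "smooth_on (transition_dom d c') (transition d c')"
    proof -
      let ?S = "transition_dom d c'"
      have S: "open ?S" "?S \<subseteq> W"
        unfolding transition_dom_def im[symmetric] by (intro open_chart_image d open_chart_dom ch') blast
      have "smooth_on ?S (\<lambda>y. transition c c' (g y))"
      proof (rule smooth_on_compose[OF S(1), of "transition_dom c c'" g "transition c c'"])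
        show "open (transition_dom c c')"
          unfolding transition_dom_def by (intro open_chart_image ch open_chart_dom ch')
        show "g ` ?S \<subseteq> transition_dom c c'"
        proof
          fix z assume "z \<in> g ` ?S"
          then obtain p where p: "p \<in> chart_dom d" "p \<in> chart_dom c'" "z = g (snd d p)"
            by (auto simp: transition_dom_def)
          have "z = snd c p"
            using dc[of p] p sub zU[OF p(1)] I(5) by (auto simp: homeomorphism_def)
          then show "z \<in> transition_dom c c'"
            using p sub by (auto simp: transition_dom_def)
        qed
        show "smooth_on ?S g"
          using I(6) S(2) by (rule smooth_on_subset)
        show "smooth_on (transition_dom c c') (transition c c')"
          using oc(2) by (simp add: oriented_transition_def)
      qed
      then show ?thesis
        by (rule smooth_on_cong[OF S(1)]) (use S(2) inv in \<open>auto simp: transition_def\<close>)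
    qed
    \<comment> \<open>One sign follows from the chain rule through \<open>c\<close>; the other
      because the two differentials are mutually inverse and their determinants multiply to
      1.\<close>
    have pos: "plane_det (dif c' (snd d) p) > 0" "plane_det (dif d (snd c') p) > 0"
      if p: "p \<in> chart_dom d" "p \<in> chart_dom c'" for p
    proof -
      have pc: "p \<in> chart_dom c"
        using sub p by blast
      note O = oriented_transitionD[OF oc(1) pc p(2) ch ch']
      have *: "dif c' (snd d) p = (\<lambda>v. dif c (snd d) p (dif c' (snd c) p v))"
        using dif_change[OF ch ch' pc p(2) O(1) cd_diff[OF p(1)]] by blast
      show pos1: "plane_det (dif c' (snd d) p) > 0"
        unfolding * plane_det_compose[OF detcd(1)[OF p(1)] O(2)] using detcd(2)[OF p(1)] O(3) by simp
      have zd: "snd d p \<in> transition_dom d c'" and zc': "snd c' p \<in> transition_dom c' d"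
        using p by (auto simp: transition_dom_def)
      have Dd: "transition d c' differentiable (at (snd d p))" and Dc': "transition c' d differentiable (at (snd c' p))"
        by (rule smooth_onD[OF back_smooth zd], rule smooth_onD[OF into zc'])
      have "dif d (snd d) p v = dif c' (snd d) p (dif d (snd c') p v)" for v
        using dif_change[OF ch' d p(2,1) Dd] Dc' by (simp add: transition_def)
      then have "(\<lambda>v. dif c' (snd d) p (dif d (snd c') p v)) = (\<lambda>v. v)"
        using dif_self(1)[OF d p(1)] by simp
      moreover have "linear (dif c' (snd d) p)" "linear (dif d (snd c') p)"
        using linear_ddir[OF Dc'] linear_ddir[OF Dd] by (simp_all add: dif_ddir[abs_def] transition_def)
      ultimately have "plane_det (dif c' (snd d) p) * plane_det (dif d (snd c') p) = plane_det (\<lambda>v. v)"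
        using plane_det_compose by metis
      then have "plane_det (dif c' (snd d) p) * plane_det (dif d (snd c') p) > 0"
        by (simp add: plane_det_def)
      then show "plane_det (dif d (snd c') p) > 0"
        using pos1 by (simp add: zero_less_mult_iff)
    qed
    show "oriented_transition c' d" "oriented_transition d c'"
      using into back_smooth pos
      by (auto simp: oriented_transition_def transition_dom_def transition_def dif_def[abs_def])
  qed
  have "\<exists>u. u \<noteq> 0 \<and> (\<forall>v. dif d F p v = v *s u)" if p: "p \<in> chart_dom d" for p
  proof -
    have pc: "p \<in> chart_dom c"
      using p sub by blast
    obtain u T where u: "u \<noteq> 0" "\<And>v. dif c F p v = T v *s u"
      using dF[OF pc] by blast
    have T: "dif c (snd d) p v = T v * u $ k" for v
      using d\<psi>[OF pc, of v] u(2) by (simp add: dif_ddir sd o_def \<psi>_def[abs_def])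
    have uk: "u $ k \<noteq> 0"
      using detcd(2)[OF p] by (auto simp: T[abs_def] plane_det_def)
    \<comment> \<open>The coordinate is the k-th component of F itself, so scaling u to have k-th
      entry 1 turns its coefficient into v.\<close>
    have "dif d F p v = v *s ((1 / u $ k) *s u)" for v
    proof -
      have "dif d F p v = T (dif d (snd c) p v) *s u"
        using compatible_chart_differentiable(2)[OF compat c(1) ch pc p F_diff[OF compat_A[OF c(1)] pc]] u(2) by simp
      moreover have "T (dif d (snd c) p v) * u $ k = v"
        using compatible_chart_inverse(1)[OF compat c(1) ch pc p, of v] by (simp add: T)
      ultimately show ?thesis
        using uk by (simp add: vec_eq_iff field_simps)
    qed
    moreover have "(1 / u $ k) *s u \<noteq> 0"
      using u(1) uk by simp
    ultimately show ?thesis by blast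
  qed
  moreover have "q0 \<in> chart_dom d"
    unfolding dom using I(3) chart_inv_snd[OF ch c(2)] by (intro image_eqI[where x = "snd c q0"]) simp_all
  ultimately have "complex_chart d" "q0 \<in> chart_dom d"
    using compat unfolding complex_chart_def by blast+
  then show ?thesis by blast
qed

lemma induced_compatible: "d \<in> induced_structure A f \<Longrightarrow> compatible_chart A d"
  by (simp add: induced_structure_def compatible_chart_def)

text \<open>Both charts present g as a positive multiple of their squared modulus, so the transition
  is conformal. It also preserves orientation, and by \<open>conformal_linear\<close> its
  differential is a complex multiplication.\<close>

lemma induced_transition:
  assumes d: "d \<in> induced_structure A f" and e: "e \<in> induced_structure A f"
    and q: "q \<in> chart_dom d" "q \<in> chart_dom e"
  shows "transition d e differentiable (at (snd d q))"
    "\<exists>s. s \<noteq> 0 \<and> (\<forall>w. dif d (snd e) q w = w * s)"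
proof -
  obtain c where c: "c \<in> A" "q \<in> chart_dom c"
    by (rule chart_at[OF A])
  note ch = chart_A[OF c(1)] and cd = induced_compatible[OF d] and ce = induced_compatible[OF e]
  have oc: "is_chart d" "is_chart e" "oriented_transition d c" "oriented_transition c e"
    using cd ce c(1) by (simp_all add: compatible_chart_def)
  \<comment> \<open>\<open>induced_structure\<close> constrains g through frames only, so a frame at
    q is needed before the two charts can be compared.\<close>
  obtain U X where "q \<in> U" "third_order_frame A f U X"
    using third_order_frame_at[OF A ell] by blast
  then have X: "q \<in> U" "first_order_frame A f U X"
    by (simp_all add: third_order_frame_def second_order_frame_def)
  obtain r r0 where r: "r > 0" "\<And>v. frame_g c X q v = r * (cmod (dif c (snd d) q v))\<^sup>2"
    and r0: "r0 > 0" "\<And>v. frame_g c X q v = r0 * (cmod (dif c (snd e) q v))\<^sup>2"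
    using d e X c q unfolding induced_structure_def by blast
  note Dce = compatible_chart_inverse(3)[OF ce c(1) ch c(2) q(2)]
  show "transition d e differentiable (at (snd d q))"
    using compatible_chart_differentiable(1)[OF cd c(1) ch c(2) q(1) Dce] by (simp add: transition_def)
  have S: "dif d (snd e) q w = dif c (snd e) q (dif d (snd c) q w)" for w
    by (rule compatible_chart_differentiable(2)[OF cd c(1) ch c(2) q(1) Dce])
  have conf: "r0 * (cmod (dif d (snd e) q w))\<^sup>2 = r * (cmod w)\<^sup>2" for w
    using r(2)[of "dif d (snd c) q w"] r0(2)[of "dif d (snd c) q w"]
      compatible_chart_inverse(1)[OF cd c(1) ch c(2) q(1)] by (simp add: S)
  note O1 = oriented_transitionD[OF oc(3) c(2) q(1) ch oc(1)] and O2 = oriented_transitionD[OF oc(4) q(2) c(2) oc(2) ch]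
  have S': "dif d (snd e) q = (\<lambda>w. dif c (snd e) q (dif d (snd c) q w))"
    using S by blast
  have "linear (dif d (snd e) q)"
    unfolding S' using linear_compose[OF O1(2) O2(2)] by (simp add: o_def)
  moreover have "plane_det (dif d (snd e) q) > 0"
    unfolding S' plane_det_compose[OF O2(2) O1(2)] using O1(3) O2(3) by simp
  ultimately have "dif d (snd e) q w = w * dif d (snd e) q 1" for w
    using conf r0(1) by (rule conformal_linear)
  moreover have "dif d (snd e) q 1 \<noteq> 0"
    using conf[of 1] r(1) by auto
  ultimately show "\<exists>s. s \<noteq> 0 \<and> (\<forall>w. dif d (snd e) q w = w * s)"
    by blast
qed

text \<open>Comparison with a complex chart around the point: the transition has complex linear
  differential, and composing with it keeps the differential of F complex linear.\<close>

lemma induced_complex_chart: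
  assumes d: "d \<in> induced_structure A f"
  shows "complex_chart d"
  unfolding complex_chart_def
proof (intro conjI induced_compatible[OF d] ballI)
  fix q assume q: "q \<in> chart_dom d"
  obtain e where e: "complex_chart e" "q \<in> chart_dom e"
    using complex_chart_exists by blast
  have ce: "compatible_chart A e" "is_chart d" "is_chart e"
    using e induced_compatible[OF d] by (simp_all add: complex_chart_def compatible_chart_def)
  note T = induced_transition[OF d complex_chart_induced[OF e(1)] q e(2)]
  obtain u where u: "u \<noteq> 0" "\<And>v. dif e F q v = v *s u"
    using e by (auto simp: complex_chart_def)
  obtain s where s: "s \<noteq> 0" "\<And>w. dif d (snd e) q w = w * s"
    using T(2) by blast
  have "dif d F q v = v *s (s *s u)" for v
    using dif_change[OF ce(3,2) e(2) q T(1) F_diff[OF ce(1) e(2)], of v] by (simp add: u(2) s(2))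
  moreover have "s *s u \<noteq> 0"
    using u(1) s(1) by simp
  ultimately show "\<exists>u. u \<noteq> 0 \<and> (\<forall>v. dif d F q v = v *s u)"
    by blast
qed

lemma induced_riemann_surface: "riemann_surface (induced_structure A f)"
  unfolding riemann_surface_def
proof (intro conjI ballI)
  show "is_chart c" if "c \<in> induced_structure A f" for c
    using that by (simp add: induced_structure_def)
  show "\<Union> (chart_dom ` induced_structure A f) = UNIV"
    using complex_chart_exists complex_chart_induced by blast
  fix d e assume d: "d \<in> induced_structure A f" and e: "e \<in> induced_structure A f"
  show "transition d e holomorphic_on transition_dom d e"
  proof (rule holomorphic_onI)
    fix z assume "z \<in> transition_dom d e"
    then obtain q where q: "z = snd d q" "q \<in> chart_dom d" "q \<in> chart_dom e"
      by (auto simp: transition_dom_def)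
    note T = induced_transition[OF d e q(2,3)]
    obtain s where s: "\<And>w. dif d (snd e) q w = w * s"
      using T(2) by blast
    have "(\<lambda>v. ddir (transition d e) v (snd d q)) = times s"
      using s by (simp add: dif_ddir transition_def fun_eq_iff mult.commute)
    then have "(transition d e has_field_derivative s) (at z)"
      using has_derivative_ddir[OF T(1)] by (simp add: has_field_derivative_def q(1))
    then show "transition d e field_differentiable at z within transition_dom d e"
      unfolding field_differentiable_def by (metis has_field_derivative_at_within)
  qed
qed

lemma induced_complex_curve: "complex_curve (induced_structure A f) F"
  using induced_complex_chart complex_chart_holomorphic by (auto simp: complex_curve_def)

lemma induced_no_flex: "\<not> flex_point (induced_structure A f) F q"
proof
  assume "flex_point (induced_structure A f) F q"
  then obtain d where d: "d \<in> induced_structure A f" "q \<in> chart_dom d"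
    "wedge2 (curve_z d F q) (curve_zz d F q) = 0"
    by (auto simp: flex_point_def)
  obtain U X where "q \<in> U" "third_order_frame A f U X"
    using third_order_frame_at[OF A ell] by blast
  then have X: "q \<in> U" "first_order_frame A f U X"
    by (simp_all add: third_order_frame_def second_order_frame_def)
  show False
    using complex_chart_frame_g(2)[OF induced_complex_chart[OF d(1)] X(2,1) d(2)] d(3) by simp
qed

end

theorem totally_umbilic_complex_curve:
  assumes A: "oriented_surface A" and M: "connected (UNIV :: 'a::t2_space set)"
    and f: "totally_umbilic A (f :: 'a \<Rightarrow> real^4)"
  shows "riemann_surface (induced_structure A f)"
    "\<exists>D\<in>affine_symplectic. complex_curve (induced_structure A f) (to_C2 \<circ> affine_act D \<circ> f) \<and>
       (\<nexists>q. flex_point (induced_structure A f) (to_C2 \<circ> affine_act D \<circ> f) q)"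
proof -
  obtain Y where Y: "Y \<in> Sp4" "\<And>c q. c \<in> A \<Longrightarrow> q \<in> chart_dom c \<Longrightarrow>
      \<exists>u T. u \<noteq> 0 \<and> linear T \<and> plane_det T > 0 \<and> (\<forall>v. to_C2 (Y *v dif c f q v) = T v *s u)"
    using umbilic_complex_tangents[OF A f M] by blast
  \<comment> \<open>The translation part is zero: immersion, holomorphy and flex points are
    insensitive to translations.\<close>
  interpret E: elliptic_complex_tangents A f "(0, Y)"
    using A f Y by unfold_locales (simp_all add: totally_umbilic_def)
  show "riemann_surface (induced_structure A f)"
    by (rule E.induced_riemann_surface)
  show "\<exists>D\<in>affine_symplectic. complex_curve (induced_structure A f) (to_C2 \<circ> affine_act D \<circ> f) \<and>
       (\<nexists>q. flex_point (induced_structure A f) (to_C2 \<circ> affine_act D \<circ> f) q)"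
    using E.induced_complex_curve E.induced_no_flex Y(1)
    by (intro bexI[of _ "(0, Y)"]) (auto simp: E.F_def affine_symplectic_def)
qed

theorem proposition4:
  shows "(\<forall>(A :: 'a::t2_space chart set) (f :: 'a \<Rightarrow> real^4).
            riemann_surface A \<and> simply_connected (UNIV :: 'a set) \<and>
            complex_curve A (to_C2 \<circ> f) \<and> (\<nexists>q. flex_point A (to_C2 \<circ> f) q)
            \<longrightarrow> totally_umbilic A f) \<and>
         (\<forall>(A :: 'b::{t2_space,second_countable_topology} chart set) (f :: 'b \<Rightarrow> real^4).
            oriented_surface A \<and> connected (UNIV :: 'b set) \<and> simply_connected (UNIV :: 'b set) \<and>
            totally_umbilic A f
            \<longrightarrow> riemann_surface (induced_structure A f) \<and>
                (\<exists>D\<in>affine_symplectic.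
                   complex_curve (induced_structure A f) (to_C2 \<circ> affine_act D \<circ> f) \<and>
                   (\<nexists>q. flex_point (induced_structure A f) (to_C2 \<circ> affine_act D \<circ> f) q)))"
  using complex_curve_totally_umbilic totally_umbilic_complex_curve by blast

end
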